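(* For every integer $d\geq2$ and every $p\in(0,\infty)\setminus\mathbb{N}$, there exist $N\in\mathbb{N}$ and real numbers $a,b>0$ with $a+b<1$ such that the functions $f_1,f_2$ on $\mathbb{T}=\mathbb{R}/\mathbb{Z}$ defined by \[ f_1(x) := 1 + a\cos (2\pi x) + b\cos(2N\pi x), \qquad f_2(x) := 1 + a\cos (2\pi x) - b\cos(2N\pi x) \] violate the triangle inequality for $[\,\cdot\,]_{\mathrm{U}^{d,p}(\mathbb{T})}$, in the sense that \[ [f_1+f_2]_{\mathrm{U}^{d,p}(\mathbb{T})} > [f_1]_{\mathrm{U}^{d,p}(\mathbb{T})} + [f_2]_{\mathrm{U}^{d,p}(\mathbb{T})}. \]
   Context: $\mathbb{N}=\{1,2,3,\ldots\}$, and $\mathbb{T}=\mathbb{R}/\mathbb{Z}$ carries its normalised Haar (Lebesgue) measure. For a measurable $f\colon\mathbb{T}\to[0,\infty)$, \[ R_d f(h_1,\ldots,h_d) := \int_{\mathbb{T}} \prod_{(\omega_1,\ldots,\omega_d)\in\{0,1\}^d} f\bigl(x+\omega_1h_1+\cdots+\omega_dh_d\bigr)\,dx, \qquad [f]_{\mathrm{U}^{d,p}(\mathbb{T})} := \Bigl(\int_{\mathbb{T}^d}(R_df)^p\Bigr)^{1/(2^dp)}. \] *)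

theory Defs
  imports "HOL-Analysis.Analysis"
begin

text \<open>
  A function on the circle \<open>\<real>/\<int>\<close> is represented by a 1-periodic function on the reals, and the
  normalised Haar measure by Lebesgue measure on the fundamental domain \<open>[0,1)\<close>.
  The definitions below are meant for 1-periodic arguments only: then the value of \<open>f\<close> at a sum
  computed in the reals is its value at the sum in \<open>\<real>/\<int>\<close>, and no integral depends on the choice
  of fundamental domain.
\<close>

definition circle_measure :: "real measure" where
  "circle_measure = restrict_space lborel {0..<1}"

definition torus_measure :: "nat \<Rightarrow> (nat \<Rightarrow> real) measure" where
  "torus_measure d = (\<Pi>\<^sub>M i\<in>{..<d}. circle_measure)"

text \<open>
  Coordinates are indexed by \<open>0, \<dots>, d - 1\<close>. The integrals are Bochner integrals with real values,
  so the two definitions carry their intended meaning for nonnegative measurable \<open>f\<close> whenever the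
  integrals involved are finite, in particular for bounded \<open>f\<close>.
\<close>

definition R_op :: "nat \<Rightarrow> (real \<Rightarrow> real) \<Rightarrow> (nat \<Rightarrow> real) \<Rightarrow> real" where
  "R_op d f h =
     (LINT x|circle_measure. (\<Prod>\<omega>\<in>{..<d} \<rightarrow>\<^sub>E {0, 1}. f (x + (\<Sum>i<d. \<omega> i * h i))))"

definition U_norm :: "nat \<Rightarrow> real \<Rightarrow> (real \<Rightarrow> real) \<Rightarrow> real" where
  "U_norm d p f = (LINT h|torus_measure d. (R_op d f h) powr p) powr (1 / (2 ^ d * p))"

end

theory Submission
  imports Defs "HOL-Complex_Analysis.Complex_Analysis"
begin

text \<open>
  Write \<open>a = 2 \<alpha>\<close>, let \<open>R\<close> be the \<open>R_d\<close>-transform of \<open>1 + a cos (2 \<pi> x)\<close>, and perturb by \<open>\<plusminus> b cos (2 \<pi> N x)\<close>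
  with \<open>N > 2\<^sup>d\<close>. The term of order \<open>b\<close> integrates to zero, so \<open>R\<close> changes by \<open>b\<^sup>2 Q + O(b\<^sup>3)\<close>, where \<open>Q\<close> is a sum
  over pairs of cube vertices \<open>w, w'\<close>. If \<open>\<integral> R\<^sup>p\<^sup>-\<^sup>1 Q < 0\<close>, then both perturbed norms lie strictly below the
  unperturbed one for small \<open>b\<close>, which violates the triangle inequality.

  As \<open>\<alpha> \<rightarrow> 0\<close>, \<open>\<integral> R\<^sup>p\<^sup>-\<^sup>1 Q\<close> equals \<open>(\<alpha>\<^sup>2\<^sup>N A\<^sub>N + O(\<alpha>\<^sup>2\<^sup>N\<^sup>+\<^sup>2)) / 2\<close>. Only those monomials contribute to \<open>A\<^sub>N\<close> whose
  frequency is extremal in the direction \<open>w - w'\<close> for their order in \<open>\<alpha>\<close>, and so \<open>A\<^sub>N\<close> is the coefficient of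
  \<open>t\<^sup>N\<close> in \<open>g(t) = \<Sum> \<integral> \<Phi>(t,h)\<^sup>p\<^sup>-\<^sup>1 \<Psi>(t,h) dh\<close>, where \<open>\<Phi>\<close> and \<open>\<Psi>\<close> are monic polynomials in \<open>t\<close> with constant term 1 whose
  coefficients are squared moduli of elementary symmetric polynomials.

  Suppose that \<open>A\<^sub>N \<ge> 0\<close> for all large \<open>N\<close>. By a Pringsheim argument the power series of \<open>g\<close> converges to \<open>g\<close> on
  the whole half line; since \<open>g\<close> grows polynomially, it is a polynomial. But at infinity each summand is
  \<open>t\<^sup>m\<^sup>p\<^sup>-\<^sup>1\<close> times a power series in \<open>1/t\<close> with leading coefficient 1, where \<open>m\<close> is the degree of \<open>\<Phi>\<close>, and \<open>m = 1\<close> occurs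
  for antipodal vertices. As \<open>p\<close> is not an integer, the largest nonintegral exponent gives a contradiction.
\<close>

section \<open>Power series of a power of a polynomial with nonnegative coefficients\<close>

text \<open>The obstacle is positivity. For integral \<open>p \<ge> 1\<close> the function
  \<open>\<Phi> ^ (p - 1) * \<Psi>\<close> is a polynomial with nonnegative coefficients, so
  \<open>A_N\<close> is never negative, and for other \<open>p\<close> the sign of an individual
  integral over \<open>h\<close> is hard to see. Hence no coefficient is computed: the contradiction
  comes from nonnegativity of all late ones, and \<open>N\<close> stays inexplicit. The Pringsheim
  argument needs analyticity near the whole half line, uniformly in \<open>h\<close>. Nonnegative
  bounded coefficients and constant term 1 provide it: they keep \<open>\<Phi>\<close> free of zeros
  in a half strip of fixed width. The degree \<open>m\<close> is the number of vertices in the face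
  of the cube through \<open>w\<close> on which the coordinates where \<open>w\<close> and
  \<open>w'\<close> differ are frozen, so it varies with the pair. Pairs with the same exponent
  cannot cancel, because every leading coefficient at infinity is 1. The bound
  \<open>N > 2 ^ d\<close> is imposed because the unperturbed product has frequencies of at most
  \<open>2 ^ d\<close> in \<open>x\<close>, which cannot compensate a single cosine of frequency
  \<open>N\<close>. The constants of the estimates in \<alpha> depend on \<open>N\<close>, those in
  \<open>b\<close> on \<open>N\<close> and \<alpha>; the parameters are chosen in this
  order.\<close>

lemma norm_power_add_diff_le:
  fixes w v :: complex
  shows "norm ((w + v) ^ k - w ^ k) \<le> (norm w + norm v) ^ k - norm w ^ k"
proof (induction k)
  case (Suc k)
  have "(w + v) ^ Suc k - w ^ Suc k = (w + v) * ((w + v) ^ k - w ^ k) + v * w ^ k"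
    by (simp add: algebra_simps)
  also have "norm \<dots> \<le> norm (w + v) * norm ((w + v) ^ k - w ^ k) + norm v * norm w ^ k"
    by (metis norm_mult norm_power norm_triangle_ineq)
  also have "\<dots> \<le> (norm w + norm v) * ((norm w + norm v) ^ k - norm w ^ k) + norm v * norm w ^ k"
    by (intro add_mono mult_mono Suc.IH norm_triangle_ineq) auto
  also have "\<dots> = (norm w + norm v) ^ Suc k - norm w ^ Suc k"
    by (simp add: algebra_simps)
  finally show ?case .
qed auto

text \<open>Two regimes. Far out, \<open>Im w\<close> is small against \<open>u = Re w\<close>, so
  \<open>w ^ k\<close> stays within distance \<open>u ^ k\<close> of the positive real
  \<open>u ^ k\<close>. Otherwise \<open>norm w \<le> min 1 \<eta>\<close>, and \<open>w ^ k\<close>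
  itself is small.\<close>

lemma Re_power_half_strip:
  assumes "\<eta> > 0"
  obtains \<delta> where "\<delta> > 0"
    "\<And>w k. Re w \<ge> -\<delta> \<Longrightarrow> \<bar>Im w\<bar> \<le> \<delta> \<Longrightarrow> 1 \<le> k \<Longrightarrow> k \<le> m \<Longrightarrow> Re (w ^ k) \<ge> -\<eta>"
proof -
  \<comment> \<open>For \<open>k \<le> m\<close> this gives
    \<open>(1 + 1 / L) ^ k \<le> exp (k / L) \<le> exp (1 / 2) \<le> 2\<close>. The width \<delta>
    is scaled so that \<open>Re w < L * \<delta>\<close> forces
    \<open>norm w \<le> min 1 \<eta>\<close>.\<close>
  define L where "L = 2 * real m + 1"
  define \<delta> where "\<delta> = min 1 \<eta> / (L + 1)"
  have L: "L > 0" by (simp add: L_def)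
  have d: "\<delta> > 0" using assms L by (simp add: \<delta>_def)
  show ?thesis
  proof (rule that[OF d])
    fix w k assume w: "Re w \<ge> -\<delta>" "\<bar>Im w\<bar> \<le> \<delta>" and k: "1 \<le> k" "k \<le> m"
    show "Re (w ^ k) \<ge> -\<eta>"
    proof (cases "Re w \<ge> L * \<delta>")
      case True
      define u where "u = Re w"
      have u: "u > 0" "u \<ge> L * \<bar>Im w\<bar>" 
        using True L d w(2) unfolding u_def
        by (smt (verit, best) mult_pos_pos mult_left_mono)+
      have "norm (w ^ k - of_real u ^ k) \<le> (u + \<bar>Im w\<bar>) ^ k - u ^ k"
      proof -
        have "w = of_real u + \<i> * of_real (Im w)" by (simp add: u_def complex_eq_iff)
        then have "norm (w ^ k - of_real u ^ k) = norm ((of_real u + \<i> * of_real (Im w)) ^ k - of_real u ^ k)"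
          by simp
        also have "\<dots> \<le> (norm (of_real u :: complex) + norm (\<i> * of_real (Im w))) ^ k - norm (of_real u :: complex) ^ k"
          by (rule norm_power_add_diff_le)
        also have "\<dots> = (u + \<bar>Im w\<bar>) ^ k - u ^ k" using u by (simp add: norm_mult)
        finally show ?thesis .
      qed
      moreover have "(u + \<bar>Im w\<bar>) ^ k \<le> 2 * u ^ k"
      proof -
        have "(u + \<bar>Im w\<bar>) ^ k \<le> (u * (1 + 1 / L)) ^ k"
          using u L by (intro power_mono) (auto simp: field_simps)
        also have "\<dots> = u ^ k * (1 + 1 / L) ^ k" by (simp add: power_mult_distrib)
        also have "(1 + 1 / L) ^ k \<le> exp (1 / L) ^ k"
          using L by (intro power_mono exp_ge_add_one_self) auto
        also have "exp (1 / L) ^ k = exp (real k / L)" by (simp add: exp_of_nat_mult [symmetric])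
        also have "\<dots> \<le> exp (1 / 2)" using k L by (simp add: L_def field_simps)
        also have "exp (1 / 2 :: real) \<le> 2" 
          using exp_half_le2 by simp
        finally show ?thesis using u by (simp add: mult_left_mono mult.commute)
      qed
      ultimately have "norm (w ^ k - of_real u ^ k) \<le> u ^ k" by linarith
      then have "\<bar>Re (w ^ k - of_real u ^ k)\<bar> \<le> u ^ k"
        using abs_Re_le_cmod order_trans by blast
      then have "\<bar>Re (w ^ k) - u ^ k\<bar> \<le> u ^ k"
        by (metis Re_complex_of_real minus_complex.sel(1) of_real_power)
      then show ?thesis using assms by linarith
    next
      case False
      have "norm w \<le> \<bar>Re w\<bar> + \<bar>Im w\<bar>" by (rule cmod_le)
      also have "\<dots> \<le> L * \<delta> + \<delta>"
      proof -
        have "\<delta> \<le> L * \<delta>" using d by (simp add: L_def)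
        then show ?thesis using False w by linarith
      qed
      also have "\<dots> = (L + 1) * \<delta>" by (simp add: algebra_simps)
      also have "\<dots> = min 1 \<eta>" using L by (simp add: \<delta>_def)
      finally have n: "norm w \<le> min 1 \<eta>" .
      have "norm (w ^ k) \<le> norm w"
        using n k power_decreasing[of 1 k "norm w"] by (simp add: norm_power)
      with n have "\<bar>Re (w ^ k)\<bar> \<le> \<eta>" using abs_Re_le_cmod[of "w ^ k"] by linarith
      then show ?thesis by linarith
    qed
  qed
qed

text \<open>The coefficients are complex so that the polynomial can be evaluated off the real axis.
  The bound \<open>C\<close> makes later constants uniform over a family.\<close>

definition nonneg_poly :: "nat \<Rightarrow> real \<Rightarrow> complex poly \<Rightarrow> bool" where
  "nonneg_poly m C \<phi> \<longleftrightarrow> degree \<phi> \<le> m \<and> (\<forall>k. coeff \<phi> k = of_real (Re (coeff \<phi> k)) \<and>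
     0 \<le> Re (coeff \<phi> k) \<and> Re (coeff \<phi> k) \<le> C)"

lemma poly_eq_sum_atMost:
  fixes \<phi> :: "complex poly"
  shows "degree \<phi> \<le> m \<Longrightarrow> poly \<phi> z = (\<Sum>k\<le>m. coeff \<phi> k * z ^ k)"
  unfolding poly_altdef by (intro sum.mono_neutral_left) (auto simp: coeff_eq_0)

lemma nonneg_poly_norm_le:
  assumes "nonneg_poly m C \<phi>" "norm z \<le> r"
  shows "norm (poly \<phi> z) \<le> (\<Sum>k\<le>m. C * r ^ k)"
proof -
  have "norm (poly \<phi> z) \<le> (\<Sum>k\<le>m. norm (coeff \<phi> k * z ^ k))"
    using assms by (simp add: poly_eq_sum_atMost[of \<phi> m] nonneg_poly_def norm_sum)
  also have "\<dots> \<le> (\<Sum>k\<le>m. C * r ^ k)"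
  proof (rule sum_mono)
    fix k
    have "norm (coeff \<phi> k) \<le> C" using assms(1) unfolding nonneg_poly_def
      by (metis norm_of_real abs_of_nonneg)
    moreover have "0 \<le> C" using assms(1) unfolding nonneg_poly_def by (meson order_trans)
    ultimately show "norm (coeff \<phi> k * z ^ k) \<le> C * r ^ k"
      using assms(2) by (auto simp: norm_mult norm_power intro!: mult_mono power_mono)
  qed
  finally show ?thesis .
qed

text \<open>The constant term contributes 1, and by \<open>Re_power_half_strip\<close> each of the
  other \<open>m\<close> terms can take away only little. The width depends on \<open>m\<close> and
  \<open>C\<close> alone, so a whole family shares one zero-free half strip.\<close>

lemma nonneg_poly_Re_ge:
  obtains \<delta> where "\<delta> > 0"
    "\<And>\<phi> w. nonneg_poly m C \<phi> \<Longrightarrow> coeff \<phi> 0 = 1 \<Longrightarrow> Re w \<ge> -\<delta> \<Longrightarrow> \<bar>Im w\<bar> \<le> \<delta> \<Longrightarrow> Re (poly \<phi> w) \<ge> 1 / 2"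
proof -
  \<comment> \<open>Chosen so that \<open>(\<bar>C\<bar> + 1) * \<eta> = 1 / (2 * (m + 1))\<close>;
    the \<open>m\<close> terms then lose at most 1/2 in total.\<close>
  define \<eta> where "\<eta> = 1 / (2 * (real m + 1) * (\<bar>C\<bar> + 1))"
  have eta: "\<eta> > 0" unfolding \<eta>_def by (intro divide_pos_pos mult_pos_pos) auto
  obtain \<delta> where \<delta>: "\<delta> > 0"
    "\<And>w k. Re w \<ge> -\<delta> \<Longrightarrow> \<bar>Im w\<bar> \<le> \<delta> \<Longrightarrow> 1 \<le> k \<Longrightarrow> k \<le> m \<Longrightarrow> Re (w ^ k) \<ge> -\<eta>"
    using Re_power_half_strip[OF eta] by metis
  show ?thesis
  proof (rule that[OF \<delta>(1)])
    fix \<phi> w assume p: "nonneg_poly m C \<phi>" "coeff \<phi> 0 = 1" and w: "Re w \<ge> -\<delta>" "\<bar>Im w\<bar> \<le> \<delta>"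
    have "Re (poly \<phi> w) = (\<Sum>k\<le>m. Re (coeff \<phi> k * w ^ k))"
      using p by (simp add: poly_eq_sum_atMost[of \<phi> m] nonneg_poly_def)
    also have "\<dots> = 1 + (\<Sum>k\<in>{1..m}. Re (coeff \<phi> k * w ^ k))"
      by (simp add: p(2) atMost_atLeast0 sum.atLeast_Suc_atMost)
    finally have 1: "Re (poly \<phi> w) = 1 + (\<Sum>k\<in>{1..m}. Re (coeff \<phi> k * w ^ k))" .
    have "(\<Sum>k\<in>{1..m}. - ((\<bar>C\<bar> + 1) * \<eta>)) \<le> (\<Sum>k\<in>{1..m}. Re (coeff \<phi> k * w ^ k))"
    proof (rule sum_mono)
      fix k assume k: "k \<in> {1..m}"
      define c where "c = Re (coeff \<phi> k)"
      have c: "coeff \<phi> k = of_real c" "0 \<le> c" "c \<le> \<bar>C\<bar> + 1"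
        using p(1) unfolding nonneg_poly_def c_def by (auto intro: order_trans[of _ C])
      have "Re (coeff \<phi> k * w ^ k) = c * Re (w ^ k)" by (simp add: c)
      moreover have "c * Re (w ^ k) \<ge> c * (-\<eta>)"
        using \<delta>(2)[OF w] k c by (intro mult_left_mono) auto
      moreover have "c * \<eta> \<le> (\<bar>C\<bar> + 1) * \<eta>" using c eta by (intro mult_right_mono) auto
      ultimately show "- ((\<bar>C\<bar> + 1) * \<eta>) \<le> Re (coeff \<phi> k * w ^ k)" by simp
    qed
    moreover have "(\<Sum>k\<in>{1..m}. - ((\<bar>C\<bar> + 1) * \<eta>)) = - (real m * ((\<bar>C\<bar> + 1) * \<eta>))" by simp
    moreover have "real m * ((\<bar>C\<bar> + 1) * \<eta>) \<le> 1 / 2"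
    proof -
      define K where "K = \<bar>C\<bar> + 1"
      have "K > 0" by (simp add: K_def)
      then have "K * \<eta> = 1 / (2 * (real m + 1))" unfolding \<eta>_def K_def [symmetric] by simp
      then have "(\<bar>C\<bar> + 1) * \<eta> = 1 / (2 * (real m + 1))" by (simp only: K_def)
      moreover have "real m * (1 / (2 * (real m + 1))) \<le> 1 / 2" by (simp add: field_simps)
      ultimately show ?thesis by (simp only:)
    qed
    ultimately show "Re (poly \<phi> w) \<ge> 1 / 2" using 1 by linarith
  qed
qed

section \<open>Taylor coefficients of a complex power of a polynomial\<close>

text \<open>Coefficient of \<open>t ^ N\<close> in \<open>\<phi> powr q * \<psi>\<close> by the
  binomial series in \<open>\<phi> - 1\<close>. If \<phi> has constant term 1, then
  \<open>(\<phi> - 1) ^ k\<close> starts at \<open>t ^ k\<close>, hence the cut-off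
  \<open>k \<le> N\<close>.\<close>

definition powr_coeff :: "complex \<Rightarrow> complex poly \<Rightarrow> complex poly \<Rightarrow> nat \<Rightarrow> complex" where
  "powr_coeff q \<phi> \<psi> N = (\<Sum>k\<le>N. (q gchoose k) * coeff ((\<phi> - 1) ^ k * \<psi>) N)"

lemma poly_has_fps_expansion:
  fixes \<phi> :: "complex poly"
  shows "poly \<phi> has_fps_expansion fps_of_poly \<phi>"
proof (induction \<phi>)
  case (pCons a \<phi>)
  have "(\<lambda>x. a + x * poly \<phi> x) has_fps_expansion fps_const a + fps_X * fps_of_poly \<phi>"
    by (intro fps_expansion_intros pCons.IH)
  then show ?case by (simp add: fps_of_poly_pCons mult.commute)
qed auto

lemma powr_poly_has_fps_expansion:
  assumes "coeff \<phi> 0 = 1"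
  shows "(\<lambda>t. poly \<phi> t powr q * poly \<psi> t) has_fps_expansion Abs_fps (powr_coeff q \<phi> \<psi>)"
proof -
  define G where "G = fps_of_poly (\<phi> - 1)"
  have G0: "fps_nth G 0 = 0" by (simp add: G_def assms)
  have e: "poly \<theta> has_fps_expansion fps_of_poly \<theta>" for \<theta> :: "complex poly"
    by (rule poly_has_fps_expansion)
  have "((\<lambda>x. (1 + x) powr q) \<circ> poly (\<phi> - 1)) has_fps_expansion (fps_binomial q oo G)"
    unfolding G_def by (intro has_fps_expansion_compose has_fps_expansion_binomial_complex e) (simp add: assms)
  then have "(\<lambda>t. ((\<lambda>x. (1 + x) powr q) \<circ> poly (\<phi> - 1)) t * poly \<psi> t) has_fps_expansion (fps_binomial q oo G) * fps_of_poly \<psi>"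
    by (intro has_fps_expansion_mult e)
  moreover have "(fps_binomial q oo G) * fps_of_poly \<psi> = Abs_fps (powr_coeff q \<phi> \<psi>)"
  proof (rule fps_ext)
    fix N
    \<comment> \<open>All indices \<open>i \<le> N\<close> get the same range
      \<open>k \<le> N\<close>, since \<open>G ^ k\<close> has no terms below index
      \<open>k\<close>; the two sums can then be exchanged.\<close>
    have c: "fps_nth (fps_binomial q oo G) i = (\<Sum>k\<le>N. (q gchoose k) * fps_nth (G ^ k) i)" if "i \<le> N" for i
    proof -
      have "fps_nth (fps_binomial q oo G) i = (\<Sum>k=0..i. (q gchoose k) * fps_nth (G ^ k) i)"
        by (simp add: fps_compose_nth)
      also have "\<dots> = (\<Sum>k\<le>N. (q gchoose k) * fps_nth (G ^ k) i)"
        using that startsby_zero_power_prefix[OF G0] by (intro sum.mono_neutral_left) auto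
      finally show ?thesis .
    qed
    have "fps_nth ((fps_binomial q oo G) * fps_of_poly \<psi>) N
        = (\<Sum>i=0..N. \<Sum>k\<le>N. (q gchoose k) * (fps_nth (G ^ k) i * coeff \<psi> (N - i)))"
      by (simp add: fps_mult_nth c sum_distrib_right mult.assoc)
    also have "\<dots> = (\<Sum>k\<le>N. (q gchoose k) * (\<Sum>i=0..N. fps_nth (G ^ k) i * coeff \<psi> (N - i)))"
      by (subst sum.swap) (simp add: sum_distrib_left)
    also have "\<dots> = (\<Sum>k\<le>N. (q gchoose k) * fps_nth (G ^ k * fps_of_poly \<psi>) N)"
      by (simp add: fps_mult_nth)
    also have "\<dots> = powr_coeff q \<phi> \<psi> N"
      by (simp add: powr_coeff_def G_def flip: fps_of_poly_power fps_of_poly_mult)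
    finally show "fps_nth ((fps_binomial q oo G) * fps_of_poly \<psi>) N = fps_nth (Abs_fps (powr_coeff q \<phi> \<psi>)) N"
      by simp
  qed
  ultimately show ?thesis by simp
qed

text \<open>For a real exponent the modulus depends on \<open>norm z\<close> only, which lies
  between 1/2 and \<open>D\<close>.\<close>

lemma norm_powr_of_real_le:
  fixes z :: complex
  assumes "Re z \<ge> 1 / 2" "norm z \<le> D"
  shows "norm (z powr of_real q) \<le> exp (\<bar>q\<bar> * (ln 2 + ln (max 1 D)))"
proof -
  have z: "z \<noteq> 0" "norm z \<ge> 1 / 2" using assms(1) complex_Re_le_cmod[of z] by auto
  have "norm (z powr of_real q) = exp (q * ln (norm z))"
    using z by (simp add: powr_def)
  also have "q * ln (norm z) \<le> \<bar>q\<bar> * \<bar>ln (norm z)\<bar>"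
    by (metis abs_ge_self abs_mult)
  also have "\<bar>ln (norm z)\<bar> \<le> ln 2 + ln (max 1 D)"
  proof -
    have "ln (norm z) \<le> ln (max 1 D)" using z assms by (intro ln_mono) auto
    moreover have "ln (1 / 2) \<le> ln (norm z)" using z by (intro ln_mono) auto
    moreover have "ln (1 / 2 :: real) = - ln 2" by (simp add: ln_div)
    moreover have "ln (2::real) > 0" "ln (max 1 D) \<ge> 0" by auto
    ultimately show ?thesis by linarith
  qed
  finally show ?thesis by (simp add: mult_left_mono)
qed

section \<open>Integrals over families of polynomials\<close>

text \<open>In the application \<open>M\<close> is the torus of all \<open>h\<close>. Degree and
  coefficient bounds are the same at every point \<open>x\<close>, so the estimates are uniform in
  \<open>x\<close> and survive integration.\<close>

locale nonneg_poly_family = finite_measure M for M :: "'x measure" +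
  fixes m m' :: nat and C :: real and \<Phi> \<Psi> :: "'x \<Rightarrow> complex poly" and q :: real
  assumes \<Phi>: "\<And>x. x \<in> space M \<Longrightarrow> nonneg_poly m C (\<Phi> x)" "\<And>x. x \<in> space M \<Longrightarrow> coeff (\<Phi> x) 0 = 1"
    and \<Psi>: "\<And>x. x \<in> space M \<Longrightarrow> nonneg_poly m' C (\<Psi> x)"
    and meas_\<Phi>: "\<And>k. (\<lambda>x. coeff (\<Phi> x) k) \<in> borel_measurable M"
    and meas_\<Psi>: "\<And>k. (\<lambda>x. coeff (\<Psi> x) k) \<in> borel_measurable M"
begin

definition F :: "'x \<Rightarrow> complex \<Rightarrow> complex" where
  "F x w = poly (\<Phi> x) w powr of_real q * poly (\<Psi> x) w"

definition coeffs_int :: "nat \<Rightarrow> complex" where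
  "coeffs_int N = (LINT x|M. powr_coeff (of_real q) (\<Phi> x) (\<Psi> x) N)"

lemma measurable_powr_coeff: "(\<lambda>x. powr_coeff c (\<Phi> x) (\<Psi> x) N) \<in> borel_measurable M"
proof -
  have "(\<lambda>x. coeff ((\<Phi> x - 1) ^ k * \<Psi> x) N) \<in> borel_measurable M" for k N
  proof (induction k arbitrary: N)
    case 0
    show ?case using meas_\<Psi> by simp
  next
    case (Suc k)
    have "(\<lambda>x. \<Sum>i\<le>N. (coeff (\<Phi> x) i - coeff 1 i) * coeff ((\<Phi> x - 1) ^ k * \<Psi> x) (N - i)) \<in> borel_measurable M"
      by (intro borel_measurable_sum borel_measurable_times borel_measurable_diff Suc meas_\<Phi>) auto
    then show ?case by (simp add: coeff_mult[of "\<Phi> _ - 1"] mult.assoc)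
  qed
  then show ?thesis unfolding powr_coeff_def by (intro borel_measurable_sum borel_measurable_times) auto
qed

definition in_strip :: "real \<Rightarrow> complex \<Rightarrow> bool" where
  "in_strip \<delta> w \<longleftrightarrow> Re w \<ge> -\<delta> \<and> \<bar>Im w\<bar> \<le> \<delta>"

text \<open>Real part at least 1/2 keeps the values off the branch cut, so the complex power is
  holomorphic, and away from 0, so that negative exponents stay bounded.\<close>

definition good_width :: "real \<Rightarrow> bool" where
  "good_width \<delta> \<longleftrightarrow> \<delta> > 0 \<and> (\<forall>x\<in>space M. \<forall>w. in_strip \<delta> w \<longrightarrow> Re (poly (\<Phi> x) w) \<ge> 1 / 2)"

lemma ex_good_width: "\<exists>\<delta>. good_width \<delta>"
proof -
  obtain \<delta> where "\<delta> > 0"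
    "\<And>\<phi> w. nonneg_poly m C \<phi> \<Longrightarrow> coeff \<phi> 0 = 1 \<Longrightarrow> Re w \<ge> -\<delta> \<Longrightarrow> \<bar>Im w\<bar> \<le> \<delta> \<Longrightarrow> Re (poly \<phi> w) \<ge> 1 / 2"
    using nonneg_poly_Re_ge by metis
  then show ?thesis unfolding good_width_def in_strip_def using \<Phi> by (intro exI[of _ \<delta>]) auto
qed

lemma good_width_mono: "good_width \<delta> \<Longrightarrow> 0 < \<epsilon> \<Longrightarrow> \<epsilon> \<le> \<delta> \<Longrightarrow> good_width \<epsilon>"
  unfolding good_width_def in_strip_def by (meson le_minus_iff order_trans neg_le_iff_le)

lemma F_bounded:
  assumes "good_width \<delta>"
  shows "\<exists>B>0. \<forall>x\<in>space M. \<forall>w. in_strip \<delta> w \<and> norm w \<le> r \<longrightarrow> norm (F x w) \<le> B"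
proof -
  define D where "D = (\<Sum>k\<le>m. C * r ^ k)"
  define D' where "D' = (\<Sum>k\<le>m'. C * r ^ k)"
  define E where "E = exp (\<bar>q\<bar> * (ln 2 + ln (max 1 D)))"
  show ?thesis
  proof (intro exI conjI ballI allI impI)
    show "0 < E * \<bar>D'\<bar> + 1" unfolding E_def by (simp add: add_nonneg_pos)
    fix x w assume x: "x \<in> space M" and w: "in_strip \<delta> w \<and> norm w \<le> r"
    have "norm (F x w) = norm (poly (\<Phi> x) w powr of_real q) * norm (poly (\<Psi> x) w)"
      by (simp add: F_def norm_mult)
    also have "\<dots> \<le> E * D'"
    proof (rule mult_mono)
      show "norm (poly (\<Phi> x) w powr of_real q) \<le> E"
        unfolding E_def using assms x w \<Phi>(1)[OF x] nonneg_poly_norm_le[of m C "\<Phi> x" w r]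
        by (intro norm_powr_of_real_le) (auto simp: good_width_def D_def)
      show "norm (poly (\<Psi> x) w) \<le> D'"
        using nonneg_poly_norm_le[OF \<Psi>[OF x]] w by (auto simp: D'_def)
    qed (auto simp: E_def)
    also have "E * D' \<le> E * \<bar>D'\<bar> + 1" unfolding E_def by (simp add: mult_left_mono add_increasing2)
    finally show "norm (F x w) \<le> E * \<bar>D'\<bar> + 1" .
  qed
qed

text \<open>Taylor coefficients of \<open>F x (g s)\<close> in \<open>s\<close> by formal
  composition; the sum stops at \<open>n\<close> because \<open>G\<close> has no constant term. Two
  maps \<open>g\<close> into the half strip occur: the identity and a logarithm.\<close>

definition subst_coeff :: "complex fps \<Rightarrow> 'x \<Rightarrow> nat \<Rightarrow> complex" where
  "subst_coeff G x n = (\<Sum>N\<le>n. powr_coeff (of_real q) (\<Phi> x) (\<Psi> x) N * fps_nth (G ^ N) n)"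

context
  fixes \<delta> :: real and r :: real and g :: "complex \<Rightarrow> complex" and G :: "complex fps"
  assumes \<delta>: "good_width \<delta>" and r: "r > 0" and g: "g holomorphic_on ball 0 r" "g has_fps_expansion G" "fps_nth G 0 = 0"
    and strip: "\<And>s. s \<in> ball 0 r \<Longrightarrow> in_strip \<delta> (g s)"
begin

lemma subst_holomorphic:
  assumes "x \<in> space M"
  shows "(\<lambda>s. F x (g s)) holomorphic_on ball 0 r"
proof -
  have "poly (\<Phi> x) (g s) \<notin> \<real>\<^sub>\<le>\<^sub>0" if "s \<in> ball 0 r" for s
  proof -
    have "Re (poly (\<Phi> x) (g s)) \<ge> 1 / 2" using \<delta> strip[OF that] assms by (auto simp: good_width_def)
    then show ?thesis by (auto simp: complex_nonpos_Reals_iff)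
  qed
  moreover have "(\<lambda>s. poly p (g s)) holomorphic_on ball 0 r" for p
    using holomorphic_on_compose[OF g(1), of "poly p"] by (simp add: o_def poly_holomorphic_on)
  ultimately show ?thesis unfolding F_def by (intro holomorphic_on_mult holomorphic_on_powr_right holomorphic_on_powr holomorphic_on_const) auto
qed

lemma subst_fps:
  assumes "x \<in> space M"
  shows "(\<lambda>s. F x (g s)) has_fps_expansion Abs_fps (subst_coeff G x)"
proof -
  have "(F x \<circ> g) has_fps_expansion (Abs_fps (powr_coeff (of_real q) (\<Phi> x) (\<Psi> x)) oo G)"
    unfolding F_def using powr_poly_has_fps_expansion[OF \<Phi>(2)[OF assms]] g by (intro has_fps_expansion_compose) auto
  moreover have "(Abs_fps (powr_coeff (of_real q) (\<Phi> x) (\<Psi> x)) oo G) = Abs_fps (subst_coeff G x)"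
    by (rule fps_ext) (simp add: fps_compose_nth subst_coeff_def atMost_atLeast0)
  ultimately show ?thesis by (simp add: o_def)
qed

text \<open>Cauchy's inequality on the circle of radius \<rho>. The map \<open>g\<close> takes the
  closed disc into a bounded piece of the half strip, where \<open>F x\<close> has a bound that is
  the same for all \<open>x\<close>.\<close>

lemma subst_coeff_bound:
  assumes "0 < \<rho>" "\<rho> < r"
  shows "\<exists>B>0. \<forall>x\<in>space M. \<forall>n. norm (subst_coeff G x n) \<le> B / \<rho> ^ n"
proof -
  have "compact (g ` cball 0 \<rho>)"
    using assms g(1) by (intro compact_continuous_image holomorphic_on_imp_continuous_on)
      (auto elim!: holomorphic_on_subset)
  then obtain W where W: "\<And>s. s \<in> cball 0 \<rho> \<Longrightarrow> norm (g s) \<le> W"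
    by (meson bounded_iff compact_imp_bounded imageI)
  obtain B where B: "B > 0" "\<And>x w. x \<in> space M \<Longrightarrow> in_strip \<delta> w \<Longrightarrow> norm w \<le> W \<Longrightarrow> norm (F x w) \<le> B"
    using F_bounded[OF \<delta>, of W] by blast
  show ?thesis
  proof (intro exI conjI ballI allI)
    fix x n assume x: "x \<in> space M"
    have h: "(\<lambda>s. F x (g s)) holomorphic_on cball 0 \<rho>"
      using subst_holomorphic[OF x] assms by (auto elim!: holomorphic_on_subset)
    have "norm ((deriv ^^ n) (\<lambda>s. F x (g s)) 0) \<le> fact n * B / \<rho> ^ n"
    proof (rule Cauchy_inequality)
      show "(\<lambda>s. F x (g s)) holomorphic_on ball 0 \<rho>" using h by (auto elim!: holomorphic_on_subset)
      show "continuous_on (cball 0 \<rho>) (\<lambda>s. F x (g s))" using h by (rule holomorphic_on_imp_continuous_on)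
      fix s :: complex assume "norm (0 - s) = \<rho>"
      then show "norm (F x (g s)) \<le> B" using W[of s] strip[of s] assms x by (intro B) auto
    qed (use assms in auto)
    moreover have "subst_coeff G x n = (deriv ^^ n) (\<lambda>s. F x (g s)) 0 / fact n"
      using fps_nth_fps_expansion[OF subst_fps[OF x], of n] by simp
    ultimately show "norm (subst_coeff G x n) \<le> B / \<rho> ^ n"
      using divide_right_mono[of _ _ "fact n"] by (fastforce simp: norm_divide)
  qed (use B in auto)
qed

lemma integrable_subst_coeff:
  "integrable M (\<lambda>x. subst_coeff G x n)"
proof -
  obtain B where "\<forall>x\<in>space M. norm (subst_coeff G x n) \<le> B / (r / 2) ^ n"
    using subst_coeff_bound[of "r / 2"] r by auto
  then show ?thesis
    by (intro integrable_const_bound[of _ "B / (r / 2) ^ n"] AE_I2)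
      (auto simp: subst_coeff_def intro!: borel_measurable_sum borel_measurable_times measurable_powr_coeff)
qed

text \<open>A radius \<rho> strictly between \<open>norm s\<close> and \<open>r\<close> turns the
  Cauchy bounds into a geometric majorant independent of \<open>x\<close>, which permits the
  exchange of series and integral.\<close>

lemma subst_sums_aux:
  assumes "s \<in> ball 0 r"
  shows "(\<lambda>n. (LINT x|M. subst_coeff G x n) * s ^ n) sums (LINT x|M. F x (g s))" (is ?th)
    and "integrable M (\<lambda>x. F x (g s))" (is ?int)
proof -
  obtain \<rho> where \<rho>: "norm s < \<rho>" "\<rho> < r" using assms dense[of "norm s" r] by auto
  then have "\<rho> > 0" using norm_ge_zero[of s] by linarith
  then obtain B where B: "B > 0" "\<And>x n. x \<in> space M \<Longrightarrow> norm (subst_coeff G x n) \<le> B / \<rho> ^ n"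
    using subst_coeff_bound[OF _ \<rho>(2)] by blast
  define t where "t = norm s / \<rho>"
  have t: "0 \<le> t" "t < 1" using \<rho> \<open>\<rho> > 0\<close> by (auto simp: t_def)
  have bd: "norm (subst_coeff G x n * s ^ n) \<le> B * t ^ n" if "x \<in> space M" for x n
    using mult_right_mono[OF B(2)[OF that, of n], of "norm s ^ n"]
    by (simp add: norm_mult norm_power t_def power_divide)
  have summ: "summable (\<lambda>n. B * t ^ n)" using t by (intro summable_mult summable_geometric) auto
  have int: "integrable M (\<lambda>x. subst_coeff G x n * s ^ n)" for n
    by (intro integrable_mult_left integrable_subst_coeff)
  have S: "(\<lambda>n. subst_coeff G x n * s ^ n) sums F x (g s)" if "x \<in> space M" for x
    using has_fps_expansion_imp_sums_complex[OF subst_fps[OF that], of "ereal r" s] subst_holomorphic[OF that] assms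
    by simp
  have *: "AE x in M. summable (\<lambda>n. norm (subst_coeff G x n * s ^ n))"
    by (intro AE_I2 summable_comparison_test'[OF summ]) (use bd in auto)
  have **: "summable (\<lambda>n. LINT x|M. norm (subst_coeff G x n * s ^ n))"
  proof (rule summable_comparison_test'[OF summable_mult[OF summ, of "measure M (space M)"]])
    fix n
    have "(LINT x|M. norm (subst_coeff G x n * s ^ n)) \<le> (LINT x|M. B * t ^ n)"
      by (intro integral_mono integrable_norm int) (auto intro: bd)
    then show "norm (LINT x|M. norm (subst_coeff G x n * s ^ n)) \<le> measure M (space M) * (B * t ^ n)"
      by simp
  qed
  have eq: "(LINT x|M. (\<Sum>n. subst_coeff G x n * s ^ n)) = (LINT x|M. F x (g s))"
    by (intro Bochner_Integration.integral_cong refl sums_unique[symmetric] S)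
  show ?th
    using sums_integral[OF int * **] unfolding eq by simp
  show ?int
    using integrable_suminf[OF int * **]
    by (subst Bochner_Integration.integrable_cong[OF refl, of _ _ "\<lambda>x. \<Sum>n. subst_coeff G x n * s ^ n"])
      (auto dest!: S simp: sums_iff)
qed

end

text \<open>The case \<open>g s = s\<close> on the disc of radius \<delta>, which lies in the half
  strip.\<close>

lemma integrable_powr_coeff: "integrable M (\<lambda>x. powr_coeff (of_real q) (\<Phi> x) (\<Psi> x) N)"
proof -
  obtain \<delta> where \<delta>: "good_width \<delta>" using ex_good_width by blast
  have d: "\<delta> > 0" using \<delta> by (simp add: good_width_def)
  have s: "in_strip \<delta> (id s)" if "s \<in> ball 0 \<delta>" for s
    using that abs_Re_le_cmod[of s] abs_Im_le_cmod[of s] by (simp add: in_strip_def)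
  have "integrable M (\<lambda>x. subst_coeff fps_X x N)"
    by (rule integrable_subst_coeff[OF \<delta> d _ _ _ s])
      (auto simp: id_def intro!: fps_expansion_intros holomorphic_intros)
  moreover have "subst_coeff fps_X x N = powr_coeff (of_real q) (\<Phi> x) (\<Psi> x) N" for x
  proof -
    have "subst_coeff fps_X x N = (\<Sum>k\<in>{N}. powr_coeff (of_real q) (\<Phi> x) (\<Psi> x) k * fps_nth (fps_X ^ k) N)"
      unfolding subst_coeff_def by (intro sum.mono_neutral_right) auto
    then show ?thesis by simp
  qed
  ultimately show ?thesis by simp
qed

lemma subst_sums:
  assumes "good_width \<delta>" "r > 0" "g holomorphic_on ball 0 r" "g has_fps_expansion G" "fps_nth G 0 = 0"
    and "\<And>s. s \<in> ball 0 r \<Longrightarrow> in_strip \<delta> (g s)" and "s \<in> ball 0 r"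
  shows "(\<lambda>n. (\<Sum>N\<le>n. coeffs_int N * fps_nth (G ^ N) n) * s ^ n) sums (LINT x|M. F x (g s))"
    and "integrable M (\<lambda>x. F x (g s))"
proof -
  have "(LINT x|M. subst_coeff G x n) = (\<Sum>N\<le>n. coeffs_int N * fps_nth (G ^ N) n)" for n
    unfolding subst_coeff_def coeffs_int_def
    by (subst Bochner_Integration.integral_sum) (auto intro!: integrable_mult_left integrable_powr_coeff)
  then show "(\<lambda>n. (\<Sum>N\<le>n. coeffs_int N * fps_nth (G ^ N) n) * s ^ n) sums (LINT x|M. F x (g s))"
    using subst_sums_aux(1)[OF assms] by simp
  show "integrable M (\<lambda>x. F x (g s))" by (rule subst_sums_aux(2)[OF assms])
qed

end

section \<open>The logarithmic substitution\<close>

lemma nonneg_Reals_fps_power: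
  fixes G :: "complex fps"
  assumes "\<And>n. fps_nth G n \<in> \<real>\<^sub>\<ge>\<^sub>0"
  shows "fps_nth (G ^ N) n \<in> \<real>\<^sub>\<ge>\<^sub>0"
proof (induction N arbitrary: n)
  case (Suc N)
  have sum: "sum f A \<in> \<real>\<^sub>\<ge>\<^sub>0" if "\<And>i. f i \<in> \<real>\<^sub>\<ge>\<^sub>0" for f :: "nat \<Rightarrow> complex" and A
    by (induction A rule: infinite_finite_induct) (auto intro!: nonneg_Reals_add_I that)
  show ?case
    unfolding power_Suc fps_mult_nth
    by (intro sum nonneg_Reals_mult_I assms Suc)
qed (auto simp: fps_one_nth)

lemma neg_Ln_fps_expansion:
  assumes "c \<ge> 0"
  obtains G :: "complex fps" where
    "(\<lambda>s. - of_real c * Ln (1 - s)) has_fps_expansion G" "fps_nth G 0 = 0"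
    "\<And>n. fps_nth G n \<in> \<real>\<^sub>\<ge>\<^sub>0"
proof -
  \<comment> \<open>The entry at \<open>n = 0\<close> is \<open>c / 0 = 0\<close> by convention,
    which is the required constant term.\<close>
  define G where "G = Abs_fps (\<lambda>n. of_real (c / real n) :: complex)"
  have "eventually (\<lambda>s. s \<in> ball 0 1) (nhds (0::complex))"
    by (intro eventually_nhds_in_open) auto
  then have "eventually (\<lambda>s. (\<lambda>n. fps_nth G n * s ^ n) sums (- of_real c * Ln (1 - s))) (nhds 0)"
  proof eventually_elim
    case (elim s)
    have "(\<lambda>n. (-1) ^ Suc n / of_nat n * (- s) ^ n) sums Ln (1 + - s)"
      using elim by (intro Ln_series) auto
    from sums_mult[OF this, of "- of_real c"]
    have "(\<lambda>n. - of_real c * ((-1) ^ Suc n / of_nat n * (- s) ^ n)) sums (- of_real c * Ln (1 - s))"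
      by simp
    moreover have "- of_real c * ((-1) ^ Suc n / of_nat n * (- s) ^ n) = fps_nth G n * s ^ n" for n
      by (simp add: G_def power_minus[of s] field_simps)
    ultimately show ?case by simp
  qed
  then show ?thesis
    using assms by (intro that[of G] has_fps_expansionI) (auto simp: G_def)
qed

text \<open>The number \<open>1 - s\<close> lies in the right half plane and has modulus at most 2.
  Its argument is below \<open>pi / 2 < 2\<close> in absolute value and the logarithm of its modulus
  is at most \<open>ln 2 < 2\<close>, so the factor \<open>\<delta> / 2\<close> brings both within
  \<delta>.\<close>

lemma strip_neg_Ln:
  assumes "\<delta> > 0" "norm s < 1"
  shows "Re (- of_real (\<delta> / 2) * Ln (1 - s)) \<ge> -\<delta>" "\<bar>Im (- of_real (\<delta> / 2) * Ln (1 - s))\<bar> \<le> \<delta>"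
proof -
  have re: "Re (1 - s) > 0" using assms(2) abs_Re_le_cmod[of s] by auto
  then have nz: "1 - s \<noteq> 0" by auto
  have "\<bar>Im (Ln (1 - s))\<bar> < pi / 2" using Re_Ln_pos_lt_imp re by blast
  then have "\<bar>Im (Ln (1 - s))\<bar> \<le> 2" using pi_less_4 by linarith
  then have "(\<delta> / 2) * \<bar>Im (Ln (1 - s))\<bar> \<le> (\<delta> / 2) * 2" using assms by (intro mult_left_mono) auto
  then show "\<bar>Im (- of_real (\<delta> / 2) * Ln (1 - s))\<bar> \<le> \<delta>"
    using assms(1) by (simp add: abs_mult)
  have "norm (1 - s) \<le> 2" using assms norm_triangle_ineq4[of 1 s] by simp
  then have "ln (norm (1 - s)) \<le> ln 2" using nz by (intro ln_mono) auto
  also have "ln 2 < (2::real)" using ln_less_self[of 2] by simp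
  finally have "(\<delta> / 2) * ln (norm (1 - s)) \<le> (\<delta> / 2) * 2" using assms by (intro mult_left_mono) auto
  then show "Re (- of_real (\<delta> / 2) * Ln (1 - s)) \<ge> -\<delta>" using nz by simp
qed

context nonneg_poly_family
begin

definition gen_fun :: "real \<Rightarrow> real" where
  "gen_fun t = (LINT x|M. Re (poly (\<Phi> x) (of_real t)) powr q * Re (poly (\<Psi> x) (of_real t)))"

lemma poly_of_real_Reals:
  assumes "nonneg_poly k C \<phi>"
  shows "poly \<phi> (of_real t) = of_real (Re (poly \<phi> (of_real t)))"
proof -
  have "poly \<phi> (of_real t) = (\<Sum>i\<le>degree \<phi>. of_real (Re (coeff \<phi> i) * t ^ i))"
    using assms unfolding poly_altdef nonneg_poly_def by (intro sum.cong) auto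
  then show ?thesis by simp
qed

lemma F_of_real:
  assumes "x \<in> space M" "0 < Re (poly (\<Phi> x) (of_real t))"
  shows "F x (of_real t) = of_real (Re (poly (\<Phi> x) (of_real t)) powr q * Re (poly (\<Psi> x) (of_real t)))"
  unfolding F_def using assms
  by (subst (1 2) poly_of_real_Reals) (auto intro: \<Phi> \<Psi> simp: powr_of_real)

lemma integral_F_of_real:
  assumes "good_width \<delta>" "t \<ge> -\<delta>"
  shows "(LINT x|M. F x (of_real t)) = of_real (gen_fun t)"
proof -
  have "(LINT x|M. F x (of_real t)) = (LINT x|M. complex_of_real (Re (poly (\<Phi> x) (of_real t)) powr q * Re (poly (\<Psi> x) (of_real t))))"
  proof (intro Bochner_Integration.integral_cong refl F_of_real)
    fix x assume "x \<in> space M"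
    then have "Re (poly (\<Phi> x) (of_real t)) \<ge> 1 / 2" using assms by (auto simp: good_width_def in_strip_def)
    then show "0 < Re (poly (\<Phi> x) (of_real t))" by linarith
  qed
  then show ?thesis by (simp add: gen_fun_def del: of_real_mult)
qed

text \<open>
  The substitution \<open>t = - (\<delta> / 2) ln (1 - s)\<close> has nonnegative coefficients, takes \<open>[0, 1)\<close> onto \<open>[0, \<infinity>)\<close>, and maps
  the unit disc into a half strip on which \<open>\<Phi>\<close> has no zeros. Hence, if the coefficients in \<open>t\<close> are nonnegative
  from some index on, then their series converges on the whole half line.
\<close>
lemma gen_fun_sums:
  assumes \<delta>: "good_width \<delta>" and G: "(\<lambda>s. - of_real (\<delta> / 2) * Ln (1 - s)) has_fps_expansion G" "fps_nth G 0 = 0"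
    "\<And>n. fps_nth G n \<in> \<real>\<^sub>\<ge>\<^sub>0" and s: "0 \<le> s" "s < 1"
  shows "(\<lambda>n. (\<Sum>N\<le>n. Re (coeffs_int N) * Re (fps_nth (G ^ N) n)) * s ^ n) sums gen_fun (- (\<delta> / 2) * ln (1 - s))"
proof -
  have d: "\<delta> > 0" using \<delta> by (simp add: good_width_def)
  have Ln: "Ln (1 - of_real s) = complex_of_real (ln (1 - s))"
    using Ln_of_real[of "1 - s"] s by simp
  have hol: "(\<lambda>s. - of_real (\<delta> / 2) * Ln (1 - s)) holomorphic_on ball 0 1"
  proof -
    have "1 - s \<notin> \<real>\<^sub>\<le>\<^sub>0" if "s \<in> ball 0 1" for s :: complex
      using that abs_Re_le_cmod[of s] by (auto simp: complex_nonpos_Reals_iff)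
    then show ?thesis by (intro holomorphic_intros) auto
  qed
  have "(\<lambda>n. (\<Sum>N\<le>n. coeffs_int N * fps_nth (G ^ N) n) * of_real s ^ n) sums
      (LINT x|M. F x (- of_real (\<delta> / 2) * Ln (1 - of_real s)))"
  proof (intro subst_sums(1)[OF \<delta> _ hol G(1,2)])
    fix s :: complex assume "s \<in> ball 0 1"
    then show "in_strip \<delta> (- of_real (\<delta> / 2) * Ln (1 - s))"
      unfolding in_strip_def using strip_neg_Ln[OF d, of s] by (simp only: mem_ball dist_0_norm)
  qed (use s in auto)
  also have "- of_real (\<delta> / 2) * Ln (1 - of_real s) = complex_of_real (- (\<delta> / 2) * ln (1 - s))"
    by (simp add: Ln)
  also have "(LINT x|M. F x (complex_of_real (- (\<delta> / 2) * ln (1 - s)))) = of_real (gen_fun (- (\<delta> / 2) * ln (1 - s)))"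
  proof (rule integral_F_of_real[OF \<delta>])
    have "- (\<delta> / 2) * ln (1 - s) \<ge> 0" using s d by (simp add: mult_le_0_iff)
    then show "- \<delta> \<le> - (\<delta> / 2) * ln (1 - s)" using d by linarith
  qed
  finally have sums: "(\<lambda>n. (\<Sum>N\<le>n. coeffs_int N * fps_nth (G ^ N) n) * of_real s ^ n) sums
      of_real (gen_fun (- (\<delta> / 2) * ln (1 - s)))" .
  have "Re ((\<Sum>N\<le>n. coeffs_int N * fps_nth (G ^ N) n) * of_real s ^ n) =
       (\<Sum>N\<le>n. Re (coeffs_int N) * Re (fps_nth (G ^ N) n)) * s ^ n" for n
  proof -
    have r: "fps_nth (G ^ N) n = of_real (Re (fps_nth (G ^ N) n))" for N
      using nonneg_Reals_fps_power[OF G(3), of N n] by (auto simp: complex_nonneg_Reals_iff complex_eq_iff)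
    have "(\<Sum>N\<le>n. coeffs_int N * fps_nth (G ^ N) n) = (\<Sum>N\<le>n. coeffs_int N * of_real (Re (fps_nth (G ^ N) n)))"
      by (intro sum.cong refl arg_cong2[of _ _ _ _ "(*)"] r)
    then show ?thesis
      by (simp only: flip: of_real_power) simp
  qed
  with sums_Re[OF sums] show ?thesis by (simp only: Re_complex_of_real)
qed

text \<open>Needed for the reversed family, where it says that the generating function is analytic
  at infinity up to a power of \<open>t\<close>.\<close>

lemma integral_F_fps_expansion:
  "\<exists>H. (\<lambda>u. LINT x|M. F x u) has_fps_expansion H"
proof -
  obtain \<delta> where \<delta>: "good_width \<delta>" using ex_good_width by blast
  have d: "\<delta> > 0" using \<delta> by (simp add: good_width_def)
  have "eventually (\<lambda>u. u \<in> ball 0 \<delta>) (nhds (0::complex))"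
    using d by (intro eventually_nhds_in_open) auto
  then have "eventually (\<lambda>u. (\<lambda>n. fps_nth (Abs_fps (\<lambda>n. \<Sum>N\<le>n. coeffs_int N * fps_nth (fps_X ^ N) n)) n * u ^ n) sums
     (LINT x|M. F x u)) (nhds 0)"
  proof eventually_elim
    case (elim u)
    have s: "in_strip \<delta> s" if "s \<in> ball 0 \<delta>" for s
      using that abs_Re_le_cmod[of s] abs_Im_le_cmod[of s] by (simp add: in_strip_def)
    show ?case unfolding fps_nth_Abs_fps
      by (rule subst_sums(1)[OF \<delta> d _ _ _ s elim]) (auto intro!: fps_expansion_intros holomorphic_intros)
  qed
  then show ?thesis by (intro exI has_fps_expansionI)
qed

end

section \<open>Reciprocal polynomials and behaviour at infinity\<close>

text \<open>Reversal at a prescribed \<open>m\<close> instead of the degree, so that the same index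
  shift applies to every member of a family.\<close>

definition reverse_poly :: "nat \<Rightarrow> complex poly \<Rightarrow> complex poly" where
  "reverse_poly m \<phi> = (\<Sum>k\<le>m. monom (coeff \<phi> (m - k)) k)"

lemma coeff_reverse_poly: "coeff (reverse_poly m \<phi>) k = (if k \<le> m then coeff \<phi> (m - k) else 0)"
  by (simp add: reverse_poly_def coeff_sum)

lemma nonneg_poly_reverse:
  assumes "nonneg_poly m C \<phi>"
  shows "nonneg_poly m C (reverse_poly m \<phi>)"
proof -
  have "0 \<le> C" using assms unfolding nonneg_poly_def by (meson order_trans)
  moreover have "degree (reverse_poly m \<phi>) \<le> m" by (rule degree_le) (simp add: coeff_reverse_poly)
  ultimately show ?thesis using assms unfolding nonneg_poly_def coeff_reverse_poly by auto
qed

lemma poly_reverse_poly: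
  assumes "degree \<phi> \<le> m" "t \<noteq> 0"
  shows "poly \<phi> t = t ^ m * poly (reverse_poly m \<phi>) (1 / t)"
proof -
  have "t ^ m * poly (reverse_poly m \<phi>) (1 / t) = (\<Sum>k\<le>m. coeff \<phi> (m - k) * (t ^ m * (1 / t) ^ k))"
    by (simp add: reverse_poly_def poly_sum poly_monom sum_distrib_left mult_ac)
  also have "\<dots> = (\<Sum>k\<le>m. coeff \<phi> (m - k) * t ^ (m - k))"
    using assms(2) by (intro sum.cong) (auto simp: power_diff field_simps)
  also have "\<dots> = (\<Sum>k\<le>m. coeff \<phi> k * t ^ k)"
    by (rule sum.nat_diff_reindex[of "\<lambda>k. coeff \<phi> k * t ^ k" "Suc m", unfolded lessThan_Suc_atMost, simplified])
  also have "\<dots> = poly \<phi> t" using assms by (simp add: poly_eq_sum_atMost)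
  finally show ?thesis ..
qed

text \<open>Leading coefficients 1 allow reversal within \<open>nonneg_poly_family\<close>, so that
  results at 0 transfer to infinity; with total mass 1 they also make the leading coefficient at
  infinity equal to 1. The degree \<open>m - 1\<close> of \<Psi> reflects the removal of one vertex
  from a face.\<close>

locale monic_poly_family = nonneg_poly_family M m "m - 1" C \<Phi> \<Psi> q
  for M :: "'x measure" and m C \<Phi> \<Psi> q +
  assumes m: "m \<ge> 1"
    and top: "\<And>x. x \<in> space M \<Longrightarrow> coeff (\<Phi> x) m = 1" "\<And>x. x \<in> space M \<Longrightarrow> coeff (\<Psi> x) (m - 1) = 1"
    and mass: "measure M (space M) = 1"
begin

sublocale rev: nonneg_poly_family M m "m - 1" C "\<lambda>x. reverse_poly m (\<Phi> x)" "\<lambda>x. reverse_poly (m - 1) (\<Psi> x)" q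
proof (intro nonneg_poly_family.intro nonneg_poly_family_axioms.intro)
  show "finite_measure M" by (rule finite_measure_axioms)
next
  fix x assume x: "x \<in> space M"
  show "nonneg_poly m C (reverse_poly m (\<Phi> x))" by (intro nonneg_poly_reverse \<Phi> x)
  show "coeff (reverse_poly m (\<Phi> x)) 0 = 1" using top(1)[OF x] by (simp add: coeff_reverse_poly)
  show "nonneg_poly (m - 1) C (reverse_poly (m - 1) (\<Psi> x))" by (intro nonneg_poly_reverse \<Psi> x)
next
  fix k
  show "(\<lambda>x. coeff (reverse_poly m (\<Phi> x)) k) \<in> borel_measurable M"
    unfolding coeff_reverse_poly by (cases "k \<le> m") (simp_all only: if_True if_False meas_\<Phi> borel_measurable_const)
  show "(\<lambda>x. coeff (reverse_poly (m - 1) (\<Psi> x)) k) \<in> borel_measurable M"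
    unfolding coeff_reverse_poly by (cases "k \<le> m - 1") (simp_all only: if_True if_False meas_\<Psi> borel_measurable_const)
qed

text \<open>The powers \<open>t ^ m\<close> and \<open>t ^ (m - 1)\<close> pulled out of the two
  factors combine to the exponent \<open>m * q + (m - 1)\<close>, which is \<open>m * p - 1\<close>
  for \<open>q = p - 1\<close>.\<close>

lemma gen_fun_reverse:
  assumes t: "t > 0"
  shows "gen_fun t = t powr (real m * (q + 1) - 1) * rev.gen_fun (1 / t)"
proof -
  have "Re (poly (\<Phi> x) (of_real t)) powr q * Re (poly (\<Psi> x) (of_real t)) =
    t powr (real m * (q + 1) - 1) * (Re (poly (reverse_poly m (\<Phi> x)) (of_real (1 / t))) powr q *
     Re (poly (reverse_poly (m - 1) (\<Psi> x)) (of_real (1 / t))))" if x: "x \<in> space M" for x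
  proof -
    have deg: "degree (\<Phi> x) \<le> m" "degree (\<Psi> x) \<le> m - 1"
      using \<Phi>(1)[OF x] \<Psi>[OF x] by (auto simp: nonneg_poly_def)
    have 1: "Re (poly (\<Phi> x) (of_real t)) = t ^ m * Re (poly (reverse_poly m (\<Phi> x)) (of_real (1 / t)))"
      using t by (subst poly_reverse_poly[OF deg(1)]) (simp_all flip: of_real_power)
    have 2: "Re (poly (\<Psi> x) (of_real t)) = t ^ (m - 1) * Re (poly (reverse_poly (m - 1) (\<Psi> x)) (of_real (1 / t)))"
      using t by (subst poly_reverse_poly[OF deg(2)]) (simp_all flip: of_real_power)
    have ge: "0 \<le> Re (poly (reverse_poly m (\<Phi> x)) (of_real (1 / t)))"
    proof -
      have nn: "nonneg_poly m C (reverse_poly m (\<Phi> x))" by (intro nonneg_poly_reverse \<Phi> x)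
      then have "poly (reverse_poly m (\<Phi> x)) (of_real (1 / t)) = (\<Sum>k\<le>m. coeff (reverse_poly m (\<Phi> x)) k * of_real (1 / t) ^ k)"
        by (intro poly_eq_sum_atMost) (simp add: nonneg_poly_def)
      also have "Re \<dots> = (\<Sum>k\<le>m. Re (coeff (reverse_poly m (\<Phi> x)) k) * (1 / t) ^ k)"
        by (simp only: Re_sum flip: of_real_power) simp
      also have "\<dots> \<ge> 0" using nn t by (intro sum_nonneg mult_nonneg_nonneg) (auto simp: nonneg_poly_def)
      finally show ?thesis .
    qed
    have e: "(t ^ m) powr q * t ^ (m - 1) = t powr (real m * (q + 1) - 1)"
    proof -
      have "(t ^ m) powr q = t powr (real m * q)"
        using t by (metis powr_powr powr_realpow)
      moreover have "t ^ (m - 1) = t powr (real m - 1)"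
        using t m by (subst powr_realpow[symmetric]) (auto simp: of_nat_diff)
      ultimately show ?thesis by (simp add: algebra_simps flip: powr_add)
    qed
    show ?thesis
      using t ge by (simp only: 1 2 e[symmetric] powr_mult zero_le_power less_imp_le) (simp only: mult_ac)
  qed
  then show ?thesis
    unfolding gen_fun_def rev.gen_fun_def
    by (subst integral_mult_right_zero [symmetric]) (rule Bochner_Integration.integral_cong[OF refl])
qed

text \<open>Through \<open>gen_fun_reverse\<close> this bounds the growth of \<open>gen_fun\<close>
  on \<open>t \<ge> 1\<close> by a power of \<open>t\<close>.\<close>

lemma rev_gen_fun_bounded: "\<exists>B. \<forall>t. 0 \<le> t \<and> t \<le> 1 \<longrightarrow> rev.gen_fun t \<le> B"
proof -
  obtain \<delta> where \<delta>: "rev.good_width \<delta>" using rev.ex_good_width by blast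
  then have d: "\<delta> > 0" by (simp add: rev.good_width_def)
  obtain B where B: "\<And>x w. x \<in> space M \<Longrightarrow> rev.in_strip \<delta> w \<Longrightarrow> norm w \<le> 1 \<Longrightarrow> norm (rev.F x w) \<le> B"
    using rev.F_bounded[OF \<delta>, of 1] by blast
  show ?thesis
  proof (intro exI allI impI)
    fix t :: real assume t: "0 \<le> t \<and> t \<le> 1"
    have strip: "rev.in_strip \<delta> (of_real t)" using t d by (simp add: rev.in_strip_def)
    have "norm (LINT x|M. rev.F x (of_real t)) \<le> (LINT x|M. norm (rev.F x (of_real t)))"
      by (rule integral_norm_bound)
    also have "\<dots> \<le> (LINT x|M. \<bar>B\<bar>)"
    proof (cases "integrable M (\<lambda>x. norm (rev.F x (of_real t)))")
      case True
      then show ?thesis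
        using B[OF _ strip] t by (intro integral_mono) (auto intro: order_trans[OF _ abs_ge_self])
    next
      \<comment> \<open>By convention the integral is then 0, which \<open>\<bar>B\<bar>\<close>
        dominates.\<close>
      case False
      then show ?thesis by (simp add: not_integrable_integral_eq)
    qed
    also have "\<dots> = \<bar>B\<bar>" using mass by simp
    also have "(LINT x|M. rev.F x (of_real t)) = of_real (rev.gen_fun t)"
      using t d by (intro rev.integral_F_of_real[OF \<delta>]) auto
    finally show "rev.gen_fun t \<le> \<bar>B\<bar>" by simp
  qed
qed

text \<open>At 0 only the former leading coefficients survive, so the limit 1 comes from the monic
  condition and total mass 1.\<close>

lemma rev_fps:
  obtains h :: "complex \<Rightarrow> complex" and H where "h has_fps_expansion H" "\<And>t. 0 \<le> t \<Longrightarrow> h (of_real t) = of_real (rev.gen_fun t)"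
    "((\<lambda>t. rev.gen_fun t) \<longlongrightarrow> 1) (at_right 0)"
proof -
  obtain \<delta> where \<delta>: "rev.good_width \<delta>" using rev.ex_good_width by blast
  then have d: "\<delta> > 0" by (simp add: rev.good_width_def)
  define h where "h = (\<lambda>u. LINT x|M. rev.F x u)"
  obtain H where H: "h has_fps_expansion H"
    using rev.integral_F_fps_expansion unfolding h_def by blast
  have h: "h (of_real t) = of_real (rev.gen_fun t)" if "t \<ge> 0" for t
    unfolding h_def using rev.integral_F_of_real[OF \<delta>] that d by simp
  have "rev.gen_fun 0 = (LINT x|M. 1)"
    unfolding rev.gen_fun_def
    by (intro Bochner_Integration.integral_cong) (auto simp: poly_0_coeff_0 coeff_reverse_poly top top[unfolded One_nat_def])
  then have 0: "rev.gen_fun 0 = 1" using mass by simp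
  have "isCont h 0" using H by (rule has_fps_expansion_imp_continuous)
  then have "((\<lambda>t. h (of_real t)) \<longlongrightarrow> h (of_real 0)) (at_right 0)"
    by (intro isCont_tendsto_compose[of "of_real 0" h]) (auto intro!: tendsto_eq_intros)
  then have "((\<lambda>t. Re (h (of_real t))) \<longlongrightarrow> Re (h (of_real 0))) (at_right 0)" by (rule tendsto_Re)
  then have lim: "((\<lambda>t. Re (h (of_real t))) \<longlongrightarrow> 1) (at_right 0)" using h[of 0] 0 by simp
  have "eventually (\<lambda>t. Re (h (of_real t)) = rev.gen_fun t) (at_right 0)"
    by (rule eventually_at_rightI[of 0 1]) (auto simp: h)
  from tendsto_cong[THEN iffD1, OF this lim] show ?thesis by (intro that[OF H] h)
qed

end

section \<open>Coefficients that are negative for arbitrarily large index\<close>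

text \<open>An analytic function is asymptotic to \<open>\<kappa> * z ^ k\<close> with integral
  \<open>k\<close>, or vanishes near 0. Comparison with \<open>c * u powr e\<close> would give
  \<open>u powr (e - k)\<close> a finite nonzero limit, but that power tends to 0 or to
  infinity.\<close>

lemma not_asymp_powr_noninteger:
  fixes D :: "complex \<Rightarrow> complex" and T :: "real \<Rightarrow> real"
  assumes D: "D has_fps_expansion H" and e: "e \<notin> \<int>" and c: "c > 0"
    and eq: "\<And>u. 0 < u \<Longrightarrow> u < 1 \<Longrightarrow> D (of_real u) = of_real (T u)"
    and lim: "((\<lambda>u. T u / u powr e) \<longlongrightarrow> c) (at_right 0)"
  shows False
proof -
  define k where "k = subdegree H"
  define \<kappa> where "\<kappa> = fps_nth H k"
  have "D \<sim>[nhds 0] (\<lambda>z. \<kappa> * z ^ k)"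
    unfolding k_def \<kappa>_def by (rule has_fps_expansion_imp_asymp_equiv_0[OF D])
  then have "((\<lambda>x. if D x = 0 \<and> \<kappa> * x ^ k = 0 then 1 else D x / (\<kappa> * x ^ k)) \<longlongrightarrow> 1) (nhds 0)"
    by (rule asymp_equivD)
  then have "((\<lambda>u. if D (of_real u) = 0 \<and> \<kappa> * of_real u ^ k = 0 then 1 else D (of_real u) / (\<kappa> * of_real u ^ k)) \<longlongrightarrow> 1) (at_right (0::real))"
    by (rule filterlim_compose[where g = "\<lambda>x. if D x = 0 \<and> \<kappa> * x ^ k = 0 then 1 else D x / (\<kappa> * x ^ k)"])
      (auto intro!: tendsto_eq_intros)
  \<comment> \<open>Near 0 this excludes \<open>T u = 0\<close>, and with it the clause that counts
    0/0 as 1 in asymptotic equivalence.\<close>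
  moreover have pos: "eventually (\<lambda>u. T u / u powr e > c / 2) (at_right 0)"
    using lim c by (intro order_tendstoD) auto
  moreover have rng: "eventually (\<lambda>u. 0 < u \<and> u < (1::real)) (at_right 0)"
    by (rule eventually_at_rightI[of 0 1]) auto
  ultimately have lim2: "((\<lambda>u. D (of_real u) / (\<kappa> * of_real u ^ k)) \<longlongrightarrow> 1) (at_right (0::real))"
  proof (elim Lim_transform_eventually)
    show "eventually (\<lambda>u. (if D (of_real u) = 0 \<and> \<kappa> * of_real u ^ k = 0 then 1 else D (of_real u) / (\<kappa> * of_real u ^ k)) = D (of_real u) / (\<kappa> * of_real u ^ k)) (at_right (0::real))"
      using pos rng
    proof eventually_elim
      case (elim u)
      then have "T u \<noteq> 0" using c by auto
      then show ?case using eq[of u] elim by simp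
    qed
  qed
  then have "((\<lambda>u. norm (D (of_real u) / (\<kappa> * of_real u ^ k))) \<longlongrightarrow> 1) (at_right (0::real))"
    using tendsto_norm by fastforce
  then have lim3: "((\<lambda>u. norm (D (of_real u) / (\<kappa> * of_real u ^ k)) / (T u / u powr e)) \<longlongrightarrow> 1 / c) (at_right (0::real))"
    using c lim by (intro tendsto_divide) auto
  have "\<kappa> \<noteq> 0"
  proof
    assume "\<kappa> = 0"
    then have "((\<lambda>u::real. 0::complex) \<longlongrightarrow> 1) (at_right 0)" using lim2 by simp
    then show False by (simp add: tendsto_const_iff)
  qed
  have ev: "eventually (\<lambda>u. norm (D (of_real u) / (\<kappa> * of_real u ^ k)) / (T u / u powr e) = (1 / norm \<kappa>) * u powr (e - real k)) (at_right 0)"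
    using pos rng
  proof eventually_elim
    case (elim u)
    then have "T u / u powr e > 0" using c by linarith
    then have "T u > 0" using elim by (simp add: zero_less_divide_iff)
    have "norm (D (of_real u) / (\<kappa> * of_real u ^ k)) = T u / (norm \<kappa> * u powr real k)"
      using elim eq[of u] \<open>T u > 0\<close> by (simp add: norm_divide norm_mult norm_power powr_realpow)
    then show ?case using elim \<open>T u > 0\<close> by (simp add: powr_diff)
  qed
  from tendsto_cong[THEN iffD1, OF ev lim3]
  have "((\<lambda>u. norm \<kappa> * ((1 / norm \<kappa>) * u powr (e - real k))) \<longlongrightarrow> norm \<kappa> * (1 / c)) (at_right 0)"
    by (intro tendsto_mult_left)
  then have lim4: "((\<lambda>u. u powr (e - real k)) \<longlongrightarrow> norm \<kappa> / c) (at_right 0)"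
    using \<open>\<kappa> \<noteq> 0\<close> by simp
  have "e - real k \<noteq> 0" using e by auto
  then consider "e - real k > 0" | "e - real k < 0" by linarith
  then show False
  proof cases
    case 1
    then have "((\<lambda>u. u powr (e - real k)) \<longlongrightarrow> 0) (at_right (0::real))"
      by real_asymp
    with lim4 have "norm \<kappa> / c = 0" by (intro tendsto_unique) auto
    then show False using \<open>\<kappa> \<noteq> 0\<close> c by simp
  next
    case 2
    then have "filterlim (\<lambda>u. u powr (e - real k)) at_top (at_right (0::real))"
      by real_asymp
    then show False using lim4 not_tendsto_and_filterlim_at_infinity[of "at_right 0" "\<lambda>u. u powr (e - real k)"]
      by (auto intro: filterlim_at_top_imp_at_infinity)
  qed
qed

lemma ex_has_fps_expansion_sum:
  fixes f :: "'i \<Rightarrow> complex \<Rightarrow> complex"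
  assumes "\<And>i. i \<in> I \<Longrightarrow> \<exists>H. f i has_fps_expansion H"
  shows "\<exists>H. (\<lambda>u. \<Sum>i\<in>I. f i u) has_fps_expansion H"
  using assms
proof (induction I rule: infinite_finite_induct)
  case (insert i I)
  then obtain H where "(\<lambda>u. \<Sum>i\<in>I. f i u) has_fps_expansion H" by auto
  moreover obtain H' where "f i has_fps_expansion H'" using insert.prems by auto
  ultimately have "(\<lambda>u. f i u + (\<Sum>i\<in>I. f i u)) has_fps_expansion (H' + H)"
    by (intro has_fps_expansion_add)
  then show ?case using insert.hyps by auto
qed auto

text \<open>The lower bound \<open>N0\<close> is free because the perturbation needs a frequency
  above \<open>2 ^ d\<close>. The proof by contradiction thus knows nonnegativity only from
  \<open>N0\<close> on, and the finitely many earlier coefficients are carried along with arbitrary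
  sign.\<close>

lemma ex_negative_coeff:
  fixes M :: "'x measure" and \<Phi> \<Psi> :: "'j \<Rightarrow> 'x \<Rightarrow> complex poly" and p C :: real and m :: "'j \<Rightarrow> nat"
  assumes J: "finite J" and fam: "\<And>j. j \<in> J \<Longrightarrow> monic_poly_family M (m j) C (\<Phi> j) (\<Psi> j)"
    and j0: "j0 \<in> J" "real (m j0) * p \<notin> \<int>"
  shows "\<exists>N\<ge>N0. (\<Sum>j\<in>J. Re (LINT x|M. powr_coeff (of_real (p - 1)) (\<Phi> j x) (\<Psi> j x) N)) < 0"
proof (rule ccontr)
  define a where "a = (\<lambda>N. \<Sum>j\<in>J. Re (LINT x|M. powr_coeff (of_real (p - 1)) (\<Phi> j x) (\<Psi> j x) N))"
  assume "\<not> ?thesis"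
  then have a_nonneg: "a N \<ge> 0" if "N \<ge> N0" for N using that unfolding a_def by (meson not_less)
  define g where "g = (\<lambda>j. nonneg_poly_family.gen_fun M (\<Phi> j) (\<Psi> j) (p - 1))"
  define gr where "gr = (\<lambda>j. nonneg_poly_family.gen_fun M (\<lambda>x. reverse_poly (m j) (\<Phi> j x))
     (\<lambda>x. reverse_poly (m j - 1) (\<Psi> j x)) (p - 1))"
  define E where "E = (\<lambda>j. real (m j) * p - 1)"

  \<comment> \<open>One width for all of the finitely many \<open>j\<close>, so that a single
    substitution serves the whole sum.\<close>
  have "\<exists>\<delta>>0. \<forall>j\<in>J. nonneg_poly_family.good_width M (\<Phi> j) \<delta>"
    using J fam
  proof (induction J rule: finite_induct)
    case empty
    then show ?case by (auto intro: exI[of _ 1])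
  next
    case (insert j J)
    then obtain \<delta> where \<delta>: "\<delta> > 0" "\<forall>j\<in>J. nonneg_poly_family.good_width M (\<Phi> j) \<delta>" by auto
    interpret monic_poly_family M "m j" C "\<Phi> j" "\<Psi> j" "p - 1" using insert.prems by simp
    obtain \<epsilon> where \<epsilon>: "good_width \<epsilon>" using ex_good_width by blast
    then have "\<epsilon> > 0" by (simp add: good_width_def)
    have "nonneg_poly_family.good_width M (\<Phi> i) (min \<delta> \<epsilon>)" if "i \<in> insert j J" for i
    proof -
      interpret i: monic_poly_family M "m i" C "\<Phi> i" "\<Psi> i" "p - 1" using insert.prems that by simp
      show ?thesis
        using \<delta> \<open>\<epsilon> > 0\<close> that \<epsilon> by (auto intro: i.good_width_mono[of \<delta>] good_width_mono[of \<epsilon>])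
    qed
    then show ?case using \<delta>(1) \<open>\<epsilon> > 0\<close> by (intro exI[of _ "min \<delta> \<epsilon>"]) auto
  qed
  then obtain \<delta> where \<delta>: "\<delta> > 0" "\<And>j. j \<in> J \<Longrightarrow> nonneg_poly_family.good_width M (\<Phi> j) \<delta>" by blast
  obtain G where G: "(\<lambda>s. - of_real (\<delta> / 2) * Ln (1 - s)) has_fps_expansion G" "fps_nth G 0 = 0"
    "\<And>n. fps_nth G n \<in> \<real>\<^sub>\<ge>\<^sub>0"
    using neg_Ln_fps_expansion[of "\<delta> / 2"] \<delta>(1) by auto
  define \<gamma> where "\<gamma> = (\<lambda>N n. Re (fps_nth (G ^ N) n))"
  have \<gamma>_nonneg: "\<gamma> N n \<ge> 0" for N n
    using nonneg_Reals_fps_power[OF G(3), of N n] by (simp add: \<gamma>_def complex_nonneg_Reals_iff)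
  have \<gamma>_0: "\<gamma> N n = 0" if "n < N" for N n
    using startsby_zero_power_prefix[OF G(2)] that by (simp add: \<gamma>_def)
  define \<tau> where "\<tau> = (\<lambda>s::real. - (\<delta> / 2) * ln (1 - s))"
  define h where "h = (\<lambda>t. \<Sum>j\<in>J. g j t)"
  have h_sums: "(\<lambda>n. (\<Sum>N\<le>n. a N * \<gamma> N n) * s ^ n) sums h (\<tau> s)" if "0 \<le> s" "s < 1" for s
  proof -
    have "(\<lambda>n. \<Sum>j\<in>J. (\<Sum>N\<le>n. Re (LINT x|M. powr_coeff (of_real (p - 1)) (\<Phi> j x) (\<Psi> j x) N) * \<gamma> N n) * s ^ n) sums h (\<tau> s)"
      unfolding h_def
    proof (intro sums_sum)
      fix j assume j: "j \<in> J"
      interpret monic_poly_family M "m j" C "\<Phi> j" "\<Psi> j" "p - 1" using fam j by simp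
      show "(\<lambda>n. (\<Sum>N\<le>n. Re (LINT x|M. powr_coeff (of_real (p - 1)) (\<Phi> j x) (\<Psi> j x) N) * \<gamma> N n) * s ^ n) sums g j (\<tau> s)"
        unfolding g_def \<tau>_def \<gamma>_def using gen_fun_sums[OF \<delta>(2)[OF j] G that] by (simp only: coeffs_int_def)
    qed
    moreover have "(\<Sum>j\<in>J. (\<Sum>N\<le>n. Re (LINT x|M. powr_coeff (of_real (p - 1)) (\<Phi> j x) (\<Psi> j x) N) * \<gamma> N n) * s ^ n) =
      (\<Sum>N\<le>n. a N * \<gamma> N n) * s ^ n" for n
      unfolding a_def sum_distrib_right by (rule sum.swap)
    ultimately show ?thesis by simp
  qed
  have pow_sums: "(\<lambda>n. \<gamma> N n * s ^ n) sums \<tau> s ^ N" if "0 \<le> s" "s < 1" for N s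
  proof -
    have hol: "(\<lambda>s. (- of_real (\<delta> / 2) * Ln (1 - s)) ^ N) holomorphic_on ball 0 1"
    proof -
      have "1 - s \<notin> \<real>\<^sub>\<le>\<^sub>0" if "s \<in> ball 0 1" for s :: complex
        using that abs_Re_le_cmod[of s] by (auto simp: complex_nonpos_Reals_iff)
      then show ?thesis by (intro holomorphic_intros) auto
    qed
    have "(\<lambda>s. (- of_real (\<delta> / 2) * Ln (1 - s)) ^ N) has_fps_expansion G ^ N"
      by (intro has_fps_expansion_power G)
    from has_fps_expansion_imp_sums_complex[OF this, of "ereal 1" "of_real s"] hol that
    have "(\<lambda>n. fps_nth (G ^ N) n * of_real s ^ n) sums (- of_real (\<delta> / 2) * Ln (1 - of_real s)) ^ N"
      by simp
    also have "- of_real (\<delta> / 2) * Ln (1 - of_real s) = complex_of_real (\<tau> s)"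
      using Ln_of_real[of "1 - s"] that by (simp add: \<tau>_def)
    finally have "(\<lambda>n. Re (fps_nth (G ^ N) n * of_real (s ^ n))) sums Re (of_real (\<tau> s ^ N))"
      by (intro sums_Re) simp
    then show ?thesis by (simp add: \<gamma>_def)
  qed
  have ex_\<tau>: "\<exists>s. 0 \<le> s \<and> s < 1 \<and> \<tau> s = t" if "t \<ge> 0" for t
    using that \<delta>(1) by (intro exI[of _ "1 - exp (- 2 * t / \<delta>)"]) (auto simp: \<tau>_def)
  \<comment> \<open>The Pringsheim step, made termwise in powers of \<open>s\<close>: whatever is
    dropped carries a factor \<open>a N\<close> with \<open>N \<ge> n \<ge> N0\<close> and is
    therefore nonnegative.\<close>
  have partial: "(\<Sum>N<n. a N * t ^ N) \<le> h t" if n: "n \<ge> N0" and t: "t \<ge> 0" for n t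
  proof -
    obtain s where s: "0 \<le> s" "s < 1" "\<tau> s = t" using ex_\<tau>[OF t] by blast
    have 1: "(\<lambda>k. \<Sum>N<n. a N * (\<gamma> N k * s ^ k)) sums (\<Sum>N<n. a N * t ^ N)"
      using pow_sums[OF s(1,2)] s(3) by (intro sums_sum sums_mult) auto
    have 2: "(\<Sum>N<n. a N * (\<gamma> N k * s ^ k)) \<le> (\<Sum>N\<le>k. a N * \<gamma> N k) * s ^ k" for k
    proof -
      have "(\<Sum>N<n. a N * \<gamma> N k) \<le> (\<Sum>N<max n (Suc k). a N * \<gamma> N k)"
        using n by (intro sum_mono2) (auto intro!: mult_nonneg_nonneg a_nonneg \<gamma>_nonneg)
      also have "\<dots> = (\<Sum>N\<le>k. a N * \<gamma> N k)"
        by (intro sum.mono_neutral_right) (auto simp: \<gamma>_0)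
      finally have "(\<Sum>N<n. a N * \<gamma> N k) * s ^ k \<le> (\<Sum>N\<le>k. a N * \<gamma> N k) * s ^ k"
        using s by (intro mult_right_mono) auto
      then show ?thesis by (simp only: sum_distrib_right mult.assoc)
    qed
    show ?thesis using sums_le[OF 2 1 h_sums[OF s(1,2)]] s(3) by simp
  qed
  have rev: "g j t = t powr E j * gr j (1 / t)" if "j \<in> J" "t > 0" for j t
  proof -
    interpret monic_poly_family M "m j" C "\<Phi> j" "\<Psi> j" "p - 1" using fam that by simp
    show ?thesis using gen_fun_reverse[OF that(2)] by (simp add: g_def gr_def E_def)
  qed
  have "\<exists>B. \<forall>j\<in>J. \<forall>t. 0 \<le> t \<and> t \<le> 1 \<longrightarrow> gr j t \<le> B j"
  proof (rule bchoice, rule ballI)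
    fix j assume "j \<in> J"
    then interpret monic_poly_family M "m j" C "\<Phi> j" "\<Psi> j" "p - 1" using fam by simp
    show "\<exists>B. \<forall>t. 0 \<le> t \<and> t \<le> 1 \<longrightarrow> gr j t \<le> B" using rev_gen_fun_bounded by (simp add: gr_def)
  qed
  then obtain B where B: "\<And>j t. j \<in> J \<Longrightarrow> 0 \<le> t \<Longrightarrow> t \<le> 1 \<Longrightarrow> gr j t \<le> B j" by blast
  have "\<exists>K0::nat. \<forall>j\<in>J. E j \<le> K0"
  proof (intro exI ballI)
    fix j assume "j \<in> J"
    then have "E j \<le> Max (E ` J)" using J by auto
    then show "E j \<le> real (nat \<lceil>Max (E ` J)\<rceil>)" by linarith
  qed
  then obtain K0 :: nat where K0: "\<And>j. j \<in> J \<Longrightarrow> E j \<le> K0" by blast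
  \<comment> \<open>From \<open>K\<close> on, the coefficients are nonnegative and the powers exceed
    the growth \<open>t ^ K0\<close> of \<open>h\<close>.\<close>
  define K where "K = max N0 (Suc K0)"
  define BB where "BB = (\<Sum>j\<in>J. \<bar>B j\<bar>)"
  have h_le: "h t \<le> BB * t ^ K0" if "t \<ge> 1" for t
    unfolding h_def BB_def sum_distrib_right
  proof (rule sum_mono)
    fix j assume j: "j \<in> J"
    have "g j t = t powr E j * gr j (1 / t)" using rev[OF j] that by simp
    also have "\<dots> \<le> t powr E j * \<bar>B j\<bar>"
      using B[OF j, of "1 / t"] that by (intro mult_left_mono) auto
    also have "\<dots> \<le> t powr K0 * \<bar>B j\<bar>"
      using K0[OF j] that by (intro mult_right_mono powr_mono) auto
    finally show "g j t \<le> \<bar>B j\<bar> * t ^ K0" using that by (simp add: powr_realpow mult.commute)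
  qed
  \<comment> \<open>The term \<open>a N * t ^ N\<close> is at most \<open>h t\<close> minus the
    terms below \<open>N0\<close>, all of order at most \<open>t ^ (N - 1)\<close>. Division leaves
    \<open>a N * t \<le> A\<close> for all \<open>t \<ge> 1\<close>.\<close>
  have a_0: "a N = 0" if N: "N \<ge> K" for N
  proof -
    define A where "A = BB + (\<Sum>i<N0. \<bar>a i\<bar>)"
    have "a N * t \<le> A" if t: "t \<ge> 1" for t
    proof -
      have N0: "N \<ge> N0" "N \<ge> Suc K0" using N by (auto simp: K_def)
      have "(\<Sum>i<N0. a i * t ^ i) + a N * t ^ N \<le> (\<Sum>i<Suc N. a i * t ^ i)"
      proof -
        have "(\<Sum>i\<in>{..<N0} \<union> {N}. a i * t ^ i) \<le> (\<Sum>i<Suc N. a i * t ^ i)"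
          using N0 t by (intro sum_mono2) (auto intro!: mult_nonneg_nonneg a_nonneg)
        then show ?thesis using N0 by (subst (asm) sum.union_disjoint) auto
      qed
      also have "\<dots> \<le> h t" using N0 t by (intro partial) auto
      also have "\<dots> \<le> BB * t ^ K0" by (rule h_le[OF t])
      also have "\<dots> \<le> BB * t ^ (N - 1)"
        using N0 t by (intro mult_left_mono power_increasing) (auto simp: BB_def sum_nonneg)
      finally have "a N * t ^ N \<le> BB * t ^ (N - 1) - (\<Sum>i<N0. a i * t ^ i)" by simp
      moreover have "- (\<Sum>i<N0. a i * t ^ i) \<le> (\<Sum>i<N0. \<bar>a i\<bar> * t ^ (N - 1))"
        unfolding sum_negf [symmetric]
      proof (rule sum_mono)
        fix i assume i: "i \<in> {..<N0}"
        have "- (a i * t ^ i) \<le> \<bar>a i\<bar> * t ^ i" using t by (simp add: abs_if mult_left_mono)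
        also have "\<dots> \<le> \<bar>a i\<bar> * t ^ (N - 1)" using i N0 t by (intro mult_left_mono power_increasing) auto
        finally show "- (a i * t ^ i) \<le> \<bar>a i\<bar> * t ^ (N - 1)" .
      qed
      ultimately have "a N * t ^ N \<le> BB * t ^ (N - 1) + (\<Sum>i<N0. \<bar>a i\<bar> * t ^ (N - 1))" by linarith
      also have "\<dots> = A * t ^ (N - 1)" by (simp only: A_def distrib_right sum_distrib_right)
      finally have "a N * t ^ N \<le> A * t ^ (N - 1)" .
      moreover have "t ^ N = t * t ^ (N - 1)" using N0 by (cases N) auto
      ultimately have "(a N * t) * t ^ (N - 1) \<le> A * t ^ (N - 1)" by (simp add: mult.assoc)
      then show ?thesis using t by (simp add: mult_le_cancel_right)
    qed
    note le = this
    have "a N \<ge> 0" using a_nonneg N by (simp add: K_def)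
    moreover have "\<not> a N > 0"
    proof
      assume pos: "a N > 0"
      \<comment> \<open>At this \<open>t\<close> the left side is
        \<open>a N + \<bar>A\<bar>\<close>, which exceeds \<open>A\<close>.\<close>
      have "a N * (1 + \<bar>A\<bar> / a N) \<le> A" by (rule le) (use pos in auto)
      then show False using pos by (simp add: distrib_left)
    qed
    ultimately show ?thesis by linarith
  qed
  \<comment> \<open>Since \<open>a N\<close> vanishes from \<open>K\<close> on, the series in
    \<open>s\<close> is a finite combination of the series of \<open>\<tau> s ^ N\<close>, and
    uniqueness of limits identifies \<open>h\<close> with a polynomial.\<close>
  have h_poly: "h t = (\<Sum>N<K. a N * t ^ N)" if t: "t \<ge> 0" for t
  proof -
    obtain s where s: "0 \<le> s" "s < 1" "\<tau> s = t" using ex_\<tau>[OF t] by blast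
    have "(\<lambda>k. \<Sum>N<K. a N * (\<gamma> N k * s ^ k)) sums (\<Sum>N<K. a N * t ^ N)"
      using pow_sums[OF s(1,2)] s(3) by (intro sums_sum sums_mult) auto
    moreover have "(\<Sum>N<K. a N * (\<gamma> N k * s ^ k)) = (\<Sum>N\<le>k. a N * \<gamma> N k) * s ^ k" for k
    proof -
      have "(\<Sum>N<K. a N * \<gamma> N k) = (\<Sum>N<max K (Suc k). a N * \<gamma> N k)"
        by (intro sum.mono_neutral_left) (auto simp: a_0)
      also have "\<dots> = (\<Sum>N\<le>k. a N * \<gamma> N k)"
        by (intro sum.mono_neutral_right) (auto simp: \<gamma>_0)
      finally show ?thesis by (simp only: mult.assoc [symmetric] sum_distrib_right [symmetric])
    qed
    ultimately show ?thesis using h_sums[OF s(1,2)] s(3) by (simp add: sums_iff)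
  qed

  \<comment> \<open>Exponents in \<open>u = 1 / t\<close> after multiplication by
    \<open>u ^ K\<close>. They are positive because \<open>K > K0\<close>, and the largest
    nonintegral exponent of \<open>t\<close> becomes the smallest nonintegral
    \<open>e j\<close>.\<close>
  define e where "e = (\<lambda>j. real K - E j)"
  have e_pos: "e j > 0" if "j \<in> J" for j using K0[OF that] by (simp add: e_def K_def)
  have rev_h: "(\<Sum>j\<in>J. u powr e j * gr j u) = (\<Sum>N<K. a N * u ^ (K - N))" if u: "0 < u" "u < 1" for u
  proof -
    have "(\<Sum>j\<in>J. u powr e j * gr j u) = u ^ K * h (1 / u)"
      unfolding h_def sum_distrib_left
    proof (rule sum.cong[OF refl])
      fix j assume j: "j \<in> J"
      have "u powr e j = u ^ K * (1 / u) powr E j"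
        using u by (simp add: e_def powr_diff powr_realpow powr_divide field_simps)
      then show "u powr e j * gr j u = u ^ K * g j (1 / u)" using rev[OF j, of "1 / u"] u by simp
    qed
    also have "\<dots> = (\<Sum>N<K. a N * (u ^ K * (1 / u) ^ N))"
      using u by (subst h_poly) (auto simp: sum_distrib_left mult_ac)
    also have "\<dots> = (\<Sum>N<K. a N * u ^ (K - N))"
      using u by (intro sum.cong refl) (auto simp: power_diff field_simps)
    finally show ?thesis .
  qed
  have "\<exists>hh. \<forall>j\<in>J. (\<exists>H. hh j has_fps_expansion H) \<and> (\<forall>t\<ge>0. hh j (of_real t) = complex_of_real (gr j t)) \<and>
    (gr j \<longlongrightarrow> 1) (at_right 0)"
  proof (rule bchoice, rule ballI)
    fix j assume "j \<in> J"
    then interpret monic_poly_family M "m j" C "\<Phi> j" "\<Psi> j" "p - 1" using fam by simp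
    show "\<exists>hh. (\<exists>H. hh has_fps_expansion H) \<and> (\<forall>t\<ge>0. hh (of_real t) = complex_of_real (gr j t)) \<and>
      (gr j \<longlongrightarrow> 1) (at_right 0)"
      using rev_fps unfolding gr_def by metis
  qed
  then obtain hh where hh: "\<And>j. j \<in> J \<Longrightarrow> \<exists>H. hh j has_fps_expansion H"
    "\<And>j t. j \<in> J \<Longrightarrow> t \<ge> 0 \<Longrightarrow> hh j (of_real t) = complex_of_real (gr j t)"
    and gr_lim: "\<And>j. j \<in> J \<Longrightarrow> (gr j \<longlongrightarrow> 1) (at_right 0)" by blast
  define JZ where "JZ = {j\<in>J. e j \<in> \<int>}"
  define JN where "JN = {j\<in>J. e j \<notin> \<int>}"
  have JN: "finite JN" "JN \<subseteq> J" using J by (auto simp: JN_def)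
  have "e j0 \<notin> \<int>"
  proof
    assume "e j0 \<in> \<int>"
    then have "real K + 1 - e j0 \<in> \<int>" by (intro Ints_diff Ints_add) auto
    then show False using j0 by (simp add: e_def E_def)
  qed
  then have "JN \<noteq> {}" using j0 by (auto simp: JN_def)
  define e0 where "e0 = Min (e ` JN)"
  have e0: "e0 \<in> e ` JN" "\<And>j. j \<in> JN \<Longrightarrow> e0 \<le> e j"
    using JN \<open>JN \<noteq> {}\<close> by (auto simp: e0_def)
  have "e0 \<notin> \<int>" using e0(1) by (auto simp: JN_def)
  \<comment> \<open>The identity \<open>rev_h\<close> rearranged: the polynomial and the integral
    exponents, which extend analytically to complex \<open>u\<close>, form \<open>D\<close>; the
    nonintegral exponents form \<open>T\<close>.\<close>
  define D where "D = (\<lambda>u::complex. (\<Sum>N<K. of_real (a N) * u ^ (K - N)) - (\<Sum>j\<in>JZ. u ^ nat \<lfloor>e j\<rfloor> * hh j u))"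
  define T where "T = (\<lambda>u. \<Sum>j\<in>JN. u powr e j * gr j u)"
  have "\<exists>H. D has_fps_expansion H"
  proof -
    have "\<exists>H. (\<lambda>u::complex. \<Sum>N<K. of_real (a N) * u ^ (K - N)) has_fps_expansion H"
    proof (rule ex_has_fps_expansion_sum)
      fix N
      show "\<exists>H. (\<lambda>u::complex. of_real (a N) * u ^ (K - N)) has_fps_expansion H"
        by (intro exI[of _ "fps_const (of_real (a N)) * fps_X ^ (K - N)"] fps_expansion_intros)
    qed
    moreover have "\<exists>H. (\<lambda>u. \<Sum>j\<in>JZ. u ^ nat \<lfloor>e j\<rfloor> * hh j u) has_fps_expansion H"
    proof (rule ex_has_fps_expansion_sum)
      fix j assume "j \<in> JZ"
      then obtain H where "hh j has_fps_expansion H" using hh(1) by (auto simp: JZ_def)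
      then have "(\<lambda>u. u ^ nat \<lfloor>e j\<rfloor> * hh j u) has_fps_expansion fps_X ^ nat \<lfloor>e j\<rfloor> * H"
        by (intro fps_expansion_intros)
      then show "\<exists>H. (\<lambda>u. u ^ nat \<lfloor>e j\<rfloor> * hh j u) has_fps_expansion H" by blast
    qed
    ultimately show ?thesis unfolding D_def using has_fps_expansion_diff by blast
  qed
  then obtain H where H: "D has_fps_expansion H" by blast
  have DT: "D (of_real u) = of_real (T u)" if u: "0 < u" "u < 1" for u
  proof -
    have "(\<Sum>j\<in>JZ. of_real u ^ nat \<lfloor>e j\<rfloor> * hh j (of_real u)) = complex_of_real (\<Sum>j\<in>JZ. u powr e j * gr j u)"
      unfolding of_real_sum
    proof (rule sum.cong[OF refl])
      fix j assume j: "j \<in> JZ"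
      then have "e j = real (nat \<lfloor>e j\<rfloor>)" using e_pos[of j] by (auto simp: JZ_def elim!: Ints_cases)
      then have "u powr e j = u ^ nat \<lfloor>e j\<rfloor>" using u by (metis powr_realpow)
      then show "of_real u ^ nat \<lfloor>e j\<rfloor> * hh j (of_real u) = complex_of_real (u powr e j * gr j u)"
        using j u hh(2)[of j u] by (simp add: JZ_def)
    qed
    moreover have "(\<Sum>j\<in>J. u powr e j * gr j u) = (\<Sum>j\<in>JZ. u powr e j * gr j u) + T u"
      unfolding T_def JZ_def JN_def using J by (subst sum.union_disjoint [symmetric]) (auto intro!: sum.cong)
    moreover have "(\<Sum>N<K. of_real (a N) * of_real u ^ (K - N)) = complex_of_real (\<Sum>N<K. a N * u ^ (K - N))" by simp
    ultimately show ?thesis using rev_h[OF u] unfolding D_def by (simp flip: of_real_diff)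
  qed
  have lim: "((\<lambda>u. T u / u powr e0) \<longlongrightarrow> (\<Sum>j\<in>JN. (if e j = e0 then 1 else 0) * 1)) (at_right 0)"
  proof -
    have "((\<lambda>u. \<Sum>j\<in>JN. u powr (e j - e0) * gr j u) \<longlongrightarrow> (\<Sum>j\<in>JN. (if e j = e0 then 1 else 0) * 1)) (at_right 0)"
    proof (intro tendsto_sum tendsto_mult)
      fix j assume j: "j \<in> JN"
      show "(gr j \<longlongrightarrow> 1) (at_right 0)" using j JN gr_lim by auto
      show "((\<lambda>u. u powr (e j - e0)) \<longlongrightarrow> (if e j = e0 then 1 else 0)) (at_right 0)"
      proof (cases "e j = e0")
        case True
        have "eventually (\<lambda>u. u powr (e j - e0) = 1) (at_right (0::real))"
          using True by (intro eventually_at_rightI[of 0 1]) auto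
        then show ?thesis using True by (simp add: tendsto_eventually)
      next
        case False
        then have "e j - e0 > 0" using e0(2)[OF j] by simp
        then have "((\<lambda>u. u powr (e j - e0)) \<longlongrightarrow> 0) (at_right (0::real))" by real_asymp
        then show ?thesis using False by simp
      qed
    qed
    moreover have "eventually (\<lambda>u. (\<Sum>j\<in>JN. u powr (e j - e0) * gr j u) = T u / u powr e0) (at_right 0)"
      by (rule eventually_at_rightI[of 0 1]) (auto simp: T_def powr_diff sum_divide_distrib)
    ultimately show ?thesis by (rule Lim_transform_eventually)
  qed
  \<comment> \<open>Leading coefficients are all 1, so several \<open>j\<close> with the exponent
    \<open>e0\<close> reinforce each other.\<close>
  have pos: "(\<Sum>j\<in>JN. (if e j = e0 then 1 else 0) * (1::real)) > 0"
  proof -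
    obtain j where "j \<in> JN" "e j = e0" using e0(1) by auto
    then show ?thesis using JN by (intro sum_pos2[of _ j]) auto
  qed
  show False
    by (rule not_asymp_powr_noninteger[OF H \<open>e0 \<notin> \<int>\<close> pos DT lim])
qed

section \<open>Fourier expansions on the torus\<close>

definition unit_exp :: "real \<Rightarrow> complex" where
  "unit_exp \<theta> = cis (2 * pi * \<theta>)"

lemma unit_exp_0 [simp]: "unit_exp 0 = 1"
  by (simp add: unit_exp_def)

lemma unit_exp_add: "unit_exp (x + y) = unit_exp x * unit_exp y"
  by (simp add: unit_exp_def cis_mult distrib_left)

lemma unit_exp_sum: "unit_exp (\<Sum>i\<in>I. f i) = (\<Prod>i\<in>I. unit_exp (f i))"
  by (induction I rule: infinite_finite_induct) (auto simp: unit_exp_add)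

lemma norm_unit_exp [simp]: "norm (unit_exp x) = 1"
  by (simp add: unit_exp_def)

lemma cnj_unit_exp: "cnj (unit_exp x) = unit_exp (- x)"
  by (simp add: unit_exp_def cis_cnj)

lemma Re_unit_exp: "Re (unit_exp x) = cos (2 * pi * x)"
  by (simp add: unit_exp_def)

lemma of_real_cos_unit_exp: "complex_of_real (2 * cos (2 * pi * x)) = unit_exp x + unit_exp (- x)"
  by (simp add: unit_exp_def complex_eq_iff)

lemma continuous_unit_exp [continuous_intros]:
  "continuous_on S f \<Longrightarrow> continuous_on S (\<lambda>x. unit_exp (f x))"
  unfolding unit_exp_def by (intro continuous_intros)

lemma borel_measurable_unit_exp [measurable]: "unit_exp \<in> borel_measurable borel"
  by (intro borel_measurable_continuous_onI continuous_intros)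

lemma space_circle_measure: "space circle_measure = {0..<1}"
  by (simp add: circle_measure_def space_restrict_space)

lemma measure_circle_measure: "measure circle_measure (space circle_measure) = 1"
  by (simp add: circle_measure_def space_restrict_space measure_restrict_space)

lemma finite_measure_circle: "finite_measure circle_measure"
  by (rule finite_measureI) (simp add: circle_measure_def space_restrict_space emeasure_restrict_space)

interpretation circle: finite_measure circle_measure
  by (rule finite_measure_circle)

lemma measurable_circle_borel: "f \<in> borel_measurable borel \<Longrightarrow> f \<in> borel_measurable circle_measure"
  unfolding circle_measure_def by (rule measurable_restrict_space1) simp

lemma integrable_circle_continuous:
  fixes f :: "real \<Rightarrow> 'b :: {banach, second_countable_topology}"
  assumes "continuous_on UNIV f"
  shows "integrable circle_measure f"
proof -
  have "compact (f ` {0..1})" using assms by (intro compact_continuous_image) (auto intro: continuous_on_subset)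
  then obtain B where "\<And>x. x \<in> {0..1} \<Longrightarrow> norm (f x) \<le> B"
    by (meson bounded_iff compact_imp_bounded imageI)
  then show ?thesis using assms
    by (intro circle.integrable_const_bound[of _ B] AE_I2 measurable_circle_borel borel_measurable_continuous_onI)
      (auto simp: space_circle_measure)
qed

lemma integral_circle_unit_exp:
  assumes "k \<in> \<int>"
  shows "(LINT x|circle_measure. unit_exp (k * x)) = (if k = 0 then 1 else 0)"
proof (cases "k = 0")
  case True
  then show ?thesis using measure_circle_measure by simp
next
  case False
  define F where "F = (\<lambda>x. unit_exp (k * x) / (2 * pi * k * \<i>))"
  have "has_bochner_integral lborel (\<lambda>x. indicator {0..1} x *\<^sub>R unit_exp (k * x)) (F 1 - F 0)"
  proof (rule has_bochner_integral_FTC_Icc)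
    fix x :: real
    define G where "G = (\<lambda>z::complex. exp (\<i> * (2 * pi * k * z)) / (2 * pi * k * \<i>))"
    have "(G has_field_derivative exp (\<i> * (2 * pi * k * complex_of_real x))) (at (complex_of_real x))"
      unfolding G_def using False by (auto intro!: derivative_eq_intros)
    from has_vector_derivative_real_field[OF this]
    show "(F has_vector_derivative unit_exp (k * x)) (at x within {0..1})"
      by (simp add: G_def F_def unit_exp_def cis_conv_exp mult_ac)
  qed (auto intro!: continuous_intros)
  moreover have "unit_exp k = 1" using assms by (auto simp: unit_exp_def elim!: Ints_cases)
  ultimately have "(LINT x|lborel. indicator {0..1} x *\<^sub>R unit_exp (k * x)) = 0"
    by (simp add: F_def has_bochner_integral_iff)
  also have "(LINT x|lborel. indicator {0..1} x *\<^sub>R unit_exp (k * x)) = (LINT x|lborel. indicator {0..<1} x *\<^sub>R unit_exp (k * x))"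
  proof (rule integral_cong_AE)
    have "AE x in lborel. x \<noteq> (1::real)" by (rule AE_lborel_singleton)
    then show "AE x in lborel. indicator {0..1} x *\<^sub>R unit_exp (k * x) = indicator {0..<1} x *\<^sub>R unit_exp (k * x)"
      by eventually_elim (auto simp: indicator_def)
  qed auto
  also have "\<dots> = (LINT x|circle_measure. unit_exp (k * x))"
    unfolding circle_measure_def by (subst integral_restrict_space) auto
  finally show ?thesis using False by simp
qed

text \<open>Cube vertices are \<open>undefined\<close> outside \<open>{..<d}\<close>; only
  coordinates below \<open>d\<close> are read.\<close>

definition dot :: "nat \<Rightarrow> (nat \<Rightarrow> real) \<Rightarrow> (nat \<Rightarrow> real) \<Rightarrow> real" where
  "dot d v h = (\<Sum>i<d. v i * h i)"

lemma dot_add: "dot d (\<lambda>i. v i + w i) h = dot d v h + dot d w h"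
  and dot_diff: "dot d (\<lambda>i. v i - w i) h = dot d v h - dot d w h"
  and dot_scale: "dot d (\<lambda>i. c * v i) h = c * dot d v h"
  and dot_sum: "dot d (\<lambda>i. \<Sum>j\<in>J. f j i) h = (\<Sum>j\<in>J. dot d (f j) h)"
  by (simp_all add: dot_def algebra_simps sum.distrib sum_subtractf sum_distrib_left sum_distrib_right)
    (rule sum.swap)

interpretation torus: product_sigma_finite "\<lambda>_::nat. circle_measure"
  by unfold_locales

lemma measurable_torus_coord:
  assumes "i < d"
  shows "(\<lambda>h. h i) \<in> borel_measurable (torus_measure d)"
proof -
  have "(\<lambda>h. h i) \<in> measurable (torus_measure d) circle_measure"
    unfolding torus_measure_def using assms by (intro measurable_component_singleton) auto
  moreover have "(\<lambda>x. x) \<in> borel_measurable circle_measure"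
    by (intro measurable_circle_borel) simp
  ultimately show ?thesis by (rule measurable_compose)
qed

lemma measurable_dot [measurable]: "(\<lambda>h. dot d v h) \<in> borel_measurable (torus_measure d)"
  unfolding dot_def by (intro borel_measurable_sum borel_measurable_times measurable_torus_coord) auto

lemma integral_torus_unit_exp:
  assumes "\<And>i. i < d \<Longrightarrow> v i \<in> \<int>"
  shows "(LINT h|torus_measure d. unit_exp (dot d v h)) = (if \<forall>i<d. v i = 0 then 1 else 0)"
proof -
  have "(LINT h|torus_measure d. unit_exp (dot d v h)) = (LINT h|torus_measure d. (\<Prod>i<d. unit_exp (v i * h i)))"
    by (simp add: dot_def unit_exp_sum)
  also have "\<dots> = (\<Prod>i<d. LINT x|circle_measure. unit_exp (v i * x))"
    unfolding torus_measure_def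
    by (intro torus.product_integral_prod integrable_circle_continuous) (auto intro!: continuous_intros)
  also have "\<dots> = (\<Prod>i<d. if v i = 0 then 1 else 0)"
    by (intro prod.cong refl integral_circle_unit_exp) (auto intro: assms)
  also have "\<dots> = (if \<forall>i<d. v i = 0 then 1 else 0)" by (auto intro: prod_zero)
  finally show ?thesis .
qed

lemma emeasure_torus: "emeasure (torus_measure d) (space (torus_measure d)) = 1"
proof -
  have "emeasure circle_measure (space circle_measure) = 1"
    using measure_circle_measure circle.emeasure_eq_measure by simp
  then show ?thesis
    unfolding torus_measure_def space_PiM by (subst torus.emeasure_PiM) auto
qed

lemma finite_measure_torus: "finite_measure (torus_measure d)"
  by (rule finite_measureI) (simp add: emeasure_torus)

lemma measure_torus: "measure (torus_measure d) (space (torus_measure d)) = 1"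
  by (simp add: Sigma_Algebra.measure_def emeasure_torus)

lemma integrable_torus_bounded:
  fixes f :: "(nat \<Rightarrow> real) \<Rightarrow> 'b :: {banach, second_countable_topology}"
  assumes "f \<in> borel_measurable (torus_measure d)" "\<And>h. h \<in> space (torus_measure d) \<Longrightarrow> norm (f h) \<le> B"
  shows "integrable (torus_measure d) f"
proof -
  interpret finite_measure "torus_measure d" by (rule finite_measure_torus)
  show ?thesis using assms by (intro integrable_const_bound[of _ B] AE_I2) auto
qed

section \<open>Expansion of products of cosines over cube vertices\<close>

definition disjoint_pairs :: "'a set \<Rightarrow> ('a set \<times> 'a set) set" where
  "disjoint_pairs A = Sigma (Pow A) (\<lambda>S. Pow (A - S))"

lemma finite_disjoint_pairs: "finite A \<Longrightarrow> finite (disjoint_pairs A)"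
  unfolding disjoint_pairs_def by (intro finite_SigmaI) auto

lemma prod_one_plus_plus:
  fixes x y :: "'a \<Rightarrow> 'b :: comm_ring_1"
  assumes "finite A"
  shows "(\<Prod>a\<in>A. 1 + x a + y a) = (\<Sum>(S, T)\<in>disjoint_pairs A. prod x S * prod y T)"
proof -
  have "(\<Prod>a\<in>A. 1 + x a + y a) = (\<Prod>a\<in>A. x a + (y a + 1))" by (simp add: algebra_simps)
  also have "\<dots> = (\<Sum>S\<in>Pow A. prod x S * (\<Prod>a\<in>A - S. y a + 1))" by (rule prod_add[OF assms])
  also have "\<dots> = (\<Sum>S\<in>Pow A. \<Sum>T\<in>Pow (A - S). prod x S * prod y T)"
    using assms by (intro sum.cong refl) (simp add: prod_add sum_distrib_left)
  also have "\<dots> = (\<Sum>(S, T)\<in>disjoint_pairs A. prod x S * prod y T)"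
    unfolding disjoint_pairs_def using assms by (subst sum.Sigma) (auto intro: finite_subset)
  finally show ?thesis .
qed

definition vec_sum :: "(nat \<Rightarrow> real) set \<Rightarrow> nat \<Rightarrow> real" where
  "vec_sum S i = (\<Sum>\<eta>\<in>S. \<eta> i)"

lemma dot_vec_sum: "dot d (vec_sum S) h = (\<Sum>\<eta>\<in>S. dot d \<eta> h)"
  unfolding vec_sum_def by (rule dot_sum)

text \<open>The set \<open>A\<close> is the cube without the vertices that carry the perturbation.
  The amplitude is \<open>2 * \<alpha>\<close> so that each of the two exponentials of a cosine gets
  the coefficient \<alpha>.\<close>

definition cos_prod :: "nat \<Rightarrow> (nat \<Rightarrow> real) set \<Rightarrow> real \<Rightarrow> (nat \<Rightarrow> real) \<Rightarrow> real \<Rightarrow> real" where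
  "cos_prod d A \<alpha> h x = (\<Prod>\<eta>\<in>A. 1 + 2 * \<alpha> * cos (2 * pi * (x + dot d \<eta> h)))"

definition cos_avg :: "nat \<Rightarrow> (nat \<Rightarrow> real) set \<Rightarrow> real \<Rightarrow> (nat \<Rightarrow> real) \<Rightarrow> real" where
  "cos_avg d A \<alpha> h = (LINT x|circle_measure. cos_prod d A \<alpha> h x)"

lemma continuous_cos_prod [continuous_intros]: "continuous_on S (cos_prod d A \<alpha> h)"
  unfolding cos_prod_def by (intro continuous_intros)

text \<open>Each factor has the form \<open>1 + \<alpha> * e + \<alpha> * cnj e\<close>;
  \<open>S\<close> collects the vertices contributing the first exponential, \<open>T\<close> those
  contributing its conjugate.\<close>

lemma cos_prod_expand:
  assumes "finite A"
  shows "complex_of_real (cos_prod d A \<alpha> h x) = (\<Sum>(S, T)\<in>disjoint_pairs A.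
    of_real \<alpha> ^ (card S + card T) * unit_exp (dot d (vec_sum S) h - dot d (vec_sum T) h) *
    unit_exp ((real (card S) - real (card T)) * x))"
proof -
  have "complex_of_real (cos_prod d A \<alpha> h x) = (\<Prod>\<eta>\<in>A. 1 + of_real \<alpha> * complex_of_real (2 * cos (2 * pi * (x + dot d \<eta> h))))"
    unfolding cos_prod_def by (simp add: mult_ac)
  also have "\<dots> = (\<Prod>\<eta>\<in>A. 1 + of_real \<alpha> * unit_exp (x + dot d \<eta> h) + of_real \<alpha> * unit_exp (- (x + dot d \<eta> h)))"
    unfolding of_real_cos_unit_exp by (simp add: distrib_left add.assoc)
  also have "\<dots> = (\<Sum>(S, T)\<in>disjoint_pairs A. (\<Prod>\<eta>\<in>S. of_real \<alpha> * unit_exp (x + dot d \<eta> h)) *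
     (\<Prod>\<eta>\<in>T. of_real \<alpha> * unit_exp (- (x + dot d \<eta> h))))"
    by (rule prod_one_plus_plus[OF assms])
  also have "\<dots> = (\<Sum>(S, T)\<in>disjoint_pairs A.
    of_real \<alpha> ^ (card S + card T) * unit_exp (dot d (vec_sum S) h - dot d (vec_sum T) h) *
    unit_exp ((real (card S) - real (card T)) * x))"
  proof (intro sum.cong refl, clarify)
    fix S T
    have "(\<Prod>\<eta>\<in>U. of_real \<alpha> * unit_exp (f \<eta>)) = of_real \<alpha> ^ card U * unit_exp (\<Sum>\<eta>\<in>U. f \<eta>)"
      for U :: "(nat \<Rightarrow> real) set" and f
      by (simp add: prod.distrib unit_exp_sum)
    note * = this
    have "(\<Prod>\<eta>\<in>S. of_real \<alpha> * unit_exp (x + dot d \<eta> h)) * (\<Prod>\<eta>\<in>T. of_real \<alpha> * unit_exp (- (x + dot d \<eta> h)))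
      = of_real \<alpha> ^ (card S + card T) * unit_exp ((\<Sum>\<eta>\<in>S. x + dot d \<eta> h) + (\<Sum>\<eta>\<in>T. - (x + dot d \<eta> h)))"
      unfolding * unit_exp_add[of "sum _ _"] power_add by (simp only: mult_ac)
    also have "(\<Sum>\<eta>\<in>S. x + dot d \<eta> h) + (\<Sum>\<eta>\<in>T. - (x + dot d \<eta> h)) =
       (dot d (vec_sum S) h - dot d (vec_sum T) h) + (real (card S) - real (card T)) * x"
      unfolding sum_negf sum.distrib dot_vec_sum by (simp add: algebra_simps)
    finally show "(\<Prod>\<eta>\<in>S. of_real \<alpha> * unit_exp (x + dot d \<eta> h)) * (\<Prod>\<eta>\<in>T. of_real \<alpha> * unit_exp (- (x + dot d \<eta> h))) =
      of_real \<alpha> ^ (card S + card T) * unit_exp (dot d (vec_sum S) h - dot d (vec_sum T) h) *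
      unit_exp ((real (card S) - real (card T)) * x)"
      by (simp add: unit_exp_add)
  qed
  finally show ?thesis .
qed

lemma integral_unit_exp_cos_prod:
  assumes "finite A" "k \<in> \<int>"
  shows "(LINT x|circle_measure. unit_exp (k * x) * complex_of_real (cos_prod d A \<alpha> h x)) =
    (\<Sum>(S, T)\<in>{(S, T)\<in>disjoint_pairs A. real (card S) - real (card T) + k = 0}.
      of_real \<alpha> ^ (card S + card T) * unit_exp (dot d (vec_sum S) h - dot d (vec_sum T) h))"
proof -
  have "(LINT x|circle_measure. unit_exp (k * x) * complex_of_real (cos_prod d A \<alpha> h x)) =
    (LINT x|circle_measure. (\<Sum>p\<in>disjoint_pairs A. case p of (S, T) \<Rightarrow>
      of_real \<alpha> ^ (card S + card T) * unit_exp (dot d (vec_sum S) h - dot d (vec_sum T) h) *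
      unit_exp ((real (card S) - real (card T) + k) * x)))"
    unfolding cos_prod_expand[OF assms(1)] sum_distrib_left
  proof (intro Bochner_Integration.integral_cong refl sum.cong, clarify)
    fix x and S T :: "(nat \<Rightarrow> real) set"
    have "(real (card S) - real (card T) + k) * x = k * x + (real (card S) - real (card T)) * x"
      by (simp add: algebra_simps)
    then show "unit_exp (k * x) * (of_real \<alpha> ^ (card S + card T) * unit_exp (dot d (vec_sum S) h - dot d (vec_sum T) h) *
       unit_exp ((real (card S) - real (card T)) * x)) =
       of_real \<alpha> ^ (card S + card T) * unit_exp (dot d (vec_sum S) h - dot d (vec_sum T) h) *
       unit_exp ((real (card S) - real (card T) + k) * x)"
      by (simp only: unit_exp_add mult_ac)
  qed
  also have "\<dots> = (\<Sum>p\<in>disjoint_pairs A. LINT x|circle_measure. (case p of (S, T) \<Rightarrow>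
      of_real \<alpha> ^ (card S + card T) * unit_exp (dot d (vec_sum S) h - dot d (vec_sum T) h) *
      unit_exp ((real (card S) - real (card T) + k) * x)))"
    by (intro Bochner_Integration.integral_sum integrable_circle_continuous)
      (auto intro!: continuous_intros split: prod.split)
  also have "\<dots> = (\<Sum>(S, T)\<in>disjoint_pairs A. of_real \<alpha> ^ (card S + card T) * unit_exp (dot d (vec_sum S) h - dot d (vec_sum T) h) *
      (if real (card S) - real (card T) + k = 0 then 1 else 0))"
  proof (intro sum.cong refl, clarify)
    fix S T :: "(nat \<Rightarrow> real) set"
    have "real (card S) - real (card T) + k \<in> \<int>" using assms by (intro Ints_add Ints_diff) auto
    then show "(LINT x|circle_measure. of_real \<alpha> ^ (card S + card T) * unit_exp (dot d (vec_sum S) h - dot d (vec_sum T) h) *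
      unit_exp ((real (card S) - real (card T) + k) * x)) = of_real \<alpha> ^ (card S + card T) *
       unit_exp (dot d (vec_sum S) h - dot d (vec_sum T) h) * (if real (card S) - real (card T) + k = 0 then 1 else 0)"
      by (simp only: integral_mult_right_zero integral_circle_unit_exp)
  qed
  also have "\<dots> = (\<Sum>(S, T)\<in>{(S, T)\<in>disjoint_pairs A. real (card S) - real (card T) + k = 0}.
      of_real \<alpha> ^ (card S + card T) * unit_exp (dot d (vec_sum S) h - dot d (vec_sum T) h))"
    using finite_disjoint_pairs[OF assms(1)]
    by (intro sum.mono_neutral_cong_right) (auto split: if_splits)
  finally show ?thesis .
qed

definition balanced_pairs :: "'a set \<Rightarrow> ('a set \<times> 'a set) set" where
  "balanced_pairs A = {(S, T)\<in>disjoint_pairs A. card S = card T}"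

lemma finite_balanced_pairs: "finite A \<Longrightarrow> finite (balanced_pairs A)"
  unfolding balanced_pairs_def using finite_disjoint_pairs
  by (rule rev_finite_subset) auto

lemma cos_avg_expand:
  assumes "finite A"
  shows "complex_of_real (cos_avg d A \<alpha> h) = (\<Sum>(S, T)\<in>balanced_pairs A.
    of_real \<alpha> ^ (2 * card S) * unit_exp (dot d (vec_sum S) h - dot d (vec_sum T) h))"
proof -
  have "complex_of_real (cos_avg d A \<alpha> h) = (LINT x|circle_measure. unit_exp (0 * x) * complex_of_real (cos_prod d A \<alpha> h x))"
    unfolding cos_avg_def by simp
  also have "\<dots> = (\<Sum>(S, T)\<in>{(S, T)\<in>disjoint_pairs A. real (card S) - real (card T) + 0 = 0}.
      of_real \<alpha> ^ (card S + card T) * unit_exp (dot d (vec_sum S) h - dot d (vec_sum T) h))"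
    by (rule integral_unit_exp_cos_prod[OF assms]) auto
  also have "\<dots> = (\<Sum>(S, T)\<in>balanced_pairs A.
    of_real \<alpha> ^ (2 * card S) * unit_exp (dot d (vec_sum S) h - dot d (vec_sum T) h))"
    by (intro sum.cong) (auto simp: balanced_pairs_def mult_2)
  finally show ?thesis .
qed

text \<open>In \<open>x\<close> the product has frequencies of at most \<open>card A\<close> in
  absolute value, too small to cancel \<open>k\<close>.\<close>

lemma integral_unit_exp_cos_prod_eq_0:
  assumes "finite A" "k \<in> \<int>" "\<bar>k\<bar> > real (card A)"
  shows "(LINT x|circle_measure. unit_exp (k * x) * complex_of_real (cos_prod d A \<alpha> h x)) = 0"
proof -
  have "real (card S) - real (card T) + k \<noteq> 0" if "(S, T) \<in> disjoint_pairs A" for S T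
  proof -
    have "card S \<le> card A" "card T \<le> card A"
      using that assms(1) by (auto simp: disjoint_pairs_def intro!: card_mono)
    then show ?thesis using assms(3) by linarith
  qed
  then have "{(S, T)\<in>disjoint_pairs A. real (card S) - real (card T) + k = 0} = {}" by auto
  then show ?thesis unfolding integral_unit_exp_cos_prod[OF assms(1,2)] by (simp only: sum.empty)
qed

section \<open>Extremal parts of trigonometric polynomials\<close>

definition cube :: "nat \<Rightarrow> (nat \<Rightarrow> real) set" where
  "cube d = {..<d} \<rightarrow>\<^sub>E {0, 1}"

lemma finite_cube: "finite (cube d)"
  unfolding cube_def by (intro finite_PiE) auto

lemma card_cube: "card (cube d) = 2 ^ d"
  by (simp add: cube_def card_PiE numeral_2_eq_2)

locale cube_pair =
  fixes d :: nat and w w' :: "nat \<Rightarrow> real"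
  assumes w: "w \<in> cube d" "w' \<in> cube d" "w \<noteq> w'"
begin

definition dir :: "nat \<Rightarrow> real" where "dir i = w i - w' i"

text \<open>The number of coordinates in which \<open>w\<close> and \<open>w'\<close> differ, since
  \<open>dir\<close> has entries -1, 0 and 1.\<close>

definition len :: real where "len = dot d dir dir"

definition trig_mono :: "complex \<Rightarrow> nat \<Rightarrow> (nat \<Rightarrow> real) \<Rightarrow> real \<Rightarrow> (nat \<Rightarrow> real) \<Rightarrow> complex" where
  "trig_mono c k v \<alpha> h = c * of_real \<alpha> ^ (2 * k) * unit_exp (dot d v h)"

text \<open>The phase \<open>- k * dot d dir h\<close> is built in: the coefficient of
  \<open>t ^ N\<close> is already multiplied by the character that tests the frequency
  \<open>N dir\<close> and only remains to be integrated.\<close>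

definition extremal_mono :: "complex \<Rightarrow> nat \<Rightarrow> (nat \<Rightarrow> real) \<Rightarrow> (nat \<Rightarrow> real) \<Rightarrow> complex poly" where
  "extremal_mono c k v h = (if dot d dir v = len * real k
     then monom (c * unit_exp (dot d v h - real k * dot d dir h)) k else 0)"

text \<open>
  A monomial \<open>\<alpha>\<^sup>2\<^sup>k e(v \<bullet> h)\<close> is extremal if its frequency along \<open>dir\<close> attains the bound \<open>len * k\<close>. Recording the
  extremal monomials as powers \<open>t\<^sup>k\<close> is multiplicative. The Fourier coefficient of \<open>X \<alpha>\<close> at \<open>N dir\<close> has order at
  least \<open>2 N\<close> in \<open>\<alpha>\<close>, and its leading coefficient is read off from \<open>Y\<close>.
\<close>
inductive extremal_part :: "(real \<Rightarrow> (nat \<Rightarrow> real) \<Rightarrow> complex) \<Rightarrow> ((nat \<Rightarrow> real) \<Rightarrow> complex poly) \<Rightarrow> bool" where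
  zero: "extremal_part (\<lambda>\<alpha> h. 0) (\<lambda>h. 0)"
| add: "extremal_part X Y \<Longrightarrow> (\<And>i. i < d \<Longrightarrow> v i \<in> \<int>) \<Longrightarrow> dot d dir v \<le> len * real k \<Longrightarrow>
    extremal_part (\<lambda>\<alpha> h. trig_mono c k v \<alpha> h + X \<alpha> h) (\<lambda>h. extremal_mono c k v h + Y h)"

lemma extremal_part_mono:
  "(\<And>i. i < d \<Longrightarrow> v i \<in> \<int>) \<Longrightarrow> dot d dir v \<le> len * real k \<Longrightarrow> extremal_part (trig_mono c k v) (extremal_mono c k v)"
  using add[OF zero, of v k c] by simp

lemma extremal_part_plus:
  assumes "extremal_part X Y" "extremal_part X' Y'"
  shows "extremal_part (\<lambda>\<alpha> h. X \<alpha> h + X' \<alpha> h) (\<lambda>h. Y h + Y' h)"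
  using assms by induction (auto simp: add.assoc intro: extremal_part.add)

lemma extremal_part_sum:
  assumes "\<And>i. i \<in> I \<Longrightarrow> extremal_part (X i) (Y i)"
  shows "extremal_part (\<lambda>\<alpha> h. \<Sum>i\<in>I. X i \<alpha> h) (\<lambda>h. \<Sum>i\<in>I. Y i h)"
  using assms
  by (induction I rule: infinite_finite_induct) (auto intro: extremal_part_plus zero)

lemma dot_dir_add: "dot d dir (\<lambda>i. v i + v' i) = dot d dir v + dot d dir v'"
  by (simp add: dot_def algebra_simps sum.distrib)

lemma trig_mono_mult: "trig_mono c k v \<alpha> h * trig_mono c' k' v' \<alpha> h = trig_mono (c * c') (k + k') (\<lambda>i. v i + v' i) \<alpha> h"
  by (simp add: trig_mono_def dot_add unit_exp_add distrib_left power_add)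

text \<open>The upper bounds on the frequencies along \<open>dir\<close> add up, so a product
  attains its bound exactly when both factors do.\<close>

lemma extremal_mono_mult:
  assumes "dot d dir v \<le> len * real k" "dot d dir v' \<le> len * real k'"
  shows "extremal_mono c k v h * extremal_mono c' k' v' h = extremal_mono (c * c') (k + k') (\<lambda>i. v i + v' i) h"
proof -
  have "dot d dir (\<lambda>i. v i + v' i) = len * real (k + k') \<longleftrightarrow> dot d dir v = len * real k \<and> dot d dir v' = len * real k'"
    using assms unfolding dot_dir_add of_nat_add distrib_left by linarith
  moreover have "unit_exp (dot d v h + dot d v' h - real (k + k') * dot d dir h) =
    unit_exp (dot d v h - real k * dot d dir h) * unit_exp (dot d v' h - real k' * dot d dir h)"
    unfolding unit_exp_add [symmetric] by (rule arg_cong[of _ _ unit_exp]) (simp add: algebra_simps)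
  ultimately show ?thesis
    by (simp add: extremal_mono_def mult_monom dot_add mult_ac)
qed

lemma extremal_part_mono_mult:
  assumes "extremal_part X Y" and v: "\<And>i. i < d \<Longrightarrow> v i \<in> \<int>" "dot d dir v \<le> len * real k"
  shows "extremal_part (\<lambda>\<alpha> h. trig_mono c k v \<alpha> h * X \<alpha> h) (\<lambda>h. extremal_mono c k v h * Y h)"
  using assms(1)
proof induction
  case zero
  then show ?case using extremal_part.zero by simp
next
  case (add X Y v' k' c')
  have "dot d dir (\<lambda>i. v i + v' i) \<le> len * real (k + k')"
    using v(2) add.hyps(3) by (simp add: dot_dir_add distrib_left)
  then show ?case
    unfolding distrib_left trig_mono_mult extremal_mono_mult[OF v(2) add.hyps(3)]
    using v(1) add.hyps(2) by (intro extremal_part.add add.IH) auto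
qed

lemma extremal_part_mult:
  assumes "extremal_part X Y" "extremal_part X' Y'"
  shows "extremal_part (\<lambda>\<alpha> h. X \<alpha> h * X' \<alpha> h) (\<lambda>h. Y h * Y' h)"
  using assms(1)
proof induction
  case zero
  then show ?case using extremal_part.zero by simp
next
  case (add X Y v k c)
  show ?case unfolding distrib_right
    using add by (intro extremal_part_plus extremal_part_mono_mult assms(2)) auto
qed

lemma extremal_part_const: "extremal_part (\<lambda>\<alpha> h. c) (\<lambda>h. [:c:])"
proof -
  have "extremal_part (trig_mono c 0 (\<lambda>_. 0)) (extremal_mono c 0 (\<lambda>_. 0))"
    by (rule extremal_part_mono) (auto simp: dot_def)
  moreover have "trig_mono c 0 (\<lambda>_. 0) = (\<lambda>\<alpha> h. c)" "extremal_mono c 0 (\<lambda>_. 0) = (\<lambda>h. [:c:])"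
    by (auto simp: fun_eq_iff trig_mono_def extremal_mono_def dot_def monom_0)
  ultimately show ?thesis by simp
qed

lemma extremal_part_power:
  assumes "extremal_part X Y"
  shows "extremal_part (\<lambda>\<alpha> h. X \<alpha> h ^ n) (\<lambda>h. Y h ^ n)"
proof (induction n)
  case 0
  then show ?case using extremal_part_const[of 1] by (simp add: one_pCons)
next
  case (Suc n)
  then show ?case using extremal_part_mult[OF assms] by simp
qed

lemma w_values: "i < d \<Longrightarrow> w i = 0 \<or> w i = 1" "i < d \<Longrightarrow> w' i = 0 \<or> w' i = 1"
  "\<not> i < d \<Longrightarrow> w i = undefined" "\<not> i < d \<Longrightarrow> w' i = undefined"
  using w by (auto simp: cube_def PiE_iff extensional_def)

lemma dir_Ints: "i < d \<Longrightarrow> dir i \<in> \<int>"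
  using w_values(1,2)[of i] by (auto simp: dir_def)

lemma len_pos: "len > 0"
proof -
  obtain i where i: "w i \<noteq> w' i" using w(3) by auto
  then have "i < d" using w_values(3,4) by metis
  then show ?thesis unfolding len_def dot_def using i
    by (intro sum_pos2[of _ i]) (auto simp: dir_def mult_pos_pos zero_less_mult_iff)
qed

lemma extremal_part_measurable_aux:
  assumes "extremal_part X Y"
  shows "(\<lambda>h. X \<alpha> h) \<in> borel_measurable (torus_measure d) \<and> (\<lambda>h. coeff (Y h) N) \<in> borel_measurable (torus_measure d) \<and>
    (\<exists>B. \<forall>\<alpha> h. \<bar>\<alpha>\<bar> \<le> 1 \<longrightarrow> norm (X \<alpha> h) \<le> B) \<and> (\<exists>B. \<forall>h. norm (coeff (Y h) N) \<le> B)"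
  using assms
proof induction
  case zero
  show ?case by auto
next
  case (add X Y v k c)
  note IH = add.IH[THEN conjunct1] add.IH[THEN conjunct2, THEN conjunct1]
    add.IH[THEN conjunct2, THEN conjunct2, THEN conjunct1] add.IH[THEN conjunct2, THEN conjunct2, THEN conjunct2]
  have m: "(\<lambda>h. trig_mono c k v \<alpha> h) \<in> borel_measurable (torus_measure d)"
    unfolding trig_mono_def by measurable
  have r1: "(\<lambda>h. trig_mono c k v \<alpha> h + X \<alpha> h) \<in> borel_measurable (torus_measure d)"
    by (intro borel_measurable_add m IH(1))
  have "(\<lambda>h. coeff (extremal_mono c k v h) N) \<in> borel_measurable (torus_measure d)"
  proof -
    have "(\<lambda>h. c * unit_exp (dot d v h - real k * dot d dir h)) \<in> borel_measurable (torus_measure d)"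
      by measurable
    then show ?thesis
      unfolding extremal_mono_def by (cases "dot d dir v = len * real k"; cases "k = N") simp_all
  qed
  then have r2: "(\<lambda>h. coeff (extremal_mono c k v h + Y h) N) \<in> borel_measurable (torus_measure d)"
    unfolding coeff_add by (intro borel_measurable_add IH(2))
  obtain B where "\<forall>\<alpha> h. \<bar>\<alpha>\<bar> \<le> 1 \<longrightarrow> norm (X \<alpha> h) \<le> B" using IH(3) by blast
  then have r3: "\<exists>B. \<forall>\<alpha> h. \<bar>\<alpha>\<bar> \<le> 1 \<longrightarrow> norm (trig_mono c k v \<alpha> h + X \<alpha> h) \<le> B"
    by (intro exI[of _ "norm c + B"] allI impI norm_triangle_mono)
      (auto simp: trig_mono_def norm_mult norm_power mult_left_le power_le_one)
  obtain B where "\<forall>h. norm (coeff (Y h) N) \<le> B" using IH(4) by blast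
  then have r4: "\<exists>B. \<forall>h. norm (coeff (extremal_mono c k v h + Y h) N) \<le> B"
    unfolding coeff_add
    by (intro exI[of _ "norm c + B"] allI norm_triangle_mono)
      (auto simp: extremal_mono_def norm_mult)
  show ?case by (intro conjI r1 r2 r3 r4)
qed

lemma extremal_part_measurable:
  assumes "extremal_part X Y"
  shows "(\<lambda>h. X \<alpha> h) \<in> borel_measurable (torus_measure d)"
    and "(\<lambda>h. coeff (Y h) N) \<in> borel_measurable (torus_measure d)"
    and "\<exists>B. \<forall>\<alpha> h. \<bar>\<alpha>\<bar> \<le> 1 \<longrightarrow> norm (X \<alpha> h) \<le> B"
    and "\<exists>B. \<forall>h. norm (coeff (Y h) N) \<le> B"
  using extremal_part_measurable_aux[OF assms] by blast+

lemma extremal_part_integrable: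
  assumes "extremal_part X Y"
  shows "\<bar>\<alpha>\<bar> \<le> 1 \<Longrightarrow> integrable (torus_measure d) (\<lambda>h. X \<alpha> h * unit_exp (dot d v h))"
    and "integrable (torus_measure d) (\<lambda>h. coeff (Y h) N)"
proof -
  obtain B where B: "\<And>\<alpha> h. \<bar>\<alpha>\<bar> \<le> 1 \<Longrightarrow> norm (X \<alpha> h) \<le> B" using extremal_part_measurable(3)[OF assms] by blast
  show "integrable (torus_measure d) (\<lambda>h. X \<alpha> h * unit_exp (dot d v h))" if "\<bar>\<alpha>\<bar> \<le> 1"
    using B[OF that] extremal_part_measurable(1)[OF assms]
    by (intro integrable_torus_bounded[of _ _ B] borel_measurable_times) (auto simp: norm_mult)
  obtain B where B: "\<And>h. norm (coeff (Y h) N) \<le> B" using extremal_part_measurable(4)[OF assms] by blast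
  then show "integrable (torus_measure d) (\<lambda>h. coeff (Y h) N)"
    by (intro integrable_torus_bounded[of _ _ B] extremal_part_measurable(2)[OF assms])
qed

lemma dot_dir_eq_len:
  assumes "\<forall>i<d. v i - real N * dir i = 0"
  shows "dot d dir v = len * real N"
proof -
  have "dot d dir v = (\<Sum>i<d. dir i * (real N * dir i))"
    unfolding dot_def using assms by (intro sum.cong) auto
  then show ?thesis by (simp add: len_def dot_def sum_distrib_left mult_ac)
qed

text \<open>One monomial at a time, by linearity. Integration leaves only \<open>v = N dir\<close>
  on the first \<open>d\<close> coordinates, and then
  \<open>len * N = dot d dir v \<le> len * k\<close> gives \<open>k \<ge> N\<close>. The case
  \<open>k = N\<close> is extremal and reproduced exactly; \<open>k > N\<close> has order at least
  \<open>2 * N + 2\<close>.\<close>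

lemma extremal_part_limit:
  assumes "extremal_part X Y"
  shows "\<exists>C\<ge>0. \<forall>\<alpha>. 0 \<le> \<alpha> \<and> \<alpha> \<le> 1 \<longrightarrow>
    norm ((LINT h|torus_measure d. X \<alpha> h * unit_exp (dot d (\<lambda>i. - real N * dir i) h)) -
      of_real \<alpha> ^ (2 * N) * (LINT h|torus_measure d. coeff (Y h) N)) \<le> C * \<alpha> ^ (2 * N + 2)"
  using assms
proof induction
  case zero
  show ?case by (auto intro: exI[of _ 0])
next
  case (add X Y v k c)
  define e where "e = (\<lambda>h. unit_exp (dot d (\<lambda>i. - real N * dir i) h))"
  define u where "u = (\<lambda>i. v i - real N * dir i)"
  have u: "u i \<in> \<int>" if "i < d" for i
    using that add.hyps(2) dir_Ints by (auto simp: u_def)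
  have dot_u: "dot d u h = dot d v h - real N * dot d dir h" for h
    by (simp add: u_def dot_diff dot_scale)
  define z where "z = (if \<forall>i<d. u i = 0 then 1 else 0 :: complex)"
  have z: "(LINT h|torus_measure d. unit_exp (dot d u h)) = z"
    using integral_torus_unit_exp[of d u] u by (simp add: z_def)
  obtain C where C: "C \<ge> 0" "\<And>\<alpha>. 0 \<le> \<alpha> \<Longrightarrow> \<alpha> \<le> 1 \<Longrightarrow>
    norm ((LINT h|torus_measure d. X \<alpha> h * e h) - of_real \<alpha> ^ (2 * N) * (LINT h|torus_measure d. coeff (Y h) N))
      \<le> C * \<alpha> ^ (2 * N + 2)"
    using add.IH unfolding e_def by blast
  have ep: "extremal_part (trig_mono c k v) (extremal_mono c k v)"
    by (rule extremal_part_mono) (use add.hyps in auto)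
  have 1: "(LINT h|torus_measure d. trig_mono c k v \<alpha> h * e h) = c * of_real \<alpha> ^ (2 * k) * z" for \<alpha>
  proof -
    have "trig_mono c k v \<alpha> h * e h = c * of_real \<alpha> ^ (2 * k) * unit_exp (dot d u h)" for h
      using unit_exp_add[of "dot d v h" "- real N * dot d dir h"]
      by (simp add: trig_mono_def e_def dot_u dot_scale[of d "- real N" dir, simplified])
    then show ?thesis by (simp add: z)
  qed
  have 2: "(LINT h|torus_measure d. coeff (extremal_mono c k v h) N) =
    (if dot d dir v = len * real k \<and> k = N then c * z else 0)"
  proof (cases "dot d dir v = len * real k \<and> k = N")
    case True
    then have "coeff (extremal_mono c k v h) N = c * unit_exp (dot d u h)" for h
      by (simp add: extremal_mono_def dot_u)
    then show ?thesis using True by (simp add: z)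
  next
    case False
    then have "coeff (extremal_mono c k v h) N = 0" for h by (auto simp: extremal_mono_def)
    then show ?thesis using False by auto
  qed
  have bound: "norm (c * of_real \<alpha> ^ (2 * k) * z - of_real \<alpha> ^ (2 * N) * (if dot d dir v = len * real k \<and> k = N then c * z else 0))
     \<le> norm c * \<alpha> ^ (2 * N + 2)" if a: "0 \<le> \<alpha>" "\<alpha> \<le> 1" for \<alpha>
  proof (cases "\<forall>i<d. u i = 0")
    case True
    then have "z = 1" by (simp add: z_def)
    have dv: "dot d dir v = len * real N" using True by (intro dot_dir_eq_len) (auto simp: u_def)
    then have "k \<ge> N" using add.hyps(3) len_pos by simp
    show ?thesis
    proof (cases "k = N")
      case True
      then show ?thesis using dv a by (simp add: mult_ac)
    next
      case False
      then have "2 * N + 2 \<le> 2 * k" using \<open>k \<ge> N\<close> by linarith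
      then have "\<alpha> ^ (2 * k) \<le> \<alpha> ^ (2 * N + 2)" using a by (intro power_decreasing)
      then show ?thesis using False a \<open>z = 1\<close> by (simp add: norm_mult norm_power mult_left_mono del: power_Suc)
    qed
  next
    case False
    then have "z = 0" unfolding z_def by (rule if_not_P)
    then show ?thesis using a by simp
  qed
  have "\<exists>D\<ge>0. \<forall>\<alpha>. 0 \<le> \<alpha> \<and> \<alpha> \<le> 1 \<longrightarrow> norm ((LINT h|torus_measure d. (trig_mono c k v \<alpha> h + X \<alpha> h) * e h) -
      of_real \<alpha> ^ (2 * N) * (LINT h|torus_measure d. coeff (extremal_mono c k v h + Y h) N)) \<le> D * \<alpha> ^ (2 * N + 2)"
  proof (intro exI[of _ "norm c + C"] conjI allI impI)
    show "0 \<le> norm c + C" using C(1) by simp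
    fix \<alpha> :: real assume a: "0 \<le> \<alpha> \<and> \<alpha> \<le> 1"
    then have abs: "\<bar>\<alpha>\<bar> \<le> 1" by simp
    have i1: "(LINT h|torus_measure d. (trig_mono c k v \<alpha> h + X \<alpha> h) * e h) =
      (LINT h|torus_measure d. trig_mono c k v \<alpha> h * e h) + (LINT h|torus_measure d. X \<alpha> h * e h)"
      unfolding distrib_right e_def
      by (intro Bochner_Integration.integral_add extremal_part_integrable(1)[OF ep abs]
        extremal_part_integrable(1)[OF add.hyps(1) abs])
    have i2: "(LINT h|torus_measure d. coeff (extremal_mono c k v h + Y h) N) =
      (LINT h|torus_measure d. coeff (extremal_mono c k v h) N) + (LINT h|torus_measure d. coeff (Y h) N)"
      unfolding coeff_add
      by (intro Bochner_Integration.integral_add extremal_part_integrable(2)[OF ep]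
        extremal_part_integrable(2)[OF add.hyps(1)])
    have "norm ((LINT h|torus_measure d. (trig_mono c k v \<alpha> h + X \<alpha> h) * e h) -
        of_real \<alpha> ^ (2 * N) * (LINT h|torus_measure d. coeff (extremal_mono c k v h + Y h) N)) =
      norm ((c * of_real \<alpha> ^ (2 * k) * z - of_real \<alpha> ^ (2 * N) * (if dot d dir v = len * real k \<and> k = N then c * z else 0)) +
       ((LINT h|torus_measure d. X \<alpha> h * e h) - of_real \<alpha> ^ (2 * N) * (LINT h|torus_measure d. coeff (Y h) N)))"
      unfolding i1 i2 1 2 by (rule arg_cong[of _ _ norm]) (simp only: algebra_simps)
    also have "\<dots> \<le> norm c * \<alpha> ^ (2 * N + 2) + C * \<alpha> ^ (2 * N + 2)"
      by (intro norm_triangle_mono bound C(2)) (use a in auto)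
    finally show "norm ((LINT h|torus_measure d. (trig_mono c k v \<alpha> h + X \<alpha> h) * e h) -
        of_real \<alpha> ^ (2 * N) * (LINT h|torus_measure d. coeff (extremal_mono c k v h + Y h) N))
      \<le> (norm c + C) * \<alpha> ^ (2 * N + 2)" by (simp only: distrib_right)
  qed
  then show ?case by (simp only: e_def)
qed

end

section \<open>Faces of the cube and elementary symmetric polynomials\<close>

lemma cube_values: "\<eta> \<in> cube d \<Longrightarrow> i < d \<Longrightarrow> \<eta> i = 0 \<or> \<eta> i = 1"
  "\<eta> \<in> cube d \<Longrightarrow> \<not> i < d \<Longrightarrow> \<eta> i = undefined"
  by (auto simp: cube_def PiE_iff extensional_def)

lemma cubeI: "(\<And>i. i < d \<Longrightarrow> \<eta> i = 0 \<or> \<eta> i = 1) \<Longrightarrow> (\<And>i. \<not> i < d \<Longrightarrow> \<eta> i = undefined) \<Longrightarrow> \<eta> \<in> cube d"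
  by (auto simp: cube_def PiE_iff extensional_def)

lemma sum_le_card_eq_iff:
  fixes f :: "'a \<Rightarrow> real"
  assumes "finite S" "\<And>x. x \<in> S \<Longrightarrow> f x \<le> c"
  shows "sum f S \<le> real (card S) * c" and "sum f S = real (card S) * c \<longleftrightarrow> (\<forall>x\<in>S. f x = c)"
proof -
  have 1: "(\<Sum>x\<in>S. c - f x) = real (card S) * c - sum f S" by (simp add: sum_subtractf)
  have "(\<Sum>x\<in>S. c - f x) \<ge> 0" using assms by (intro sum_nonneg) auto
  then show "sum f S \<le> real (card S) * c" unfolding 1 by linarith
  have "sum f S = real (card S) * c \<longleftrightarrow> (\<Sum>x\<in>S. c - f x) = 0" unfolding 1 by linarith
  also have "\<dots> \<longleftrightarrow> (\<forall>x\<in>S. c - f x = 0)"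
    using assms by (intro sum_nonneg_eq_0_iff) auto
  also have "\<dots> \<longleftrightarrow> (\<forall>x\<in>S. f x = c)" by (intro ball_cong refl) linarith
  finally show "sum f S = real (card S) * c \<longleftrightarrow> (\<forall>x\<in>S. f x = c)" .
qed

context cube_pair
begin

text \<open>By \<open>dot_dir_le\<close>, \<open>w\<close> maximises and \<open>w'\<close> minimises
  the functional \<open>dot d dir\<close> on the cube, so these are two opposite faces of extremal
  vertices.\<close>

definition top_face :: "(nat \<Rightarrow> real) set" where "top_face = {\<eta>\<in>cube d. dot d dir \<eta> = dot d dir w}"
definition bot_face :: "(nat \<Rightarrow> real) set" where "bot_face = {\<eta>\<in>cube d. dot d dir \<eta> = dot d dir w'}"
definition shift :: "(nat \<Rightarrow> real) \<Rightarrow> nat \<Rightarrow> real" where "shift \<eta> i = \<eta> i - dir i"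

lemma dir_coord_le:
  assumes "\<eta> \<in> cube d" "i < d"
  shows "dir i * \<eta> i \<le> dir i * w i" "dir i * w' i \<le> dir i * \<eta> i"
    and "dir i * \<eta> i = dir i * w i \<longleftrightarrow> dir i = 0 \<or> \<eta> i = w i"
    and "dir i * \<eta> i = dir i * w' i \<longleftrightarrow> dir i = 0 \<or> \<eta> i = w' i"
  using cube_values(1)[OF assms] w_values(1,2)[OF assms(2)] by (auto simp: dir_def)

lemma dot_dir_le:
  assumes "\<eta> \<in> cube d"
  shows "dot d dir \<eta> \<le> dot d dir w" "dot d dir w' \<le> dot d dir \<eta>"
  unfolding dot_def using dir_coord_le(1,2)[OF assms] by (auto intro!: sum_mono)

lemma len_eq: "len = dot d dir w - dot d dir w'"
  by (simp add: len_def dot_def dir_def sum_subtractf [symmetric] algebra_simps)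

lemma top_face_iff:
  assumes "\<eta> \<in> cube d"
  shows "\<eta> \<in> top_face \<longleftrightarrow> (\<forall>i<d. dir i = 0 \<or> \<eta> i = w i)"
proof -
  have "\<eta> \<in> top_face \<longleftrightarrow> (\<Sum>i<d. dir i * w i - dir i * \<eta> i) = 0"
    using assms by (auto simp: top_face_def dot_def sum_subtractf)
  also have "\<dots> \<longleftrightarrow> (\<forall>i\<in>{..<d}. dir i * w i - dir i * \<eta> i = 0)"
    using dir_coord_le(1)[OF assms] by (intro sum_nonneg_eq_0_iff) auto
  also have "\<dots> \<longleftrightarrow> (\<forall>i<d. dir i = 0 \<or> \<eta> i = w i)"
    by auto
  finally show ?thesis .
qed

lemma bot_face_iff:
  assumes "\<eta> \<in> cube d"
  shows "\<eta> \<in> bot_face \<longleftrightarrow> (\<forall>i<d. dir i = 0 \<or> \<eta> i = w' i)"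
proof -
  have "\<eta> \<in> bot_face \<longleftrightarrow> (\<Sum>i<d. dir i * \<eta> i - dir i * w' i) = 0"
    using assms by (auto simp: bot_face_def dot_def sum_subtractf)
  also have "\<dots> \<longleftrightarrow> (\<forall>i\<in>{..<d}. dir i * \<eta> i - dir i * w' i = 0)"
    using dir_coord_le(2)[OF assms] by (intro sum_nonneg_eq_0_iff) auto
  also have "\<dots> \<longleftrightarrow> (\<forall>i<d. dir i = 0 \<or> \<eta> i = w' i)"
    by auto
  finally show ?thesis .
qed

lemma dir_outside: "\<not> i < d \<Longrightarrow> dir i = 0"
  using w_values(3,4) by (simp add: dir_def)

lemma inj_shift: "inj_on shift U"
  by (auto simp: inj_on_def shift_def fun_eq_iff)

text \<open>A vertex of the top face agrees with \<open>w\<close> wherever \<open>dir\<close> is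
  nonzero, and subtracting \<open>dir\<close> turns just these coordinates into those of
  \<open>w'\<close>. Outside \<open>{..<d}\<close> \<open>dir\<close> is 0, which preserves
  \<open>undefined\<close>.\<close>

lemma shift_top_face: "shift ` top_face = bot_face"
proof (intro equalityI subsetI)
  fix \<zeta> assume "\<zeta> \<in> shift ` top_face"
  then obtain \<eta> where \<eta>: "\<eta> \<in> top_face" "\<zeta> = shift \<eta>" by auto
  then have c: "\<eta> \<in> cube d" by (simp add: top_face_def)
  have "\<forall>i<d. dir i = 0 \<or> \<eta> i = w i" using \<eta> top_face_iff[OF c] by simp
  then have v: "shift \<eta> i = (if dir i = 0 then \<eta> i else w' i)" if "i < d" for i
    using that by (auto simp: shift_def dir_def)
  have "shift \<eta> \<in> cube d"
  proof (rule cubeI)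
    show "shift \<eta> i = 0 \<or> shift \<eta> i = 1" if "i < d" for i
      using v[OF that] cube_values(1)[OF c that] w_values(2)[OF that] by auto
    show "shift \<eta> i = undefined" if "\<not> i < d" for i
      using that cube_values(2)[OF c that] by (simp add: shift_def dir_outside)
  qed
  then show "\<zeta> \<in> bot_face" using v \<eta> by (auto simp: bot_face_iff)
next
  fix \<zeta> assume b: "\<zeta> \<in> bot_face"
  then have c: "\<zeta> \<in> cube d" by (simp add: bot_face_def)
  define \<eta> where "\<eta> = (\<lambda>i. \<zeta> i + dir i)"
  have z: "\<forall>i<d. dir i = 0 \<or> \<zeta> i = w' i" using b bot_face_iff[OF c] by simp
  then have v: "\<eta> i = (if dir i = 0 then \<zeta> i else w i)" if "i < d" for i
    using that by (auto simp: \<eta>_def dir_def)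
  have "\<eta> \<in> cube d"
  proof (rule cubeI)
    show "\<eta> i = 0 \<or> \<eta> i = 1" if "i < d" for i
      using v[OF that] cube_values(1)[OF c that] w_values(1)[OF that] by auto
    show "\<eta> i = undefined" if "\<not> i < d" for i
      using that cube_values(2)[OF c that] by (simp add: \<eta>_def dir_outside)
  qed
  then have "\<eta> \<in> top_face" using v by (auto simp: top_face_iff)
  moreover have "\<zeta> = shift \<eta>" by (simp add: shift_def \<eta>_def fun_eq_iff)
  ultimately show "\<zeta> \<in> shift ` top_face" by blast
qed

lemma shift_w: "shift w = w'"
  by (simp add: shift_def dir_def fun_eq_iff)

lemma faces: "w \<in> top_face" "w' \<in> bot_face" "top_face \<inter> bot_face = {}" "finite top_face"
  using w len_pos len_eq finite_cube[of d] by (auto simp: top_face_def bot_face_def)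

lemma dot_vec_sum_shift: "finite S \<Longrightarrow> dot d (vec_sum (shift ` S)) h = dot d (vec_sum S) h - real (card S) * dot d dir h"
proof -
  have "dot d (shift \<eta>) h = dot d \<eta> h - dot d dir h" for \<eta>
    by (simp add: dot_def shift_def left_diff_distrib sum_subtractf)
  then show ?thesis
    by (simp add: dot_vec_sum sum.reindex[OF inj_shift] sum_subtractf)
qed

text \<open>A vertex in \<open>S\<close> adds at most \<open>dot d dir w\<close>, one in
  \<open>T\<close> at most \<open>- dot d dir w'\<close>, and these two bounds sum to
  \<open>len\<close>. Equality in total forces equality at every vertex.\<close>

lemma balanced_pair_extremal:
  assumes A: "A \<subseteq> cube d" and ST: "(S, T) \<in> balanced_pairs A"
  shows "dot d dir (\<lambda>i. vec_sum S i - vec_sum T i) \<le> len * real (card S)"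
    and "dot d dir (\<lambda>i. vec_sum S i - vec_sum T i) = len * real (card S) \<longleftrightarrow> S \<subseteq> top_face \<and> T \<subseteq> bot_face"
proof -
  have sub: "S \<subseteq> cube d" "T \<subseteq> cube d" "card S = card T" using A ST by (auto simp: balanced_pairs_def disjoint_pairs_def)
  then have fin: "finite S" "finite T" using finite_cube finite_subset by blast+
  have dv: "dot d dir (vec_sum U) = (\<Sum>\<eta>\<in>U. dot d dir \<eta>)" for U
  proof -
    have "dot d dir (vec_sum U) = dot d (vec_sum U) dir" by (simp add: dot_def mult.commute)
    also have "\<dots> = (\<Sum>\<eta>\<in>U. dot d \<eta> dir)" by (rule dot_vec_sum)
    finally show ?thesis by (simp add: dot_def mult.commute)
  qed
  have eq: "dot d dir (\<lambda>i. vec_sum S i - vec_sum T i) = (\<Sum>\<eta>\<in>S. dot d dir \<eta>) + (\<Sum>\<eta>\<in>T. - dot d dir \<eta>)"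
  proof -
    have "dot d dir (\<lambda>i. vec_sum S i - vec_sum T i) = dot d dir (vec_sum S) - dot d dir (vec_sum T)"
      by (simp add: dot_def algebra_simps sum_subtractf)
    then show ?thesis by (simp add: dv sum_negf)
  qed
  have 1: "(\<Sum>\<eta>\<in>S. dot d dir \<eta>) \<le> real (card S) * dot d dir w"
    "(\<Sum>\<eta>\<in>S. dot d dir \<eta>) = real (card S) * dot d dir w \<longleftrightarrow> (\<forall>\<eta>\<in>S. dot d dir \<eta> = dot d dir w)"
    using sub dot_dir_le by (intro sum_le_card_eq_iff[OF fin(1)]; blast)+
  have 2: "(\<Sum>\<eta>\<in>T. - dot d dir \<eta>) \<le> real (card T) * (- dot d dir w')"
    "(\<Sum>\<eta>\<in>T. - dot d dir \<eta>) = real (card T) * (- dot d dir w') \<longleftrightarrow> (\<forall>\<eta>\<in>T. - dot d dir \<eta> = - dot d dir w')"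
    using sub dot_dir_le by (intro sum_le_card_eq_iff[OF fin(2)]; force)+
  have l: "len * real (card S) = real (card S) * dot d dir w + real (card T) * (- dot d dir w')"
    using sub(3) by (simp add: len_eq algebra_simps)
  show "dot d dir (\<lambda>i. vec_sum S i - vec_sum T i) \<le> len * real (card S)"
    unfolding eq l using 1(1) 2(1) by linarith
  have "dot d dir (\<lambda>i. vec_sum S i - vec_sum T i) = len * real (card S) \<longleftrightarrow>
    (\<forall>\<eta>\<in>S. dot d dir \<eta> = dot d dir w) \<and> (\<forall>\<eta>\<in>T. - dot d dir \<eta> = - dot d dir w')"
    unfolding eq l 1(2)[symmetric] 2(2)[symmetric] using 1(1) 2(1) by linarith
  then show "dot d dir (\<lambda>i. vec_sum S i - vec_sum T i) = len * real (card S) \<longleftrightarrow> S \<subseteq> top_face \<and> T \<subseteq> bot_face"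
    using sub by (auto simp: top_face_def bot_face_def)
qed

definition extremal_avg :: "(nat \<Rightarrow> real) set \<Rightarrow> (nat \<Rightarrow> real) \<Rightarrow> complex poly" where
  "extremal_avg A h = (\<Sum>(S, T)\<in>balanced_pairs A. extremal_mono 1 (card S) (\<lambda>i. vec_sum S i - vec_sum T i) h)"

lemma extremal_part_cos_avg:
  assumes A: "A \<subseteq> cube d"
  shows "extremal_part (\<lambda>\<alpha> h. complex_of_real (cos_avg d A \<alpha> h)) (extremal_avg A)"
proof -
  have fin: "finite A" using A finite_cube finite_subset by blast
  have "extremal_part (\<lambda>\<alpha> h. \<Sum>p\<in>balanced_pairs A. trig_mono 1 (card (fst p)) (\<lambda>i. vec_sum (fst p) i - vec_sum (snd p) i) \<alpha> h)
    (\<lambda>h. \<Sum>p\<in>balanced_pairs A. extremal_mono 1 (card (fst p)) (\<lambda>i. vec_sum (fst p) i - vec_sum (snd p) i) h)"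
  proof (intro extremal_part_sum extremal_part_mono)
    fix p assume p: "p \<in> balanced_pairs A"
    then show "dot d dir (\<lambda>i. vec_sum (fst p) i - vec_sum (snd p) i) \<le> len * real (card (fst p))"
      by (intro balanced_pair_extremal(1)[OF A]) simp
    fix i assume i: "i < d"
    have "vec_sum U i \<in> \<int>" if "U \<subseteq> cube d" for U
      unfolding vec_sum_def using that cube_values(1)[OF _ i] by (intro Ints_sum) force
    moreover have "fst p \<subseteq> cube d" "snd p \<subseteq> cube d"
      using p A by (auto simp: balanced_pairs_def disjoint_pairs_def)
    ultimately show "vec_sum (fst p) i - vec_sum (snd p) i \<in> \<int>" by simp
  qed
  also have "(\<lambda>\<alpha> h. \<Sum>p\<in>balanced_pairs A. trig_mono 1 (card (fst p)) (\<lambda>i. vec_sum (fst p) i - vec_sum (snd p) i) \<alpha> h) =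
    (\<lambda>\<alpha> h. complex_of_real (cos_avg d A \<alpha> h))"
    unfolding cos_avg_expand[OF fin] by (simp add: trig_mono_def dot_diff case_prod_beta)
  also have "(\<lambda>h. \<Sum>p\<in>balanced_pairs A. extremal_mono 1 (card (fst p)) (\<lambda>i. vec_sum (fst p) i - vec_sum (snd p) i) h) = extremal_avg A"
    by (simp add: extremal_avg_def[abs_def] case_prod_beta)
  finally show ?thesis .
qed

text \<open>The elementary symmetric polynomial of degree \<open>k\<close> in the numbers
  \<open>unit_exp (dot d \<eta> h)\<close> for \<open>\<eta> \<in> A\<close>.\<close>

definition elem_sym :: "(nat \<Rightarrow> real) set \<Rightarrow> nat \<Rightarrow> (nat \<Rightarrow> real) \<Rightarrow> complex" where
  "elem_sym A k h = (\<Sum>S\<in>{S. S \<subseteq> A \<and> card S = k}. unit_exp (dot d (vec_sum S) h))"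

text \<open>The faces are disjoint, so \<open>S\<close> and \<open>T\<close> range independently and
  the coefficient factors. Translation by \<open>dir\<close> turns the sum over \<open>T\<close>
  into one over subsets of the top face, the built-in phase cancels the displacement, and the minus
  sign makes the second factor the conjugate of the first.\<close>

lemma coeff_extremal_avg:
  assumes A: "A \<subseteq> cube d" and sh: "shift ` (A \<inter> top_face) = A \<inter> bot_face"
  shows "coeff (extremal_avg A h) k = of_real ((norm (elem_sym (A \<inter> top_face) k h))\<^sup>2)"
proof -
  define PS where "PS = {S. S \<subseteq> A \<inter> top_face \<and> card S = k}"
  define PT where "PT = {T. T \<subseteq> A \<inter> bot_face \<and> card T = k}"
  have fin: "finite A" using A finite_cube finite_subset by blast
  have finP: "finite PS" "finite PT" unfolding PS_def PT_def using fin by (auto intro: finite_subset[of _ "Pow A"])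
  have "coeff (extremal_avg A h) k = (\<Sum>(S, T)\<in>balanced_pairs A. if S \<subseteq> top_face \<and> T \<subseteq> bot_face \<and> card S = k
     then unit_exp (dot d (vec_sum S) h - dot d (vec_sum T) h - real k * dot d dir h) else 0)"
    unfolding extremal_avg_def coeff_sum
    by (intro sum.cong refl) (auto simp: extremal_mono_def balanced_pair_extremal(2)[OF A] dot_diff)
  also have "\<dots> = (\<Sum>(S, T)\<in>PS \<times> PT. unit_exp (dot d (vec_sum S) h - dot d (vec_sum T) h - real k * dot d dir h))"
  proof (rule sum.mono_neutral_cong_right)
    show "finite (balanced_pairs A)" by (rule finite_balanced_pairs[OF fin])
    show "PS \<times> PT \<subseteq> balanced_pairs A"
      using faces(3) by (auto simp: PS_def PT_def balanced_pairs_def disjoint_pairs_def)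
  qed (auto simp: PS_def PT_def balanced_pairs_def disjoint_pairs_def split: if_splits)
  also have "\<dots> = (\<Sum>S\<in>PS. \<Sum>T\<in>PT. unit_exp (dot d (vec_sum S) h) * unit_exp (- (dot d (vec_sum T) h + real k * dot d dir h)))"
    unfolding sum.cartesian_product unit_exp_add [symmetric]
    by (intro sum.cong refl) (auto simp: algebra_simps)
  also have "\<dots> = elem_sym (A \<inter> top_face) k h * (\<Sum>T\<in>PT. unit_exp (- (dot d (vec_sum T) h + real k * dot d dir h)))"
    unfolding elem_sym_def PS_def [symmetric] by (rule sum_product [symmetric])
  also have "(\<Sum>T\<in>PT. unit_exp (- (dot d (vec_sum T) h + real k * dot d dir h))) = (\<Sum>S\<in>PS. unit_exp (- dot d (vec_sum S) h))"
  proof (rule sum.reindex_cong[of "image shift"])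
    show "inj_on (image shift) PS" by (intro inj_on_image inj_shift)
    show "PT = image shift ` PS"
    proof (intro equalityI subsetI)
      fix T assume T: "T \<in> PT"
      then obtain S where S: "S \<subseteq> A \<inter> top_face" "T = shift ` S"
        unfolding PT_def sh[symmetric] by (auto elim!: subset_imageE)
      moreover have "card S = card T" unfolding S by (intro card_image [symmetric] inj_shift)
      ultimately show "T \<in> image shift ` PS" using T by (auto simp: PS_def PT_def)
    next
      fix T assume "T \<in> image shift ` PS"
      then show "T \<in> PT" unfolding PS_def PT_def sh[symmetric] by (auto simp: card_image[OF inj_shift])
    qed
    fix S assume "S \<in> PS"
    then have "finite S" "card S = k" using fin by (auto simp: PS_def intro: finite_subset)
    then show "unit_exp (- (dot d (vec_sum (shift ` S)) h + real k * dot d dir h)) = unit_exp (- dot d (vec_sum S) h)"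
      by (simp add: dot_vec_sum_shift)
  qed
  also have "(\<Sum>S\<in>PS. unit_exp (- dot d (vec_sum S) h)) = cnj (elem_sym (A \<inter> top_face) k h)"
    by (simp add: elem_sym_def PS_def cnj_unit_exp)
  also have "elem_sym (A \<inter> top_face) k h * cnj (elem_sym (A \<inter> top_face) k h) = of_real ((norm (elem_sym (A \<inter> top_face) k h))\<^sup>2)"
    by (rule complex_norm_square [symmetric])
  finally show ?thesis .
qed

text \<open>Square of the number of sets of vertices: crude, but common to all vertex pairs, as
  \<open>ex_negative_coeff\<close> demands.\<close>

definition coeff_bound :: real where "coeff_bound = (2 ^ card (cube d)) ^ 2"

lemma norm_elem_sym_le:
  assumes "A \<subseteq> cube d"
  shows "(norm (elem_sym A k h))\<^sup>2 \<le> coeff_bound"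
proof -
  have fin: "finite A" using assms finite_cube finite_subset by blast
  have "norm (elem_sym A k h) \<le> (\<Sum>S\<in>{S. S \<subseteq> A \<and> card S = k}. norm (unit_exp (dot d (vec_sum S) h)))"
    unfolding elem_sym_def by (rule norm_sum)
  also have "\<dots> = real (card {S. S \<subseteq> A \<and> card S = k})" by simp
  also have "card {S. S \<subseteq> A \<and> card S = k} \<le> card (Pow A)"
    using fin by (intro card_mono) auto
  also have "card (Pow A) = 2 ^ card A" by (rule card_Pow[OF fin])
  also have "(2::nat) ^ card A \<le> 2 ^ card (cube d)"
    using assms finite_cube by (intro power_increasing card_mono) auto
  finally have "norm (elem_sym A k h) \<le> 2 ^ card (cube d)" by simp
  then show ?thesis unfolding coeff_bound_def by (intro power_mono) auto
qed

text \<open>The lowest and highest coefficient come from a single subset each, the empty set and all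
  of \<open>A \<inter> top_face\<close>, so they are squared moduli of a unit complex
  number.\<close>

lemma extremal_avg_nonneg_poly:
  assumes A: "A \<subseteq> cube d" and sh: "shift ` (A \<inter> top_face) = A \<inter> bot_face"
  shows "nonneg_poly (card (A \<inter> top_face)) coeff_bound (extremal_avg A h)"
    and "coeff (extremal_avg A h) 0 = 1" "coeff (extremal_avg A h) (card (A \<inter> top_face)) = 1"
proof -
  note c = coeff_extremal_avg[OF A sh]
  have fin: "finite (A \<inter> top_face)" using faces(4) by blast
  have "coeff (extremal_avg A h) k = 0" if k: "k > card (A \<inter> top_face)" for k
  proof -
    have "card S \<noteq> k" if "S \<subseteq> A \<inter> top_face" for S using card_mono[OF fin that] k by simp
    then have "{S. S \<subseteq> A \<inter> top_face \<and> card S = k} = {}" by blast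
    then have "elem_sym (A \<inter> top_face) k h = 0" unfolding elem_sym_def by (simp only: sum.empty)
    then show ?thesis by (simp add: c)
  qed
  then have "degree (extremal_avg A h) \<le> card (A \<inter> top_face)" by (intro degree_le) auto
  then show "nonneg_poly (card (A \<inter> top_face)) coeff_bound (extremal_avg A h)"
    unfolding nonneg_poly_def c using norm_elem_sym_le[of "A \<inter> top_face"] A by auto
  have "{S. S \<subseteq> A \<inter> top_face \<and> card S = 0} = {{}}"
    using finite_subset[OF _ fin] by (auto simp del: Int_subset_iff le_inf_iff)
  then have "elem_sym (A \<inter> top_face) 0 h = unit_exp (dot d (vec_sum {}) h)" by (simp add: elem_sym_def)
  then show "coeff (extremal_avg A h) 0 = 1" by (simp add: c)
  have "{S. S \<subseteq> A \<inter> top_face \<and> card S = card (A \<inter> top_face)} = {A \<inter> top_face}"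
    using card_subset_eq[OF fin] by blast
  then have "elem_sym (A \<inter> top_face) (card (A \<inter> top_face)) h = unit_exp (dot d (vec_sum (A \<inter> top_face)) h)"
    unfolding elem_sym_def by (simp only: sum.insert finite.emptyI sum.empty) simp
  then show "coeff (extremal_avg A h) (card (A \<inter> top_face)) = 1" by (simp add: c)
qed

text \<open>Deleting \<open>w\<close> and \<open>w'\<close> takes one vertex from each face, which
  lowers the degree by one, and \<open>shift\<close> still matches the two faces because it sends
  \<open>w\<close> to \<open>w'\<close>.\<close>

lemma monic_extremal_family:
  "monic_poly_family (torus_measure d) (card top_face) coeff_bound (extremal_avg (cube d)) (extremal_avg (cube d - {w, w'}))"
proof -
  have 1: "shift ` (cube d \<inter> top_face) = cube d \<inter> bot_face" "cube d \<inter> top_face = top_face"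
    using shift_top_face by (auto simp: top_face_def bot_face_def Int_absorb1)
  have "w' \<notin> top_face" "w \<notin> bot_face" using faces by auto
  then have 2: "(cube d - {w, w'}) \<inter> top_face = top_face - {w}" "(cube d - {w, w'}) \<inter> bot_face = bot_face - {w'}"
    by (auto simp: top_face_def bot_face_def)
  have "shift ` (top_face - {w}) = bot_face - {w'}"
    using inj_on_image_set_diff[OF inj_shift[of UNIV], of top_face "{w}"] shift_top_face shift_w by auto
  then have 3: "shift ` ((cube d - {w, w'}) \<inter> top_face) = (cube d - {w, w'}) \<inter> bot_face" by (simp add: 2)
  have cards: "card ((cube d - {w, w'}) \<inter> top_face) = card top_face - 1" "card top_face \<ge> 1"
    using faces by (auto simp: 2 card_Diff_singleton Suc_le_eq card_gt_0_iff)
  note p1 = extremal_avg_nonneg_poly[OF order_refl 1(1), unfolded 1(2)]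
  note p2 = extremal_avg_nonneg_poly[OF Diff_subset 3, unfolded cards(1)]
  show ?thesis
  proof (intro monic_poly_family.intro nonneg_poly_family.intro nonneg_poly_family_axioms.intro monic_poly_family_axioms.intro)
    show "(\<lambda>h. coeff (extremal_avg (cube d) h) k) \<in> borel_measurable (torus_measure d)" for k
      by (rule extremal_part_measurable(2)[OF extremal_part_cos_avg]) auto
    show "(\<lambda>h. coeff (extremal_avg (cube d - {w, w'}) h) k) \<in> borel_measurable (torus_measure d)" for k
      by (rule extremal_part_measurable(2)[OF extremal_part_cos_avg]) auto
  qed (rule p1 p2 cards finite_measure_torus measure_torus)+
qed

end

section \<open>Small amplitudes\<close>

text \<open>Tail of the binomial series with \<open>y ^ (n + 1)\<close> taken out; the rest is
  dominated by its values at 1/2, where convergence at 3/4 yields absolute convergence.\<close>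

lemma powr_binomial_remainder:
  obtains C :: real where "C \<ge> 0"
    "\<And>y. \<bar>y\<bar> \<le> 1 / 2 \<Longrightarrow> \<bar>(1 + y) powr q - (\<Sum>k\<le>n. (q gchoose k) * y ^ k)\<bar> \<le> C * \<bar>y\<bar> ^ (n + 1)"
proof -
  define a where "a = (\<lambda>k. q gchoose k)"
  have "summable (\<lambda>k. a k * (3 / 4) ^ k)"
    using gen_binomial_real[of "3 / 4" q] by (simp add: a_def sums_iff)
  then have "summable (\<lambda>k. norm (a k * (1 / 2) ^ k))" by (rule powser_insidea) auto
  then have "summable (\<lambda>k. 2 ^ (n + 1) * norm (a (k + (n + 1)) * (1 / 2) ^ (k + (n + 1))))"
    by (intro summable_mult summable_ignore_initial_segment)
  then have summ: "summable (\<lambda>k. \<bar>a (k + (n + 1))\<bar> * (1 / 2) ^ k)"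
    by (simp add: abs_mult power_add power_divide field_simps)
  define C where "C = (\<Sum>k. \<bar>a (k + (n + 1))\<bar> * (1 / 2) ^ k)"
  show ?thesis
  proof (rule that[of C])
    show "C \<ge> 0" unfolding C_def by (rule suminf_nonneg[OF summ]) auto
    fix y :: real assume y: "\<bar>y\<bar> \<le> 1 / 2"
    have S: "(\<lambda>k. a k * y ^ k) sums (1 + y) powr q"
      unfolding a_def by (rule gen_binomial_real) (use y in auto)
    have "(\<lambda>k. a (k + (n + 1)) * y ^ (k + (n + 1))) sums ((1 + y) powr q - (\<Sum>k<n + 1. a k * y ^ k))"
      by (rule sums_split_initial_segment[OF S])
    then have r: "(\<lambda>k. y ^ (n + 1) * (a (k + (n + 1)) * y ^ k)) sums ((1 + y) powr q - (\<Sum>k\<le>n. a k * y ^ k))"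
      by (simp add: power_add mult_ac lessThan_Suc_atMost)
    have bd: "norm (y ^ (n + 1) * (a (k + (n + 1)) * y ^ k)) \<le> \<bar>y\<bar> ^ (n + 1) * (\<bar>a (k + (n + 1))\<bar> * (1 / 2) ^ k)" for k
    proof -
      have "\<bar>y\<bar> ^ k \<le> (1 / 2) ^ k" using y by (intro power_mono) auto
      then have "\<bar>a (k + (n + 1))\<bar> * \<bar>y\<bar> ^ k \<le> \<bar>a (k + (n + 1))\<bar> * (1 / 2) ^ k" by (intro mult_left_mono) auto
      then have "\<bar>y\<bar> ^ (n + 1) * (\<bar>a (k + (n + 1))\<bar> * \<bar>y\<bar> ^ k) \<le> \<bar>y\<bar> ^ (n + 1) * (\<bar>a (k + (n + 1))\<bar> * (1 / 2) ^ k)"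
        by (rule mult_left_mono) simp
      then show ?thesis by (simp only: real_norm_def abs_mult power_abs)
    qed
    have "norm (\<Sum>k. y ^ (n + 1) * (a (k + (n + 1)) * y ^ k)) \<le> (\<Sum>k. \<bar>y\<bar> ^ (n + 1) * (\<bar>a (k + (n + 1))\<bar> * (1 / 2) ^ k))"
      by (rule norm_suminf_le) (use bd summ in \<open>auto intro: summable_mult\<close>)
    also have "\<dots> = \<bar>y\<bar> ^ (n + 1) * C" unfolding C_def by (rule suminf_mult[OF summ])
    finally show "\<bar>(1 + y) powr q - (\<Sum>k\<le>n. (q gchoose k) * y ^ k)\<bar> \<le> C * \<bar>y\<bar> ^ (n + 1)"
      using sums_unique[OF r] by (simp add: a_def mult.commute)
  qed
qed

text \<open>The pair of empty sets contributes 1, and every other balanced pair at most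
  \<open>\<alpha> ^ 2\<close>.\<close>

lemma cos_avg_near_1:
  assumes A: "finite A" and \<alpha>: "\<bar>\<alpha>\<bar> \<le> 1"
  shows "\<bar>cos_avg d A \<alpha> h - 1\<bar> \<le> real (card (balanced_pairs A)) * \<alpha>\<^sup>2"
proof -
  define t where "t = (\<lambda>p. case p of (S, T) \<Rightarrow> complex_of_real \<alpha> ^ (2 * card S) * unit_exp (dot d (vec_sum S) h - dot d (vec_sum T) h))"
  have fin: "finite (balanced_pairs A)" by (rule finite_balanced_pairs[OF A])
  have mem: "({}, {}) \<in> balanced_pairs A" by (simp add: balanced_pairs_def disjoint_pairs_def)
  have "complex_of_real (cos_avg d A \<alpha> h) = sum t (balanced_pairs A)"
    unfolding cos_avg_expand[OF A] t_def ..
  also have "\<dots> = t ({}, {}) + sum t (balanced_pairs A - {({}, {})})"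
    by (rule sum.remove[OF fin mem])
  also have "t ({}, {}) = 1" by (simp add: t_def)
  finally have "complex_of_real (cos_avg d A \<alpha> h - 1) = sum t (balanced_pairs A - {({}, {})})" by simp
  then have "\<bar>cos_avg d A \<alpha> h - 1\<bar> = norm (sum t (balanced_pairs A - {({}, {})}))"
    by (metis norm_of_real)
  also have "\<dots> \<le> (\<Sum>p\<in>balanced_pairs A - {({}, {})}. norm (t p))" by (rule norm_sum)
  also have "\<dots> \<le> (\<Sum>p\<in>balanced_pairs A - {({}, {})}. \<alpha>\<^sup>2)"
  proof (rule sum_mono)
    fix p assume p: "p \<in> balanced_pairs A - {({}, {})}"
    obtain S T where ST: "p = (S, T)" by fastforce
    have "finite S" "finite T" "card S = card T" "S \<noteq> {} \<or> T \<noteq> {}"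
      using p A unfolding ST balanced_pairs_def disjoint_pairs_def by (auto dest: finite_subset)
    then have "card S \<ge> 1" by (auto simp: Suc_le_eq card_gt_0_iff)
    then have "\<bar>\<alpha>\<bar> ^ (2 * card S) \<le> \<bar>\<alpha>\<bar> ^ 2" using \<alpha> by (intro power_decreasing) auto
    then show "norm (t p) \<le> \<alpha>\<^sup>2" by (simp add: t_def ST norm_mult norm_power)
  qed
  also have "\<dots> \<le> (\<Sum>p\<in>balanced_pairs A. \<alpha>\<^sup>2)" by (intro sum_mono2 fin) auto
  finally show ?thesis by simp
qed

lemma measurable_cos_avg:
  assumes "finite A"
  shows "(\<lambda>h. cos_avg d A \<alpha> h) \<in> borel_measurable (torus_measure d)"
proof -
  have "(\<lambda>h. complex_of_real (cos_avg d A \<alpha> h)) \<in> borel_measurable (torus_measure d)"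
    unfolding cos_avg_expand[OF assms] by (intro borel_measurable_sum) (auto split: prod.split)
  from measurable_compose[OF this borel_measurable_Re] show ?thesis by simp
qed

context cube_pair
begin

text \<open>The power of \<open>R\<close> is replaced by its binomial polynomial of degree
  \<open>N\<close> in \<open>R - 1\<close>, to which \<open>extremal_part_limit\<close> applies.
  Since \<open>R - 1\<close> is of order \<open>\<alpha> ^ 2\<close>, the error has order
  \<open>2 * N + 2\<close>, as in that lemma.\<close>

lemma cross_integral_asymptotic:
  obtains C \<alpha>0 where "\<alpha>0 > 0"
    "\<And>\<alpha>. 0 \<le> \<alpha> \<Longrightarrow> \<alpha> \<le> \<alpha>0 \<Longrightarrow>
      \<bar>(LINT h|torus_measure d. cos_avg d (cube d) \<alpha> h powr q * (cos (2 * pi * (real N * dot d dir h)) * cos_avg d (cube d - {w, w'}) \<alpha> h))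
        - \<alpha> ^ (2 * N) * Re (LINT h|torus_measure d. powr_coeff (of_real q) (extremal_avg (cube d) h) (extremal_avg (cube d - {w, w'}) h) N)\<bar>
      \<le> C * \<alpha> ^ (2 * N + 2)"
proof -
  define \<Omega> where "\<Omega> = cube d"
  define \<Omega>' where "\<Omega>' = \<Omega> - {w, w'}"
  have fin: "finite \<Omega>" "finite \<Omega>'" using finite_cube by (auto simp: \<Omega>_def \<Omega>'_def)
  define K where "K = real (card (balanced_pairs \<Omega>)) + real (card (balanced_pairs \<Omega>')) + 1"
  have K: "K \<ge> 1" by (simp add: K_def)
  have near: "\<bar>cos_avg d \<Omega> \<alpha> h - 1\<bar> \<le> K * \<alpha>\<^sup>2" "\<bar>cos_avg d \<Omega>' \<alpha> h\<bar> \<le> K" if "0 \<le> \<alpha>" "\<alpha> \<le> 1" for \<alpha> h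
  proof -
    have "\<bar>cos_avg d \<Omega> \<alpha> h - 1\<bar> \<le> real (card (balanced_pairs \<Omega>)) * \<alpha>\<^sup>2" 
      using cos_avg_near_1[OF fin(1)] that by simp
    also have "\<dots> \<le> K * \<alpha>\<^sup>2" by (intro mult_right_mono) (auto simp: K_def)
    finally show "\<bar>cos_avg d \<Omega> \<alpha> h - 1\<bar> \<le> K * \<alpha>\<^sup>2" .
    have "\<bar>cos_avg d \<Omega>' \<alpha> h - 1\<bar> \<le> real (card (balanced_pairs \<Omega>')) * \<alpha>\<^sup>2" 
      using cos_avg_near_1[OF fin(2)] that by simp
    also have "\<dots> \<le> real (card (balanced_pairs \<Omega>')) * 1"
      using that by (intro mult_left_mono power_le_one) auto
    finally show "\<bar>cos_avg d \<Omega>' \<alpha> h\<bar> \<le> K" by (simp add: K_def)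
  qed
  \<comment> \<open>Built only from sums, products, powers and constants, so that the same
    operations on extremal parts produce \<open>Y\<close>.\<close>
  define X where "X = (\<lambda>\<alpha> h. \<Sum>k\<le>N. complex_of_real (q gchoose k) * ((complex_of_real (cos_avg d \<Omega> \<alpha> h) + (-1)) ^ k * complex_of_real (cos_avg d \<Omega>' \<alpha> h)))"
  define Y where "Y = (\<lambda>h. \<Sum>k\<le>N. [:complex_of_real (q gchoose k):] * ((extremal_avg \<Omega> h + [:-1:]) ^ k * extremal_avg \<Omega>' h))"
  have XY: "extremal_part X Y"
    unfolding X_def Y_def
    by (intro extremal_part_sum extremal_part_mult extremal_part_const extremal_part_power extremal_part_plus extremal_part_cos_avg)
      (auto simp: \<Omega>_def \<Omega>'_def)
  have gch: "complex_of_real (q gchoose k) = of_real q gchoose k" for k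
    by (simp add: gbinomial_prod_rev)
  have coeffY: "coeff (Y h) N = powr_coeff (of_real q) (extremal_avg \<Omega> h) (extremal_avg \<Omega>' h) N" for h
  proof -
    have "extremal_avg \<Omega> h + [:-1:] = extremal_avg \<Omega> h - 1" by (simp add: one_pCons)
    then show ?thesis unfolding Y_def powr_coeff_def coeff_sum by (simp add: gch)
  qed
  define e where "e = (\<lambda>h. unit_exp (dot d (\<lambda>i. - real N * dir i) h))"
  define c where "c = (\<lambda>h. cos (2 * pi * (real N * dot d dir h)))"
  have Re_e: "Re (e h) = c h" for h
    using dot_scale[of d "- real N" dir h] by (simp add: e_def c_def Re_unit_exp)
  obtain C1 where C1: "C1 \<ge> 0" "\<And>\<alpha>. 0 \<le> \<alpha> \<Longrightarrow> \<alpha> \<le> 1 \<Longrightarrow>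
    norm ((LINT h|torus_measure d. X \<alpha> h * e h) - of_real \<alpha> ^ (2 * N) * (LINT h|torus_measure d. coeff (Y h) N)) \<le> C1 * \<alpha> ^ (2 * N + 2)"
    using extremal_part_limit[OF XY, of N] unfolding e_def by blast
  obtain C2 where C2: "C2 \<ge> 0" "\<And>y. \<bar>y\<bar> \<le> 1 / 2 \<Longrightarrow> \<bar>(1 + y) powr q - (\<Sum>k\<le>N. (q gchoose k) * y ^ k)\<bar> \<le> C2 * \<bar>y\<bar> ^ (N + 1)"
    using powr_binomial_remainder by blast
  \<comment> \<open>Ensures \<open>K * \<alpha> ^ 2 \<le> 1 / 2\<close>, the range of the binomial
    estimate.\<close>
  define \<alpha>0 where "\<alpha>0 = 1 / (2 * K)"
  have \<alpha>0: "\<alpha>0 > 0" "\<alpha>0 \<le> 1" using K by (auto simp: \<alpha>0_def)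
  show ?thesis
  proof (rule that[OF \<alpha>0(1), unfolded \<Omega>_def[symmetric] \<Omega>'_def[symmetric]])
    fix \<alpha> :: real assume \<alpha>: "0 \<le> \<alpha>" "\<alpha> \<le> \<alpha>0"
    then have a1: "\<alpha> \<le> 1" using \<alpha>0 by linarith
    define R where "R = cos_avg d \<Omega> \<alpha>"
    define P where "P = cos_avg d \<Omega>' \<alpha>"
    define T where "T = (\<lambda>h. \<Sum>k\<le>N. (q gchoose k) * (R h - 1) ^ k)"
    have R1: "\<bar>R h - 1\<bar> \<le> K * \<alpha>\<^sup>2" for h using near(1)[of \<alpha> h] \<alpha> a1 by (simp add: R_def)
    have half: "K * \<alpha>\<^sup>2 \<le> 1 / 2"
    proof -
      have "\<alpha>\<^sup>2 \<le> \<alpha>0 * 1" unfolding power2_eq_square using \<alpha> a1 by (intro mult_mono) auto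
      then have "K * \<alpha>\<^sup>2 \<le> K * \<alpha>0" using K by (intro mult_left_mono) auto
      then show ?thesis using K by (simp add: \<alpha>0_def)
    qed
    have P: "\<bar>P h\<bar> \<le> K" for h using near(2)[of \<alpha> h] \<alpha> a1 by (simp add: P_def)
    have rem: "\<bar>R h powr q - T h\<bar> \<le> C2 * (K * \<alpha>\<^sup>2) ^ (N + 1)" for h
    proof -
      have "\<bar>(1 + (R h - 1)) powr q - T h\<bar> \<le> C2 * \<bar>R h - 1\<bar> ^ (N + 1)"
        unfolding T_def using R1[of h] half by (intro C2(2)) linarith
      also have "\<dots> \<le> C2 * (K * \<alpha>\<^sup>2) ^ (N + 1)"
        using R1[of h] C2(1) by (intro mult_left_mono power_mono) auto
      finally show ?thesis by simp
    qed
    have mR: "R \<in> borel_measurable (torus_measure d)" and mP: "P \<in> borel_measurable (torus_measure d)"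
      unfolding R_def P_def by (intro measurable_cos_avg fin)+
    have mc: "c \<in> borel_measurable (torus_measure d)" unfolding c_def by measurable
    have c1: "\<bar>c h\<bar> \<le> 1" for h by (simp add: c_def)
    have iXe: "integrable (torus_measure d) (\<lambda>h. X \<alpha> h * e h)"
      unfolding e_def using \<alpha> a1 by (intro extremal_part_integrable(1)[OF XY]) auto
    have Xeq: "X \<alpha> h = complex_of_real (T h * P h)" for h
      by (simp add: X_def T_def P_def R_def sum_distrib_right mult.assoc)
    have ReX: "Re (X \<alpha> h * e h) = T h * (c h * P h)" for h
      unfolding Xeq by (simp add: Re_e mult_ac)
    have iT: "integrable (torus_measure d) (\<lambda>h. T h * (c h * P h))"
      using integrable_Re[OF iXe] by (simp only: ReX)
    have bound: "\<bar>(R h powr q - T h) * (c h * P h)\<bar> \<le> C2 * (K * \<alpha>\<^sup>2) ^ (N + 1) * K" for h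
    proof -
      have "\<bar>c h * P h\<bar> \<le> 1 * K" unfolding abs_mult using c1 P by (intro mult_mono) auto
      then show ?thesis unfolding abs_mult[of "R h powr q - T h"]
        using rem[of h] C2(1) K by (intro mult_mono) auto
    qed
    have mT: "T \<in> borel_measurable (torus_measure d)" unfolding T_def using mR by measurable
    have id: "integrable (torus_measure d) (\<lambda>h. (R h powr q - T h) * (c h * P h))"
      using bound mR mP mc mT by (intro integrable_torus_bounded) auto
    have "(LINT h|torus_measure d. R h powr q * (c h * P h)) =
      (LINT h|torus_measure d. T h * (c h * P h) + (R h powr q - T h) * (c h * P h))"
      by (simp add: algebra_simps)
    also have "\<dots> = (LINT h|torus_measure d. T h * (c h * P h)) + (LINT h|torus_measure d. (R h powr q - T h) * (c h * P h))"
      by (intro Bochner_Integration.integral_add iT id)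
    also have "(LINT h|torus_measure d. T h * (c h * P h)) = Re (LINT h|torus_measure d. X \<alpha> h * e h)"
      by (simp only: integral_Re[OF iXe, symmetric] ReX)
    finally have split: "(LINT h|torus_measure d. R h powr q * (c h * P h)) =
       Re (LINT h|torus_measure d. X \<alpha> h * e h) + (LINT h|torus_measure d. (R h powr q - T h) * (c h * P h))" .
    have small: "\<bar>LINT h|torus_measure d. (R h powr q - T h) * (c h * P h)\<bar> \<le> C2 * (K * \<alpha>\<^sup>2) ^ (N + 1) * K"
    proof -
      have "norm (LINT h|torus_measure d. (R h powr q - T h) * (c h * P h)) \<le> (LINT h|torus_measure d. norm ((R h powr q - T h) * (c h * P h)))"
        by (rule integral_norm_bound)
      also have "\<dots> \<le> (LINT h|torus_measure d. C2 * (K * \<alpha>\<^sup>2) ^ (N + 1) * K)"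
      proof (rule integral_mono)
        show "integrable (torus_measure d) (\<lambda>h. C2 * (K * \<alpha>\<^sup>2) ^ (N + 1) * K)"
          by (rule integrable_torus_bounded) auto
        show "norm ((R h powr q - T h) * (c h * P h)) \<le> C2 * (K * \<alpha>\<^sup>2) ^ (N + 1) * K" for h
          using bound[of h] by (simp only: real_norm_def)
      qed (intro integrable_norm id)
      also have "\<dots> = C2 * (K * \<alpha>\<^sup>2) ^ (N + 1) * K" by (simp add: measure_torus)
      finally show ?thesis by simp
    qed
    define z where "z = (LINT h|torus_measure d. coeff (Y h) N)"
    have z: "z = (LINT h|torus_measure d. powr_coeff (of_real q) (extremal_avg \<Omega> h) (extremal_avg \<Omega>' h) N)"
      unfolding z_def coeffY ..
    have main: "\<bar>Re (LINT h|torus_measure d. X \<alpha> h * e h) - \<alpha> ^ (2 * N) * Re z\<bar> \<le> C1 * \<alpha> ^ (2 * N + 2)"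
    proof -
      have "Re (of_real \<alpha> ^ (2 * N) * z) = \<alpha> ^ (2 * N) * Re z" by (simp flip: of_real_power)
      then have "\<bar>Re (LINT h|torus_measure d. X \<alpha> h * e h) - \<alpha> ^ (2 * N) * Re z\<bar> =
        \<bar>Re ((LINT h|torus_measure d. X \<alpha> h * e h) - of_real \<alpha> ^ (2 * N) * z)\<bar>" by simp
      also have "\<dots> \<le> norm ((LINT h|torus_measure d. X \<alpha> h * e h) - of_real \<alpha> ^ (2 * N) * z)" by (rule abs_Re_le_cmod)
      also have "\<dots> \<le> C1 * \<alpha> ^ (2 * N + 2)" unfolding z_def by (rule C1(2)[OF \<alpha>(1) a1])
      finally show ?thesis .
    qed
    have pw: "C2 * (K * \<alpha>\<^sup>2) ^ (N + 1) * K = (C2 * K ^ (N + 1) * K) * \<alpha> ^ (2 * N + 2)"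
    proof -
      have "(\<alpha>\<^sup>2) ^ (N + 1) = \<alpha> ^ (2 * N + 2)" unfolding power_mult [symmetric] by simp
      then show ?thesis by (simp only: power_mult_distrib mult_ac)
    qed
    have "\<bar>(LINT h|torus_measure d. R h powr q * (c h * P h)) - \<alpha> ^ (2 * N) * Re z\<bar>
      \<le> C1 * \<alpha> ^ (2 * N + 2) + (C2 * K ^ (N + 1) * K) * \<alpha> ^ (2 * N + 2)"
      using main small unfolding split pw by linarith
    then show "\<bar>(LINT h|torus_measure d. cos_avg d \<Omega> \<alpha> h powr q * (cos (2 * pi * (real N * dot d dir h)) * cos_avg d \<Omega>' \<alpha> h))
        - \<alpha> ^ (2 * N) * Re (LINT h|torus_measure d. powr_coeff (of_real q) (extremal_avg \<Omega> h) (extremal_avg \<Omega>' h) N)\<bar>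
      \<le> (C1 + C2 * K ^ (N + 1) * K) * \<alpha> ^ (2 * N + 2)"
      unfolding z R_def P_def c_def distrib_right .
  qed
qed

lemma top_face_antipodal:
  assumes "\<And>i. i < d \<Longrightarrow> w i \<noteq> w' i"
  shows "top_face = {w}"
proof -
  have "\<eta> = w" if "\<eta> \<in> top_face" for \<eta>
  proof
    fix i
    have c: "\<eta> \<in> cube d" using that by (simp add: top_face_def)
    show "\<eta> i = w i"
    proof (cases "i < d")
      case True
      then show ?thesis using that assms[OF True] top_face_iff[OF c] by (auto simp: dir_def)
    next
      case False
      then show ?thesis using cube_values(2)[OF c] w_values(3) by simp
    qed
  qed
  then show ?thesis using faces(1) by blast
qed

end

section \<open>The perturbed function\<close>

lemma R_op_eq: "R_op d f h = (LINT x|circle_measure. (\<Prod>\<eta>\<in>cube d. f (x + dot d \<eta> h)))"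
  by (simp add: R_op_def cube_def dot_def)

lemma measurable_R_op:
  assumes f: "f \<in> borel_measurable borel"
  shows "R_op d f \<in> borel_measurable (torus_measure d)"
proof -
  have "(\<lambda>p. \<Prod>\<eta>\<in>cube d. f (snd p + dot d \<eta> (fst p))) \<in> borel_measurable (torus_measure d \<Otimes>\<^sub>M circle_measure)"
  proof (intro borel_measurable_prod measurable_compose[OF _ f] borel_measurable_add)
    show "(\<lambda>p. dot d \<eta> (fst p)) \<in> borel_measurable (torus_measure d \<Otimes>\<^sub>M circle_measure)" for \<eta>
      by (rule measurable_compose[OF measurable_fst measurable_dot])
    have id: "(\<lambda>x. x) \<in> borel_measurable circle_measure" by (intro measurable_circle_borel) simp
    show "snd \<in> borel_measurable (torus_measure d \<Otimes>\<^sub>M circle_measure)"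
      using measurable_compose[OF measurable_snd[of "torus_measure d" circle_measure] id] by simp
  qed
  then have "(\<lambda>h. LINT x|circle_measure. (\<Prod>\<eta>\<in>cube d. f (x + dot d \<eta> h))) \<in> borel_measurable (torus_measure d)"
    by (intro circle.borel_measurable_lebesgue_integral) (simp add: case_prod_beta')
  then show ?thesis by (simp add: R_op_eq[abs_def])
qed

lemma integral_cos_cos_prod_eq_0:
  assumes "finite A" "k \<in> \<int>" "\<bar>k\<bar> > real (card A)"
  shows "(LINT x|circle_measure. cos (2 * pi * (k * x + c)) * cos_prod d A \<alpha> h x) = 0"
proof -
  have int: "integrable circle_measure (\<lambda>x. unit_exp (k * x) * complex_of_real (cos_prod d A \<alpha> h x))"
    by (intro integrable_circle_continuous continuous_intros)
  have "cos (2 * pi * (k * x + c)) * cos_prod d A \<alpha> h x =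
      Re (unit_exp c * (unit_exp (k * x) * complex_of_real (cos_prod d A \<alpha> h x)))" for x
  proof -
    have "unit_exp c * (unit_exp (k * x) * complex_of_real (cos_prod d A \<alpha> h x)) =
      unit_exp (k * x + c) * complex_of_real (cos_prod d A \<alpha> h x)"
      by (simp only: unit_exp_add mult_ac)
    moreover have "Re (unit_exp (k * x + c) * complex_of_real (cos_prod d A \<alpha> h x)) = cos (2 * pi * (k * x + c)) * cos_prod d A \<alpha> h x"
      by (simp add: Re_unit_exp)
    ultimately show ?thesis by (simp only:)
  qed
  then have "(LINT x|circle_measure. cos (2 * pi * (k * x + c)) * cos_prod d A \<alpha> h x) =
     Re (LINT x|circle_measure. unit_exp c * (unit_exp (k * x) * complex_of_real (cos_prod d A \<alpha> h x)))"
    by (subst integral_Re [symmetric]) (auto intro: int)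
  also have "\<dots> = Re (unit_exp c * 0)"
    using integral_unit_exp_cos_prod_eq_0[OF assms] by simp
  finally show ?thesis by simp
qed

section \<open>Expansion in the amplitude of the perturbation\<close>

definition wave :: "nat \<Rightarrow> real \<Rightarrow> real \<Rightarrow> real \<Rightarrow> real" where
  "wave N \<alpha> b x = 1 + 2 * \<alpha> * cos (2 * pi * x) + b * cos (2 * pi * (real N * x))"

text \<open>The contribution to the coefficient of \<open>b ^ card B\<close> in which exactly the
  vertices of \<open>B\<close> take the perturbing cosine.\<close>

definition wave_coeff :: "nat \<Rightarrow> nat \<Rightarrow> real \<Rightarrow> (nat \<Rightarrow> real) set \<Rightarrow> (nat \<Rightarrow> real) \<Rightarrow> real" where
  "wave_coeff d N \<alpha> B h = (LINT x|circle_measure. (\<Prod>\<eta>\<in>B. cos (2 * pi * (real N * (x + dot d \<eta> h)))) * cos_prod d (cube d - B) \<alpha> h x)"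

lemma R_op_wave: "R_op d (wave N \<alpha> b) h = (\<Sum>B\<in>Pow (cube d). b ^ card B * wave_coeff d N \<alpha> B h)"
proof -
  have "(\<Prod>\<eta>\<in>cube d. wave N \<alpha> b (x + dot d \<eta> h)) =
    (\<Sum>B\<in>Pow (cube d). b ^ card B * ((\<Prod>\<eta>\<in>B. cos (2 * pi * (real N * (x + dot d \<eta> h)))) * cos_prod d (cube d - B) \<alpha> h x))" for x
  proof -
    have "(\<Prod>\<eta>\<in>cube d. wave N \<alpha> b (x + dot d \<eta> h)) =
      (\<Prod>\<eta>\<in>cube d. b * cos (2 * pi * (real N * (x + dot d \<eta> h))) + (1 + 2 * \<alpha> * cos (2 * pi * (x + dot d \<eta> h))))"
      by (simp add: wave_def add_ac)
    also have "\<dots> = (\<Sum>B\<in>Pow (cube d). (\<Prod>\<eta>\<in>B. b * cos (2 * pi * (real N * (x + dot d \<eta> h)))) * cos_prod d (cube d - B) \<alpha> h x)"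
      unfolding cos_prod_def by (rule prod_add[OF finite_cube])
    finally show ?thesis by (simp add: prod.distrib mult.assoc)
  qed
  then have "R_op d (wave N \<alpha> b) h = (LINT x|circle_measure. (\<Sum>B\<in>Pow (cube d). b ^ card B * ((\<Prod>\<eta>\<in>B. cos (2 * pi * (real N * (x + dot d \<eta> h)))) * cos_prod d (cube d - B) \<alpha> h x)))"
    by (simp add: R_op_eq)
  also have "\<dots> = (\<Sum>B\<in>Pow (cube d). (LINT x|circle_measure. b ^ card B * ((\<Prod>\<eta>\<in>B. cos (2 * pi * (real N * (x + dot d \<eta> h)))) * cos_prod d (cube d - B) \<alpha> h x)))"
    by (intro Bochner_Integration.integral_sum integrable_circle_continuous continuous_intros)
  finally show ?thesis by (simp add: wave_coeff_def)
qed

lemma wave_coeff_empty: "wave_coeff d N \<alpha> {} h = cos_avg d (cube d) \<alpha> h"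
  by (simp add: wave_coeff_def cos_avg_def)

text \<open>A lone cosine of frequency \<open>N\<close> meets frequencies of at most
  \<open>2 ^ d < N\<close> and averages to 0; thus there is no linear term in
  \<open>b\<close>.\<close>

lemma wave_coeff_singleton:
  assumes "N > 2 ^ d"
  shows "wave_coeff d N \<alpha> {\<eta>} h = 0"
proof -
  have "card (cube d - {\<eta>}) \<le> 2 ^ d" using card_mono[OF finite_cube, of "cube d - {\<eta>}"] by (auto simp: card_cube)
  then have "card (cube d - {\<eta>}) < N" using assms by linarith
  then have "(LINT x|circle_measure. cos (2 * pi * (real N * x + real N * dot d \<eta> h)) * cos_prod d (cube d - {\<eta>}) \<alpha> h x) = 0"
    by (intro integral_cos_cos_prod_eq_0) (auto simp: finite_cube)
  then show ?thesis by (simp add: wave_coeff_def distrib_left)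
qed

text \<open>Product-to-sum formula: the part of frequency \<open>2 * N\<close> in \<open>x\<close>
  averages out, the other part is constant in \<open>x\<close>.\<close>

lemma wave_coeff_pair:
  assumes N: "N > 2 ^ d" and "\<eta> \<noteq> \<zeta>"
  shows "wave_coeff d N \<alpha> {\<eta>, \<zeta>} h =
    cos (2 * pi * (real N * (dot d \<eta> h - dot d \<zeta> h))) * cos_avg d (cube d - {\<eta>, \<zeta>}) \<alpha> h / 2"
proof -
  define W where "W = cos_prod d (cube d - {\<eta>, \<zeta>}) \<alpha> h"
  define s where "s = cos (2 * pi * (real N * (dot d \<eta> h - dot d \<zeta> h)))"
  define t where "t = (\<lambda>x. cos (2 * pi * (real (2 * N) * x + real N * (dot d \<eta> h + dot d \<zeta> h))))"
  have "card (cube d - {\<eta>, \<zeta>}) \<le> 2 ^ d" using card_mono[OF finite_cube, of "cube d - {\<eta>, \<zeta>}"] by (auto simp: card_cube)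
  then have "card (cube d - {\<eta>, \<zeta>}) < 2 * N" using N by linarith
  then have 0: "(LINT x|circle_measure. t x * W x) = 0"
    unfolding t_def W_def by (intro integral_cos_cos_prod_eq_0) (auto simp: finite_cube)
  have eq: "(\<Prod>\<xi>\<in>{\<eta>, \<zeta>}. cos (2 * pi * (real N * (x + dot d \<xi> h)))) = (s + t x) / 2" for x
  proof -
    have "(\<Prod>\<xi>\<in>{\<eta>, \<zeta>}. cos (2 * pi * (real N * (x + dot d \<xi> h)))) =
      cos (2 * pi * (real N * (x + dot d \<eta> h))) * cos (2 * pi * (real N * (x + dot d \<zeta> h)))"
      using assms by simp
    also have "\<dots> = (cos (2 * pi * (real N * (x + dot d \<eta> h)) - 2 * pi * (real N * (x + dot d \<zeta> h))) +
       cos (2 * pi * (real N * (x + dot d \<eta> h)) + 2 * pi * (real N * (x + dot d \<zeta> h)))) / 2"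
      by (rule cos_times_cos)
    also have "2 * pi * (real N * (x + dot d \<eta> h)) - 2 * pi * (real N * (x + dot d \<zeta> h)) = 2 * pi * (real N * (dot d \<eta> h - dot d \<zeta> h))"
      by (simp add: algebra_simps)
    also have "2 * pi * (real N * (x + dot d \<eta> h)) + 2 * pi * (real N * (x + dot d \<zeta> h)) =
       2 * pi * (real (2 * N) * x + real N * (dot d \<eta> h + dot d \<zeta> h))"
      by (simp add: algebra_simps)
    finally show ?thesis by (simp add: s_def t_def)
  qed
  have "wave_coeff d N \<alpha> {\<eta>, \<zeta>} h = (LINT x|circle_measure. (s / 2) * W x + (1 / 2) * (t x * W x))"
    unfolding wave_coeff_def W_def [symmetric] eq by (simp add: add_divide_distrib distrib_right)
  also have "\<dots> = (LINT x|circle_measure. (s / 2) * W x) + (LINT x|circle_measure. (1 / 2) * (t x * W x))"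
    by (rule Bochner_Integration.integral_add)
      (auto simp: W_def t_def intro!: integrable_circle_continuous continuous_intros)
  also have "\<dots> = s / 2 * (LINT x|circle_measure. W x) + 1 / 2 * (LINT x|circle_measure. t x * W x)"
    by (simp only: integral_mult_right_zero)
  finally show ?thesis unfolding 0 by (simp add: cos_avg_def s_def W_def)
qed

lemma abs_wave_coeff_le:
  assumes B: "B \<subseteq> cube d" and \<alpha>: "\<bar>\<alpha>\<bar> \<le> 1 / 2"
  shows "\<bar>wave_coeff d N \<alpha> B h\<bar> \<le> 2 ^ card (cube d)"
proof -
  define g where "g = (\<lambda>x. (\<Prod>\<eta>\<in>B. cos (2 * pi * (real N * (x + dot d \<eta> h)))) * cos_prod d (cube d - B) \<alpha> h x)"
  have cont: "continuous_on UNIV g" unfolding g_def by (intro continuous_intros)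
  have "\<bar>g x\<bar> \<le> 2 ^ card (cube d)" for x
  proof -
    have "\<bar>\<Prod>\<eta>\<in>B. cos (2 * pi * (real N * (x + dot d \<eta> h)))\<bar> \<le> 1"
      unfolding abs_prod by (intro prod_le_1) auto
    moreover have "\<bar>cos_prod d (cube d - B) \<alpha> h x\<bar> \<le> 2 ^ card (cube d)"
    proof (rule order_trans)
      show "(\<Prod>\<eta>\<in>cube d - B. 2::real) \<le> 2 ^ card (cube d)"
        using card_mono[OF finite_cube, of "cube d - B" d] by (simp add: power_increasing)
      show "\<bar>cos_prod d (cube d - B) \<alpha> h x\<bar> \<le> (\<Prod>\<eta>\<in>cube d - B. 2)"
      unfolding cos_prod_def abs_prod
    proof (intro prod_mono conjI abs_ge_zero)
      fix \<eta>
      have "\<bar>2 * \<alpha> * cos (2 * pi * (x + dot d \<eta> h))\<bar> \<le> 1 * 1"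
        unfolding abs_mult[of "2 * \<alpha>"] using \<alpha> by (intro mult_mono) auto
      then show "\<bar>1 + 2 * \<alpha> * cos (2 * pi * (x + dot d \<eta> h))\<bar> \<le> 2" by linarith
      qed
    qed
    ultimately have "\<bar>\<Prod>\<eta>\<in>B. cos (2 * pi * (real N * (x + dot d \<eta> h)))\<bar> * \<bar>cos_prod d (cube d - B) \<alpha> h x\<bar> \<le> 1 * 2 ^ card (cube d)"
      by (intro mult_mono) auto
    then show ?thesis by (simp add: g_def abs_mult)
  qed
  then have "(LINT x|circle_measure. \<bar>g x\<bar>) \<le> (LINT x|circle_measure. 2 ^ card (cube d))"
    using cont by (intro integral_mono integrable_circle_continuous continuous_intros) auto
  also have "\<dots> = 2 ^ card (cube d)" using measure_circle_measure by simp
  finally have "(LINT x|circle_measure. \<bar>g x\<bar>) \<le> 2 ^ card (cube d)" .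
  with integral_abs_bound[of circle_measure g] have "\<bar>LINT x|circle_measure. g x\<bar> \<le> 2 ^ card (cube d)"
    by (rule order_trans)
  then show ?thesis unfolding wave_coeff_def g_def .
qed

definition vertex_pairs :: "nat \<Rightarrow> (nat \<Rightarrow> real) set set" where
  "vertex_pairs d = {B. B \<subseteq> cube d \<and> card B = 2}"

lemma finite_vertex_pairs: "finite (vertex_pairs d)"
  unfolding vertex_pairs_def by (rule finite_subset[of _ "Pow (cube d)"]) (auto simp: finite_cube)

text \<open>Subsets of the cube sorted by size: the empty set is the unperturbed average, singletons
  vanish, pairs give the quadratic term, and the larger ones are bounded crudely.\<close>

lemma R_op_wave_expansion:
  assumes N: "N > 2 ^ d" and \<alpha>: "\<bar>\<alpha>\<bar> \<le> 1 / 2" and b: "\<bar>b\<bar> \<le> 1"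
  shows "\<bar>R_op d (wave N \<alpha> b) h - cos_avg d (cube d) \<alpha> h - b\<^sup>2 * (\<Sum>B\<in>vertex_pairs d. wave_coeff d N \<alpha> B h)\<bar>
    \<le> 2 ^ card (cube d) * 2 ^ card (cube d) * \<bar>b\<bar> ^ 3"
proof -
  define t where "t = (\<lambda>B. b ^ card B * wave_coeff d N \<alpha> B h)"
  define P3 where "P3 = {B\<in>Pow (cube d). card B \<ge> 3}"
  define P1 where "P1 = {B\<in>Pow (cube d). card B = 1}"
  have fin: "finite P3" "finite P1" "finite (vertex_pairs d)"
    by (simp_all add: P3_def P1_def finite_cube finite_vertex_pairs)
  have "Pow (cube d) = {{}} \<union> (P1 \<union> (vertex_pairs d \<union> P3))"
  proof -
    have "B = {}" if "card B = 0" "B \<subseteq> cube d" for B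
      using that finite_subset[OF that(2) finite_cube] by simp
    moreover have "card B = 0 \<or> card B = 1 \<or> card B = 2 \<or> card B \<ge> 3" for B :: "(nat \<Rightarrow> real) set" by linarith
    ultimately show ?thesis unfolding P1_def P3_def vertex_pairs_def by blast
  qed
  then have "R_op d (wave N \<alpha> b) h = sum t ({{}} \<union> (P1 \<union> (vertex_pairs d \<union> P3)))"
    by (simp add: R_op_wave t_def)
  also have "\<dots> = t {} + (sum t P1 + (sum t (vertex_pairs d) + sum t P3))"
  proof -
    have "sum t ({{}} \<union> (P1 \<union> (vertex_pairs d \<union> P3))) = sum t {{}} + sum t (P1 \<union> (vertex_pairs d \<union> P3))"
      using fin by (intro sum.union_disjoint) (auto simp: P1_def P3_def vertex_pairs_def)
    also have "sum t (P1 \<union> (vertex_pairs d \<union> P3)) = sum t P1 + sum t (vertex_pairs d \<union> P3)"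
      using fin by (intro sum.union_disjoint) (auto simp: P1_def P3_def vertex_pairs_def)
    also have "sum t (vertex_pairs d \<union> P3) = sum t (vertex_pairs d) + sum t P3"
      using fin by (intro sum.union_disjoint) (auto simp: P1_def P3_def vertex_pairs_def)
    finally show ?thesis by simp
  qed
  also have "t {} = cos_avg d (cube d) \<alpha> h" by (simp add: t_def wave_coeff_empty)
  also have "sum t P1 = 0"
  proof (rule sum.neutral, rule ballI)
    fix B assume "B \<in> P1"
    then obtain \<eta> where "B = {\<eta>}" by (auto simp: P1_def card_1_singleton_iff)
    then show "t B = 0" using wave_coeff_singleton[OF N] by (simp add: t_def)
  qed
  also have "sum t (vertex_pairs d) = b\<^sup>2 * (\<Sum>B\<in>vertex_pairs d. wave_coeff d N \<alpha> B h)"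
    unfolding sum_distrib_left by (intro sum.cong) (auto simp: t_def vertex_pairs_def)
  finally have "R_op d (wave N \<alpha> b) h - cos_avg d (cube d) \<alpha> h - b\<^sup>2 * (\<Sum>B\<in>vertex_pairs d. wave_coeff d N \<alpha> B h) = sum t P3"
    by linarith
  also have "\<bar>sum t P3\<bar> \<le> (\<Sum>B\<in>P3. \<bar>t B\<bar>)" by (rule sum_abs)
  also have "\<dots> \<le> (\<Sum>B\<in>P3. 2 ^ card (cube d) * \<bar>b\<bar> ^ 3)"
  proof (rule sum_mono)
    fix B assume B: "B \<in> P3"
    have "\<bar>b\<bar> ^ card B \<le> \<bar>b\<bar> ^ 3" using B b by (intro power_decreasing) (auto simp: P3_def)
    then have "\<bar>b\<bar> ^ card B * \<bar>wave_coeff d N \<alpha> B h\<bar> \<le> \<bar>b\<bar> ^ 3 * 2 ^ card (cube d)"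
      using B abs_wave_coeff_le[OF _ \<alpha>] by (intro mult_mono) (auto simp: P3_def)
    then show "\<bar>t B\<bar> \<le> 2 ^ card (cube d) * \<bar>b\<bar> ^ 3" by (simp add: t_def abs_mult power_abs mult.commute)
  qed
  also have "\<dots> \<le> (\<Sum>B\<in>Pow (cube d). 2 ^ card (cube d) * \<bar>b\<bar> ^ 3)"
    by (intro sum_mono2) (auto simp: P3_def finite_cube)
  also have "\<dots> = 2 ^ card (cube d) * 2 ^ card (cube d) * \<bar>b\<bar> ^ 3"
    by (simp add: card_Pow finite_cube)
  finally show ?thesis .
qed

lemma powr_between_le:
  fixes x q :: real
  assumes "1 / 2 \<le> x" "x \<le> 3 / 2"
  shows "x powr q \<le> (1 / 2) powr q + (3 / 2) powr q"
proof (cases "q \<ge> 0")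
  case True
  then have "x powr q \<le> (3 / 2) powr q" using assms by (intro powr_mono2) auto
  then show ?thesis using powr_ge_zero[of "1 / 2" q] by linarith
next
  case False
  then have "x powr q \<le> (1 / 2) powr q" using assms by (intro powr_mono2') auto
  then show ?thesis using powr_ge_zero[of "3 / 2" q] by linarith
qed

section \<open>Choice of the frequency and the two amplitudes\<close>

definition cross_term :: "nat \<Rightarrow> nat \<Rightarrow> real \<Rightarrow> (nat \<Rightarrow> real) \<Rightarrow> real" where
  "cross_term d N \<alpha> h = (\<Sum>B\<in>vertex_pairs d. wave_coeff d N \<alpha> B h)"

lemma abs_cross_term_le:
  assumes "\<bar>\<alpha>\<bar> \<le> 1 / 2"
  shows "\<bar>cross_term d N \<alpha> h\<bar> \<le> real (card (vertex_pairs d)) * 2 ^ card (cube d)"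
proof -
  have "\<bar>cross_term d N \<alpha> h\<bar> \<le> (\<Sum>B\<in>vertex_pairs d. \<bar>wave_coeff d N \<alpha> B h\<bar>)"
    unfolding cross_term_def by (rule sum_abs)
  also have "\<dots> \<le> (\<Sum>B\<in>vertex_pairs d. 2 ^ card (cube d))"
    by (intro sum_mono abs_wave_coeff_le assms) (simp add: vertex_pairs_def)
  finally show ?thesis by simp
qed

lemma measurable_wave_coeff_pair:
  assumes "N > 2 ^ d" "B \<in> vertex_pairs d"
  shows "wave_coeff d N \<alpha> B \<in> borel_measurable (torus_measure d)"
proof -
  obtain \<eta> \<zeta> where B: "B = {\<eta>, \<zeta>}" "\<eta> \<noteq> \<zeta>" using assms(2) by (auto simp: vertex_pairs_def card_2_iff)
  have "(\<lambda>h. cos_avg d (cube d - {\<eta>, \<zeta>}) \<alpha> h) \<in> borel_measurable (torus_measure d)"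
    by (rule measurable_cos_avg) (simp add: finite_cube)
  then have "(\<lambda>h. cos (2 * pi * (real N * (dot d \<eta> h - dot d \<zeta> h))) * cos_avg d (cube d - {\<eta>, \<zeta>}) \<alpha> h / 2) \<in> borel_measurable (torus_measure d)"
    by measurable
  then show ?thesis unfolding B(1) wave_coeff_pair[OF assms(1) B(2), abs_def] .
qed

lemma measurable_cross_term:
  assumes "N > 2 ^ d"
  shows "cross_term d N \<alpha> \<in> borel_measurable (torus_measure d)"
  unfolding cross_term_def[abs_def] by (intro borel_measurable_sum measurable_wave_coeff_pair assms)

lemma ex_negative_cross_term:
  fixes p :: real
  assumes p: "p > 0" "p \<notin> \<nat>" and d: "d \<ge> 1"
  obtains N \<alpha> where "N > 2 ^ d" "0 < \<alpha>" "\<alpha> < 1 / 4"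
    "\<And>h. 1 / 2 \<le> cos_avg d (cube d) \<alpha> h \<and> cos_avg d (cube d) \<alpha> h \<le> 3 / 2"
    "(LINT h|torus_measure d. cos_avg d (cube d) \<alpha> h powr (p - 1) * cross_term d N \<alpha> h) < 0"
proof -
  \<comment> \<open>The direction \<open>dir\<close> requires an order on the two vertices, so one
    orientation of each unordered pair is fixed.\<close>
  have "\<exists>f. \<forall>B\<in>vertex_pairs d. B = {fst (f B), snd (f B)} \<and> fst (f B) \<noteq> snd (f B)"
  proof (rule bchoice, rule ballI)
    fix B assume "B \<in> vertex_pairs d"
    then obtain \<eta> \<zeta> where "B = {\<eta>, \<zeta>}" "\<eta> \<noteq> \<zeta>" by (auto simp: vertex_pairs_def card_2_iff)
    then show "\<exists>x. B = {fst x, snd x} \<and> fst x \<noteq> snd x" by (intro exI[of _ "(\<eta>, \<zeta>)"]) auto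
  qed
  then obtain f where f: "\<And>B. B \<in> vertex_pairs d \<Longrightarrow> B = {fst (f B), snd (f B)}" "\<And>B. B \<in> vertex_pairs d \<Longrightarrow> fst (f B) \<noteq> snd (f B)"
    by blast
  define w1 where "w1 = (\<lambda>B. fst (f B))"
  define w2 where "w2 = (\<lambda>B. snd (f B))"
  have pair_eq: "B = {w1 B, w2 B}" "w1 B \<noteq> w2 B" if "B \<in> vertex_pairs d" for B
    using f[OF that] by (simp_all add: w1_def w2_def)
  have cp: "cube_pair d (w1 B) (w2 B)" if B: "B \<in> vertex_pairs d" for B
  proof
    have "{w1 B, w2 B} \<subseteq> cube d" using B pair_eq(1)[OF B] by (simp add: vertex_pairs_def)
    then show "w1 B \<in> cube d" "w2 B \<in> cube d" by auto
    show "w1 B \<noteq> w2 B" by (rule pair_eq(2)[OF B])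
  qed
  define \<Phi> where "\<Phi> = (\<lambda>B. cube_pair.extremal_avg d (w1 B) (w2 B) (cube d))"
  define \<Psi> where "\<Psi> = (\<lambda>B. cube_pair.extremal_avg d (w1 B) (w2 B) (cube d - {w1 B, w2 B}))"
  define a where "a = (\<lambda>N B. Re (LINT h|torus_measure d. powr_coeff (of_real (p - 1)) (\<Phi> B h) (\<Psi> B h) N))"
  \<comment> \<open>The antipodal pair of all zeros and all ones: its top face is a single vertex,
    so \<open>m = 1\<close> and \<open>m * p = p\<close> is not an integer.\<close>
  define o1 where "o1 = (\<lambda>i. if i < d then 1 else undefined :: real)"
  define o0 where "o0 = (\<lambda>i. if i < d then 0 else undefined :: real)"
  define j0 where "j0 = {o0, o1}"
  have o: "o0 \<in> cube d" "o1 \<in> cube d" by (rule cubeI; simp add: o0_def o1_def)+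
  have "o0 0 \<noteq> o1 0" using d by (simp add: o0_def o1_def)
  then have "o0 \<noteq> o1" by auto
  then have j0: "j0 \<in> vertex_pairs d" using o by (simp add: vertex_pairs_def j0_def)
  have "w1 j0 i \<noteq> w2 j0 i" if "i < d" for i
  proof -
    have "{w1 j0, w2 j0} = {o0, o1}" using pair_eq(1)[OF j0] by (simp add: j0_def)
    then have "w1 j0 = o0 \<and> w2 j0 = o1 \<or> w1 j0 = o1 \<and> w2 j0 = o0" by (auto simp: doubleton_eq_iff)
    then show ?thesis using that by (auto simp: o0_def o1_def)
  qed
  then have top1: "cube_pair.top_face d (w1 j0) (w2 j0) = {w1 j0}"
    by (rule cube_pair.top_face_antipodal[OF cp[OF j0]])
  have pZ: "p \<notin> \<int>"
  proof
    assume "p \<in> \<int>"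
    then obtain k :: int where k: "p = of_int k" by (auto elim: Ints_cases)
    then have "p = of_nat (nat k)" using p(1) by simp
    then show False using p(2) by (metis of_nat_in_Nats)
  qed
  have "\<exists>N\<ge>2 ^ d + 1. (\<Sum>B\<in>vertex_pairs d. Re (LINT h|torus_measure d. powr_coeff (of_real (p - 1)) (\<Phi> B h) (\<Psi> B h) N)) < 0"
  proof (rule ex_negative_coeff[where m = "\<lambda>B. card (cube_pair.top_face d (w1 B) (w2 B))"])
    show "monic_poly_family (torus_measure d) (card (cube_pair.top_face d (w1 B) (w2 B))) (cube_pair.coeff_bound d) (\<Phi> B) (\<Psi> B)"
      if "B \<in> vertex_pairs d" for B
      unfolding \<Phi>_def \<Psi>_def by (rule cube_pair.monic_extremal_family[OF cp[OF that]])
    show "real (card (cube_pair.top_face d (w1 j0) (w2 j0))) * p \<notin> \<int>" using pZ by (simp add: top1)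
  qed (use j0 finite_vertex_pairs in auto)
  then obtain N where N: "N \<ge> 2 ^ d + 1" and neg: "(\<Sum>B\<in>vertex_pairs d. a N B) < 0" unfolding a_def by blast
  have N': "N > 2 ^ d" using N by simp
  define R where "R = (\<lambda>\<alpha>. cos_avg d (cube d) \<alpha>)"
  define I where "I = (\<lambda>\<alpha> B. LINT h|torus_measure d. R \<alpha> h powr (p - 1) * wave_coeff d N \<alpha> B h)"
  \<comment> \<open>Here \<open>N\<close> is already fixed, and the constants depend on it. The
    factor 2 undoes the 1/2 of \<open>wave_coeff_pair\<close>.\<close>
  have "\<exists>C. \<forall>B\<in>vertex_pairs d. eventually (\<lambda>\<alpha>. \<bar>2 * I \<alpha> B - \<alpha> ^ (2 * N) * a N B\<bar> \<le> C B * \<alpha> ^ (2 * N + 2)) (at_right 0)"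
  proof (rule bchoice, rule ballI)
    fix B assume B: "B \<in> vertex_pairs d"
    interpret cube_pair d "w1 B" "w2 B" by (rule cp[OF B])
    obtain C \<alpha>0 where C: "\<alpha>0 > 0" "\<And>\<alpha>. 0 \<le> \<alpha> \<Longrightarrow> \<alpha> \<le> \<alpha>0 \<Longrightarrow>
      \<bar>(LINT h|torus_measure d. cos_avg d (cube d) \<alpha> h powr (p - 1) * (cos (2 * pi * (real N * dot d dir h)) * cos_avg d (cube d - {w1 B, w2 B}) \<alpha> h))
        - \<alpha> ^ (2 * N) * Re (LINT h|torus_measure d. powr_coeff (of_real (p - 1)) (extremal_avg (cube d) h) (extremal_avg (cube d - {w1 B, w2 B}) h) N)\<bar>
      \<le> C * \<alpha> ^ (2 * N + 2)"
      using cross_integral_asymptotic[of "p - 1" N] by blast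
    have wc: "wave_coeff d N \<alpha> B h = (1 / 2) * (cos (2 * pi * (real N * dot d dir h)) * cos_avg d (cube d - {w1 B, w2 B}) \<alpha> h)" for \<alpha> h
    proof -
      have "dot d dir h = dot d (w1 B) h - dot d (w2 B) h"
        by (simp add: dir_def[abs_def] dot_diff)
      then show ?thesis using wave_coeff_pair[OF N' pair_eq(2)[OF B], of \<alpha> h] pair_eq(1)[OF B] by simp
    qed
    have I2: "2 * I \<alpha> B = (LINT h|torus_measure d. cos_avg d (cube d) \<alpha> h powr (p - 1) * (cos (2 * pi * (real N * dot d dir h)) * cos_avg d (cube d - {w1 B, w2 B}) \<alpha> h))" for \<alpha>
    proof -
      have "2 * I \<alpha> B = (LINT h|torus_measure d. 2 * (R \<alpha> h powr (p - 1) * wave_coeff d N \<alpha> B h))"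
        unfolding I_def by (rule integral_mult_right_zero [symmetric])
      then show ?thesis by (simp add: wc R_def)
    qed
    have "eventually (\<lambda>\<alpha>. \<bar>2 * I \<alpha> B - \<alpha> ^ (2 * N) * a N B\<bar> \<le> C * \<alpha> ^ (2 * N + 2)) (at_right 0)"
    proof (rule eventually_at_rightI[OF _ C(1)])
      fix \<alpha> assume "\<alpha> \<in> {0<..<\<alpha>0}"
      then show "\<bar>2 * I \<alpha> B - \<alpha> ^ (2 * N) * a N B\<bar> \<le> C * \<alpha> ^ (2 * N + 2)"
        unfolding I2 a_def \<Phi>_def \<Psi>_def by (intro C(2)) auto
    qed
    then show "\<exists>C. eventually (\<lambda>\<alpha>. \<bar>2 * I \<alpha> B - \<alpha> ^ (2 * N) * a N B\<bar> \<le> C * \<alpha> ^ (2 * N + 2)) (at_right 0)" ..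
  qed
  then obtain C where C: "\<And>B. B \<in> vertex_pairs d \<Longrightarrow>
    eventually (\<lambda>\<alpha>. \<bar>2 * I \<alpha> B - \<alpha> ^ (2 * N) * a N B\<bar> \<le> C B * \<alpha> ^ (2 * N + 2)) (at_right 0)" by blast
  \<comment> \<open>Sum of the error constants: negativity is reached once
    \<open>S * \<alpha> ^ 2\<close> is below the absolute value of the negative leading sum.\<close>
  define S where "S = (\<Sum>B\<in>vertex_pairs d. C B)"
  define K where "K = real (card (balanced_pairs (cube d)))"
  have "eventually (\<lambda>\<alpha>. \<forall>B\<in>vertex_pairs d. \<bar>2 * I \<alpha> B - \<alpha> ^ (2 * N) * a N B\<bar> \<le> C B * \<alpha> ^ (2 * N + 2)) (at_right 0)"
    using C finite_vertex_pairs by (intro eventually_ball_finite) auto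
  moreover have "eventually (\<lambda>\<alpha>::real. 0 < \<alpha>) (at_right 0)"
    by (rule eventually_at_right_less)
  moreover have "eventually (\<lambda>\<alpha>::real. \<alpha> < 1 / 4) (at_right 0)"
    by (rule eventually_at_rightI[of 0 "1 / 4"]) auto
  moreover have "eventually (\<lambda>\<alpha>. K * \<alpha>\<^sup>2 < 1 / 2) (at_right 0)"
  proof -
    have "((\<lambda>\<alpha>. K * \<alpha>\<^sup>2) \<longlongrightarrow> 0) (at_right 0)" by (auto intro!: tendsto_eq_intros)
    then show ?thesis by (rule order_tendstoD) simp
  qed
  moreover have "eventually (\<lambda>\<alpha>. S * \<alpha>\<^sup>2 < - (\<Sum>B\<in>vertex_pairs d. a N B)) (at_right 0)"
  proof -
    have "((\<lambda>\<alpha>. S * \<alpha>\<^sup>2) \<longlongrightarrow> 0) (at_right 0)" by (auto intro!: tendsto_eq_intros)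
    then show ?thesis by (rule order_tendstoD) (use neg in simp)
  qed
  ultimately have "eventually (\<lambda>\<alpha>. (\<forall>B\<in>vertex_pairs d. \<bar>2 * I \<alpha> B - \<alpha> ^ (2 * N) * a N B\<bar> \<le> C B * \<alpha> ^ (2 * N + 2)) \<and>
    (0 < \<alpha> \<and> \<alpha> < 1 / 4) \<and> K * \<alpha>\<^sup>2 < 1 / 2 \<and> S * \<alpha>\<^sup>2 < - (\<Sum>B\<in>vertex_pairs d. a N B)) (at_right 0)"
    by (intro eventually_conj)
  then obtain \<alpha> where \<alpha>: "\<forall>B\<in>vertex_pairs d. \<bar>2 * I \<alpha> B - \<alpha> ^ (2 * N) * a N B\<bar> \<le> C B * \<alpha> ^ (2 * N + 2)"
    "0 < \<alpha>" "\<alpha> < 1 / 4" "K * \<alpha>\<^sup>2 < 1 / 2" "S * \<alpha>\<^sup>2 < - (\<Sum>B\<in>vertex_pairs d. a N B)"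
    using eventually_happens'[OF trivial_limit_at_right_real] by blast
  have Rb: "1 / 2 \<le> R \<alpha> h \<and> R \<alpha> h \<le> 3 / 2" for h
  proof -
    have "\<bar>R \<alpha> h - 1\<bar> \<le> K * \<alpha>\<^sup>2"
      unfolding R_def K_def using \<alpha> by (intro cos_avg_near_1 finite_cube) auto
    then show ?thesis using \<alpha>(4) by linarith
  qed
  have mR: "R \<alpha> \<in> borel_measurable (torus_measure d)"
    unfolding R_def by (intro measurable_cos_avg finite_cube)
  have "(LINT h|torus_measure d. R \<alpha> h powr (p - 1) * cross_term d N \<alpha> h) = (\<Sum>B\<in>vertex_pairs d. I \<alpha> B)"
    unfolding cross_term_def sum_distrib_left I_def
  proof (rule Bochner_Integration.integral_sum)
    fix B assume B: "B \<in> vertex_pairs d"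
    show "integrable (torus_measure d) (\<lambda>h. R \<alpha> h powr (p - 1) * wave_coeff d N \<alpha> B h)"
    proof (rule integrable_torus_bounded)
      show "(\<lambda>h. R \<alpha> h powr (p - 1) * wave_coeff d N \<alpha> B h) \<in> borel_measurable (torus_measure d)"
        using mR measurable_wave_coeff_pair[OF N' B, of \<alpha>] by measurable
      fix h
      have "\<bar>wave_coeff d N \<alpha> B h\<bar> \<le> 2 ^ card (cube d)"
        using B \<alpha> by (intro abs_wave_coeff_le) (auto simp: vertex_pairs_def)
      moreover have "R \<alpha> h powr (p - 1) \<le> (1 / 2) powr (p - 1) + (3 / 2) powr (p - 1)"
        using Rb[of h] by (intro powr_between_le) auto
      ultimately show "norm (R \<alpha> h powr (p - 1) * wave_coeff d N \<alpha> B h) \<le> ((1 / 2) powr (p - 1) + (3 / 2) powr (p - 1)) * 2 ^ card (cube d)"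
        unfolding real_norm_def abs_mult by (intro mult_mono) auto
    qed
  qed
  also have "\<dots> < 0"
  proof -
    have "(\<Sum>B\<in>vertex_pairs d. 2 * I \<alpha> B) \<le> (\<Sum>B\<in>vertex_pairs d. \<alpha> ^ (2 * N) * a N B + C B * \<alpha> ^ (2 * N + 2))"
    proof (rule sum_mono)
      fix B assume "B \<in> vertex_pairs d"
      then have "\<bar>2 * I \<alpha> B - \<alpha> ^ (2 * N) * a N B\<bar> \<le> C B * \<alpha> ^ (2 * N + 2)" using \<alpha>(1) by blast
      then show "2 * I \<alpha> B \<le> \<alpha> ^ (2 * N) * a N B + C B * \<alpha> ^ (2 * N + 2)" by linarith
    qed
    also have "\<dots> = \<alpha> ^ (2 * N) * ((\<Sum>B\<in>vertex_pairs d. a N B) + S * \<alpha>\<^sup>2)"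
      by (simp add: sum.distrib S_def power_add sum_distrib_left sum_distrib_right algebra_simps power2_eq_square)
    also have "\<dots> < 0" using \<alpha>(2,5) by (intro mult_pos_neg) auto
    finally show ?thesis by (simp flip: sum_distrib_left)
  qed
  finally show ?thesis using that[OF N' \<alpha>(2,3)] Rb unfolding R_def by blast
qed

text \<open>To second order the integral changes by \<open>p * b ^ 2\<close> times a negative
  number, and the error is of order \<open>\<bar>b\<bar> ^ 3\<close>. Both signs of \<open>b\<close>
  are covered, because the two perturbed functions differ only in that sign.\<close>

lemma integral_R_op_wave_less:
  fixes p :: real
  assumes p: "p > 0" and N: "N > 2 ^ d" and \<alpha>: "0 < \<alpha>" "\<alpha> < 1 / 4"
    and R: "\<And>h. 1 / 2 \<le> cos_avg d (cube d) \<alpha> h \<and> cos_avg d (cube d) \<alpha> h \<le> 3 / 2"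
    and neg: "(LINT h|torus_measure d. cos_avg d (cube d) \<alpha> h powr (p - 1) * cross_term d N \<alpha> h) < 0"
  obtains b0 where "b0 > 0" "\<And>b. 0 < \<bar>b\<bar> \<Longrightarrow> \<bar>b\<bar> < b0 \<Longrightarrow>
    (LINT h|torus_measure d. R_op d (wave N \<alpha> b) h powr p) < (LINT h|torus_measure d. cos_avg d (cube d) \<alpha> h powr p)"
proof -
  define R0 where "R0 = cos_avg d (cube d) \<alpha>"
  define Q where "Q = cross_term d N \<alpha>"
  define I where "I = (LINT h|torus_measure d. R0 h powr (p - 1) * Q h)"
  have I: "I < 0" using neg by (simp add: I_def R0_def Q_def)
  define KQ where "KQ = real (card (vertex_pairs d)) * 2 ^ card (cube d)"
  define K where "K = (2 ^ card (cube d) * 2 ^ card (cube d) :: real)"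
  have K: "K \<ge> 0" "KQ \<ge> 0" by (auto simp: K_def KQ_def)
  have Q: "\<bar>Q h\<bar> \<le> KQ" for h unfolding Q_def KQ_def using \<alpha> by (intro abs_cross_term_le) auto
  have R0: "1 / 2 \<le> R0 h" "R0 h \<le> 3 / 2" for h using R by (auto simp: R0_def)
  define M1 where "M1 = (1 / 2) powr p + (3 / 2) powr p"
  define M2 where "M2 = (1 / 2) powr (p - 1) + (3 / 2) powr (p - 1)"
  have M: "M1 \<ge> 0" "M2 \<ge> 0" by (auto simp: M1_def M2_def)
  have R0p: "R0 h powr p \<le> M1" "R0 h powr (p - 1) \<le> M2" for h
    unfolding M1_def M2_def using R0 by (auto intro!: powr_between_le)
  obtain C where C: "C \<ge> 0" "\<And>y. \<bar>y\<bar> \<le> 1 / 2 \<Longrightarrow> \<bar>(1 + y) powr p - (\<Sum>k\<le>1. (p gchoose k) * y ^ k)\<bar> \<le> C * \<bar>y\<bar> ^ (1 + 1)"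
    using powr_binomial_remainder by blast
  \<comment> \<open>\<open>L * b ^ 2\<close> bounds the change of \<open>R0\<close>. In
    \<open>E\<close> the first summand stems from the cubic remainder of
    \<open>R_op_wave_expansion\<close>, the second from the quadratic remainder of the power;
    \<open>2 * L\<close> appears because \<open>R0 \<ge> 1 / 2\<close>.\<close>
  define L where "L = KQ + K"
  define E where "E = p * M2 * K + M1 * C * (2 * L)\<^sup>2"
  have E: "E \<ge> 0" using K M C p by (auto simp: E_def)
  have L: "L \<ge> 0" using K by (simp add: L_def)
  \<comment> \<open>The three bounds serve, in this order, to compare powers of \<open>b\<close>, to
    keep the relative change \<open>y\<close> within 1/2, and to let the negative term win.\<close>
  define b0 where "b0 = min (min 1 (1 / (4 * (L + 1)))) (p * (- I) / (E + 1))"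
  have mR0: "R0 \<in> borel_measurable (torus_measure d)"
    unfolding R0_def by (intro measurable_cos_avg finite_cube)
  have mQ: "Q \<in> borel_measurable (torus_measure d)" unfolding Q_def by (rule measurable_cross_term[OF N])
  have i0: "integrable (torus_measure d) (\<lambda>h. R0 h powr p)"
  proof (rule integrable_torus_bounded)
    show "(\<lambda>h. R0 h powr p) \<in> borel_measurable (torus_measure d)" using mR0 by measurable
    show "norm (R0 h powr p) \<le> M1" for h using R0p(1) by simp
  qed
  have iQ: "integrable (torus_measure d) (\<lambda>h. R0 h powr (p - 1) * Q h)"
  proof (rule integrable_torus_bounded)
    show "(\<lambda>h. R0 h powr (p - 1) * Q h) \<in> borel_measurable (torus_measure d)" using mR0 mQ by measurable
    show "norm (R0 h powr (p - 1) * Q h) \<le> M2 * KQ" for h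
      unfolding real_norm_def abs_mult using R0p(2) Q M by (intro mult_mono) auto
  qed
  have "p * (- I) / (E + 1) > 0" using I E p by (intro divide_pos_pos mult_pos_pos) auto
  moreover have "1 / (4 * (L + 1)) > 0" using L by simp
  ultimately have "b0 > 0" unfolding b0_def by (simp only: min_less_iff_conj zero_less_one simp_thms)
  then show ?thesis
  proof (rule that, unfold R0_def[symmetric])
    fix b :: real assume b: "0 < \<bar>b\<bar>" "\<bar>b\<bar> < b0"
    have b1: "\<bar>b\<bar> \<le> 1" "\<bar>b\<bar> \<le> 1 / (4 * (L + 1))" "\<bar>b\<bar> < p * (- I) / (E + 1)" using b(2) by (auto simp: b0_def)
    define Rb where "Rb = R_op d (wave N \<alpha> b)"
    \<comment> \<open>The first claim carries the estimate; the second, whose bound is free of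
      \<open>h\<close>, yields integrability.\<close>
    have pointwise: "Rb h powr p \<le> R0 h powr p + p * b\<^sup>2 * (R0 h powr (p - 1) * Q h) + E * \<bar>b\<bar> ^ 3"
      and bounded: "Rb h powr p \<le> M1 + p * KQ * M2 + E" for h
    proof -
      define \<Delta> where "\<Delta> = Rb h - R0 h"
      have exp: "\<bar>\<Delta> - b\<^sup>2 * Q h\<bar> \<le> K * \<bar>b\<bar> ^ 3"
        using R_op_wave_expansion[OF N, of \<alpha> b h] \<alpha> b1 unfolding \<Delta>_def Rb_def R0_def Q_def cross_term_def K_def by simp
      have b3: "\<bar>b\<bar> ^ 3 \<le> b\<^sup>2" using b1 power_decreasing[of 2 3 "\<bar>b\<bar>"] by simp
      have D: "\<bar>\<Delta>\<bar> \<le> L * b\<^sup>2"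
      proof -
        have "\<bar>b\<^sup>2 * Q h\<bar> \<le> b\<^sup>2 * KQ" using Q by (simp add: abs_mult mult_left_mono)
        moreover have "K * \<bar>b\<bar> ^ 3 \<le> K * b\<^sup>2" using b3 K by (intro mult_left_mono)
        ultimately have "\<bar>\<Delta>\<bar> \<le> b\<^sup>2 * KQ + K * b\<^sup>2" using exp by linarith
        then show ?thesis by (simp add: L_def algebra_simps)
      qed
      define y where "y = \<Delta> / R0 h"
      have y: "\<bar>y\<bar> \<le> 2 * L * b\<^sup>2"
      proof -
        have "\<bar>y\<bar> = \<bar>\<Delta>\<bar> / R0 h" using R0[of h] by (simp add: y_def)
        also have "\<dots> \<le> \<bar>\<Delta>\<bar> / (1 / 2)" using R0[of h] by (intro divide_left_mono) auto
        also have "\<dots> \<le> 2 * L * b\<^sup>2" using D by simp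
        finally show ?thesis .
      qed
      have b2: "b\<^sup>2 \<le> \<bar>b\<bar>" using b1 power_decreasing[of 1 2 "\<bar>b\<bar>"] by simp
      have yb: "\<bar>y\<bar> \<le> 2 * L * \<bar>b\<bar>"
        using y b2 L mult_left_mono[OF b2, of "2 * L"] by linarith
      have yhalf: "\<bar>y\<bar> \<le> 1 / 2"
      proof -
        have "2 * L * \<bar>b\<bar> \<le> 2 * L * (1 / (4 * (L + 1)))" using b1 L by (intro mult_left_mono) auto
        also have "\<dots> \<le> 1 / 2" using L by (simp add: field_simps)
        finally show ?thesis using yb by linarith
      qed
      have eq: "Rb h = R0 h * (1 + y)" using R0[of h] by (simp add: y_def \<Delta>_def field_simps)
      have pw: "Rb h powr p = R0 h powr p * (1 + y) powr p"
        unfolding eq by (rule powr_mult)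
      have "(1 + y) powr p \<le> 1 + p * y + C * y\<^sup>2" using C(2)[OF yhalf] by (simp add: power2_eq_square abs_le_iff)
      moreover have y2: "y\<^sup>2 \<le> (2 * L)\<^sup>2 * \<bar>b\<bar> ^ 3"
      proof -
        have "y\<^sup>2 \<le> (2 * L * b\<^sup>2)\<^sup>2" using power_mono[OF y abs_ge_zero, of 2] by simp
        also have "\<dots> = (2 * L)\<^sup>2 * \<bar>b\<bar> ^ 4" by (simp add: power_mult_distrib)
        also have "\<dots> \<le> (2 * L)\<^sup>2 * \<bar>b\<bar> ^ 3" using b1 by (intro mult_left_mono power_decreasing) auto
        finally show ?thesis .
      qed
      ultimately have "Rb h powr p \<le> R0 h powr p * (1 + p * y + C * ((2 * L)\<^sup>2 * \<bar>b\<bar> ^ 3))"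
        unfolding pw using C(1) mult_left_mono[OF y2 C(1)] by (intro mult_left_mono) auto
      also have "\<dots> = R0 h powr p + p * (R0 h powr p * y) + R0 h powr p * (C * ((2 * L)\<^sup>2 * \<bar>b\<bar> ^ 3))"
        by (simp add: algebra_simps)
      also have "R0 h powr p * y = R0 h powr (p - 1) * \<Delta>"
        using R0[of h] by (simp add: y_def powr_diff)
      also have "R0 h powr p * (C * ((2 * L)\<^sup>2 * \<bar>b\<bar> ^ 3)) \<le> M1 * (C * ((2 * L)\<^sup>2 * \<bar>b\<bar> ^ 3))"
        using R0p(1) C(1) by (intro mult_right_mono) auto
      also have "R0 h powr (p - 1) * \<Delta> \<le> R0 h powr (p - 1) * (b\<^sup>2 * Q h) + M2 * (K * \<bar>b\<bar> ^ 3)"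
      proof -
        have "R0 h powr (p - 1) * (\<Delta> - b\<^sup>2 * Q h) \<le> R0 h powr (p - 1) * (K * \<bar>b\<bar> ^ 3)"
          using exp by (intro mult_left_mono) auto
        also have "\<dots> \<le> M2 * (K * \<bar>b\<bar> ^ 3)" using R0p(2) K by (intro mult_right_mono) auto
        finally show ?thesis by (simp add: algebra_simps)
      qed
      finally show r: "Rb h powr p \<le> R0 h powr p + p * b\<^sup>2 * (R0 h powr (p - 1) * Q h) + E * \<bar>b\<bar> ^ 3"
        using p by (simp add: E_def algebra_simps)
      have "p * b\<^sup>2 * (R0 h powr (p - 1) * Q h) \<le> p * KQ * M2"
      proof -
        have "\<bar>b\<^sup>2 * (R0 h powr (p - 1) * Q h)\<bar> \<le> 1 * (M2 * KQ)"
          unfolding abs_mult using R0p(2) Q M b1 by (intro mult_mono) (auto simp: abs_square_le_1)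
        then have "b\<^sup>2 * (R0 h powr (p - 1) * Q h) \<le> M2 * KQ" by linarith
        then have "p * (b\<^sup>2 * (R0 h powr (p - 1) * Q h)) \<le> p * (M2 * KQ)" using p by (intro mult_left_mono) auto
        then show ?thesis by (simp only: mult_ac)
      qed
      moreover have "E * \<bar>b\<bar> ^ 3 \<le> E" using E b1 by (simp add: mult_left_le power_le_one)
      ultimately show "Rb h powr p \<le> M1 + p * KQ * M2 + E" using r R0p(1)[of h] by linarith
    qed
    have mRb: "Rb \<in> borel_measurable (torus_measure d)"
      unfolding Rb_def by (intro measurable_R_op borel_measurable_continuous_onI) (auto simp: wave_def[abs_def] intro!: continuous_intros)
    have iRb: "integrable (torus_measure d) (\<lambda>h. Rb h powr p)"
    proof (rule integrable_torus_bounded)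
      show "(\<lambda>h. Rb h powr p) \<in> borel_measurable (torus_measure d)" using mRb by measurable
      show "norm (Rb h powr p) \<le> M1 + p * KQ * M2 + E" for h using bounded[of h] by simp
    qed
    have ic: "integrable (torus_measure d) (\<lambda>h. E * \<bar>b\<bar> ^ 3)" by (rule integrable_torus_bounded) auto
    have "(LINT h|torus_measure d. Rb h powr p) \<le>
      (LINT h|torus_measure d. R0 h powr p + p * b\<^sup>2 * (R0 h powr (p - 1) * Q h) + E * \<bar>b\<bar> ^ 3)"
      by (intro integral_mono iRb Bochner_Integration.integrable_add i0 ic integrable_mult_right iQ pointwise)
    also have "\<dots> = (LINT h|torus_measure d. R0 h powr p) + p * b\<^sup>2 * I + E * \<bar>b\<bar> ^ 3"
      by (subst Bochner_Integration.integral_add,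
          (intro Bochner_Integration.integrable_add i0 ic integrable_mult_right iQ)+)+
        (simp add: I_def measure_torus)
    finally have le: "(LINT h|torus_measure d. Rb h powr p) \<le> (LINT h|torus_measure d. R0 h powr p) + p * b\<^sup>2 * I + E * \<bar>b\<bar> ^ 3" .
    have "p * b\<^sup>2 * I + E * \<bar>b\<bar> ^ 3 < 0"
    proof -
      have "\<bar>b\<bar> * (E + 1) < p * (- I)" using b1(3) E pos_less_divide_eq[of "E + 1" "\<bar>b\<bar>" "p * (- I)"] by (simp only:)
      then have "\<bar>b\<bar> * E < p * (- I)" using b(1) by (simp add: algebra_simps)
      then have "b\<^sup>2 * (p * I + \<bar>b\<bar> * E) < 0" using b(1) by (intro mult_pos_neg) auto
      moreover have "\<bar>b\<bar> ^ 3 = b\<^sup>2 * \<bar>b\<bar>" by (simp only: power3_eq_cube power2_eq_square abs_mult_self_eq)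
      ultimately show ?thesis by (simp add: algebra_simps)
    qed
    with le show "(LINT h|torus_measure d. R_op d (wave N \<alpha> b) h powr p) < (LINT h|torus_measure d. R0 h powr p)"
      unfolding Rb_def by linarith
  qed
qed

section \<open>Scaling, monotonicity and the conclusion\<close>

lemma R_op_wave_0: "R_op d (wave N \<alpha> 0) = cos_avg d (cube d) \<alpha>"
  by (simp add: R_op_eq wave_def cos_avg_def cos_prod_def[abs_def] fun_eq_iff)

text \<open>Each of the \<open>2 ^ d\<close> factors contributes a 2, and the outer exponent
  \<open>1 / (2 ^ d * p)\<close> undoes both powers.\<close>

lemma U_norm_scale_2:
  assumes "p > 0"
  shows "U_norm d p (\<lambda>x. 2 * f x) = 2 * U_norm d p f"
proof -
  define c where "c = (2 ^ 2 ^ d :: real)"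
  define r where "r = 1 / (2 ^ d * p)"
  have "R_op d (\<lambda>x. 2 * f x) h = c * R_op d f h" for h
    by (simp add: R_op_eq prod.distrib card_cube c_def)
  then have "(LINT h|torus_measure d. R_op d (\<lambda>x. 2 * f x) h powr p) = c powr p * (LINT h|torus_measure d. R_op d f h powr p)"
    by (simp add: powr_mult)
  then have "U_norm d p (\<lambda>x. 2 * f x) = (c powr p) powr r * U_norm d p f"
    by (simp add: U_norm_def powr_mult r_def)
  also have "(c powr p) powr r = c powr (1 / 2 ^ d)"
    using assms by (simp add: powr_powr r_def)
  also have "c = 2 powr (2 ^ d)" by (simp add: c_def flip: powr_realpow)
  also have "(2 powr (2 ^ d)) powr (1 / 2 ^ d) = (2::real)" by (simp add: powr_powr)
  finally show ?thesis .
qed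

lemma U_norm_less:
  assumes "p > 0" and "(LINT h|torus_measure d. R_op d f h powr p) < (LINT h|torus_measure d. R_op d g h powr p)"
  shows "U_norm d p f < U_norm d p g"
  unfolding U_norm_def using assms
  by (intro powr_less_mono2) (auto intro: Bochner_Integration.integral_nonneg)

theorem propositionB1:
  fixes d :: nat and p :: real
  assumes "d \<ge> 2" and "p > 0" and "p \<notin> \<nat>"
  shows "\<exists>(N::nat) (a::real) (b::real). N \<ge> 1 \<and> a > 0 \<and> b > 0 \<and> a + b < 1 \<and>
    (let f1 = (\<lambda>x::real. 1 + a * cos (2 * pi * x) + b * cos (2 * real N * pi * x));
         f2 = (\<lambda>x::real. 1 + a * cos (2 * pi * x) - b * cos (2 * real N * pi * x))
     in U_norm d p (\<lambda>x. f1 x + f2 x) > U_norm d p f1 + U_norm d p f2)"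
proof -
  have "d \<ge> 1" using assms(1) by simp
  then obtain N \<alpha> where N: "N > 2 ^ d" and \<alpha>: "0 < \<alpha>" "\<alpha> < 1 / 4"
    and *: "\<And>h. 1 / 2 \<le> cos_avg d (cube d) \<alpha> h \<and> cos_avg d (cube d) \<alpha> h \<le> 3 / 2"
      "(LINT h|torus_measure d. cos_avg d (cube d) \<alpha> h powr (p - 1) * cross_term d N \<alpha> h) < 0"
    using ex_negative_cross_term[OF assms(2,3)] by blast
  obtain b0 where b0: "b0 > 0" "\<And>b. 0 < \<bar>b\<bar> \<Longrightarrow> \<bar>b\<bar> < b0 \<Longrightarrow>
    (LINT h|torus_measure d. R_op d (wave N \<alpha> b) h powr p) < (LINT h|torus_measure d. cos_avg d (cube d) \<alpha> h powr p)"
    using integral_R_op_wave_less[OF assms(2) N \<alpha> *] by blast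
  \<comment> \<open>Since \<open>a = 2 * \<alpha> < 1 / 2\<close>, the cap 1/4 secures
    \<open>a + b < 1\<close>; halving \<open>b0\<close> makes \<open>b < b0\<close> strict.\<close>
  define b where "b = min (b0 / 2) (1 / 4)"
  have b: "0 < b" "b < b0" "b \<le> 1 / 4" using b0(1) by (auto simp: b_def)
  have less: "U_norm d p (wave N \<alpha> b') < U_norm d p (wave N \<alpha> 0)" if "\<bar>b'\<bar> = b" for b'
    using that b b0(2)[of b'] by (intro U_norm_less assms(2)) (simp add: R_op_wave_0)
  have f1: "(\<lambda>x. 1 + 2 * \<alpha> * cos (2 * pi * x) + b * cos (2 * real N * pi * x)) = wave N \<alpha> b"
    and f2: "(\<lambda>x. 1 + 2 * \<alpha> * cos (2 * pi * x) - b * cos (2 * real N * pi * x)) = wave N \<alpha> (- b)"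
    by (simp_all add: wave_def fun_eq_iff mult_ac)
  have "U_norm d p (wave N \<alpha> b) + U_norm d p (wave N \<alpha> (- b)) < 2 * U_norm d p (wave N \<alpha> 0)"
    using less[of b] less[of "- b"] b(1) by simp
  also have "\<dots> = U_norm d p (\<lambda>x. 2 * wave N \<alpha> 0 x)" using U_norm_scale_2[OF assms(2)] by simp
  \<comment> \<open>The perturbations cancel in the sum, which is twice the unperturbed
    function.\<close>
  also have "(\<lambda>x. 2 * wave N \<alpha> 0 x) = (\<lambda>x. wave N \<alpha> b x + wave N \<alpha> (- b) x)"
    by (simp add: wave_def fun_eq_iff)
  finally have main: "U_norm d p (wave N \<alpha> b) + U_norm d p (wave N \<alpha> (- b)) < U_norm d p (\<lambda>x. wave N \<alpha> b x + wave N \<alpha> (- b) x)" .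
  show ?thesis
  proof (intro exI conjI)
    show "N \<ge> 1" using N by simp
    show "2 * \<alpha> > 0" "b > 0" "2 * \<alpha> + b < 1" using \<alpha> b by auto
    show "let f1 = (\<lambda>x::real. 1 + 2 * \<alpha> * cos (2 * pi * x) + b * cos (2 * real N * pi * x));
         f2 = (\<lambda>x::real. 1 + 2 * \<alpha> * cos (2 * pi * x) - b * cos (2 * real N * pi * x))
     in U_norm d p (\<lambda>x. f1 x + f2 x) > U_norm d p f1 + U_norm d p f2"
      unfolding Let_def using main unfolding f1[symmetric] f2[symmetric] .
  qed
qed

end
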